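(* Let $S^2$ be the sphere and $T^2$ the torus, and let $f:S^2\to S^2$, $p:T^2\to S^2$, $q:T^2\to T^2$ be branched covering maps such that $\deg f\ge2$ and $f\circ p=p\circ q$. Then there exists an orbifold $\mathcal O$ on $S^2$ with zero Euler characteristic such that $q:\mathcal T^2\to\mathcal T^2$, $p:\mathcal T^2\to\mathcal O$ and $f:\mathcal O\to\mathcal O$ are all covering maps between orbifolds, where $\mathcal T^2$ denotes the non-ramified orbifold on $T^2$.
   Context: A surface is an oriented connected two-dimensional topological manifold without boundary. A continuous map $f:R\to C$ between surfaces is a branched covering map if every $y\in C$ has an open neighborhood $V$ such that $f^{-1}(V)$ is a disjoint union of open sets $U_i$, $i\in I$ ($I\neq\emptyset$), each $U_i$ contains exactly one point $x_i$ of $f^{-1}\{y\}$, and there are orientation-preserving homeomorphisms $\varphi_i:U_i\to\mathbb D$, $\psi_i:V\to\mathbb D$ onto the open unit disk with $\varphi_i(x_i)=\psi_i(y)=0$ and $(\psi_i\circ f\circ\varphi_i^{-1})(z)=z^{d_i}$ for some integer $d_i\ge1$. The integer $d_i$ is the local degree $\deg_{x_i}f$; $\deg f$ is the global degree. An orbifold is a pair $\mathcal O=(R,\nu)$ of a surface $R$ and a function $\nu:R\to\mathbb N$ (positive integers) with $\nu(z)=1$ except at isolated points. For closed $R$ its Euler characteristic is $\chi(\mathcal O)=\chi(R)+\sum_{z\in R}\left(\frac1{\nu(z)}-1\right)$. The non-ramified orbifold on a surface $S$ is $(S,\nu)$ with $\nu\equiv1$. For a branched covering map $f:R_1\to R_2$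 and orbifolds $\mathcal O_1=(R_1,\nu_1)$, $\mathcal O_2=(R_2,\nu_2)$, the map $f:\mathcal O_1\to\mathcal O_2$ is a covering map between orbifolds if $\nu_2(f(z))=\nu_1(z)\deg_zf$ for all $z\in R_1$. *)

theory Defs
  imports "HOL-Complex_Analysis.Complex_Analysis" "HOL-Homology.Homology"
begin

section \<open>Oriented surfaces\<close>

text \<open>
  A homeomorphism \<open>h\<close> between open subsets of the plane preserves orientation iff it maps small
  positively oriented circles to loops of winding number \<open>1\<close> around the image of the centre.
  (\<open>winding_number\<close> is meaningful for all continuous loops, not only rectifiable ones.)
\<close>

definition orientation_preserving_on :: "complex set \<Rightarrow> (complex \<Rightarrow> complex) \<Rightarrow> bool" where
  "orientation_preserving_on D h \<longleftrightarrow>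
     (\<forall>z r. 0 < r \<and> cball z r \<subseteq> D \<longrightarrow> winding_number (h \<circ> circlepath z r) (h z) = 1)"

text \<open>A chart is a pair of its domain and its coordinate function; the values of the latter outside
  the domain are irrelevant.\<close>

type_synonym 'a chart = "'a set \<times> ('a \<Rightarrow> complex)"

record 'a surface =
  surf_top :: "'a topology"
  surf_atlas :: "'a chart set"

definition is_chart :: "'a topology \<Rightarrow> 'a chart \<Rightarrow> bool" where
  "is_chart X = (\<lambda>(U, \<phi>). openin X U \<and> open (\<phi> ` U) \<and>
     homeomorphic_map (subtopology X U) (top_of_set (\<phi> ` U)) \<phi>)"

definition oriented_compatible :: "'a chart \<Rightarrow> 'a chart \<Rightarrow> bool" where
  "oriented_compatible = (\<lambda>(U, \<phi>) (W, \<psi>).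
     orientation_preserving_on (\<psi> ` (U \<inter> W)) (\<phi> \<circ> inv_into W \<psi>))"

text \<open>The orientation is given by an oriented atlas, which need not be maximal.\<close>

definition oriented_surface :: "'a surface \<Rightarrow> bool" where
  "oriented_surface R \<longleftrightarrow>
     topspace (surf_top R) \<noteq> {} \<and>
     Hausdorff_space (surf_top R) \<and> second_countable (surf_top R) \<and>
     connected_space (surf_top R) \<and>
     (\<forall>c \<in> surf_atlas R. is_chart (surf_top R) c) \<and>
     (\<Union>(U, \<phi>) \<in> surf_atlas R. U) = topspace (surf_top R) \<and>
     (\<forall>c \<in> surf_atlas R. \<forall>c' \<in> surf_atlas R. oriented_compatible c c')"

text \<open>\<open>\<phi>\<close> is an orientation-preserving homeomorphism from the open set \<open>U\<close> onto the unit disk.\<close>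

definition disk_chart :: "'a surface \<Rightarrow> 'a set \<Rightarrow> ('a \<Rightarrow> complex) \<Rightarrow> bool" where
  "disk_chart R U \<phi> \<longleftrightarrow>
     is_chart (surf_top R) (U, \<phi>) \<and> \<phi> ` U = ball 0 1 \<and>
     (\<forall>c \<in> surf_atlas R. oriented_compatible (U, \<phi>) c)"

section \<open>Branched covering maps\<close>

text \<open>In the disk coordinates \<open>\<phi>\<close> around \<open>x\<close> and \<open>\<psi>\<close> around \<open>f x\<close>, the map \<open>f\<close> is
  \<open>z \<mapsto> z ^ d\<close>, that is, \<open>\<psi> \<circ> f = (\<lambda>z. z ^ d) \<circ> \<phi>\<close> on \<open>U\<close>.\<close>

definition power_form ::
  "'a surface \<Rightarrow> 'b surface \<Rightarrow> ('a \<Rightarrow> 'b) \<Rightarrow> 'a \<Rightarrow> 'a set \<Rightarrow> 'b set \<Rightarrow> nat \<Rightarrow> bool" where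
  "power_form R C f x U V d \<longleftrightarrow> d \<ge> 1 \<and> x \<in> U \<and> f ` U \<subseteq> V \<and>
     (\<exists>\<phi> \<psi>. disk_chart R U \<phi> \<and> disk_chart C V \<psi> \<and> \<phi> x = 0 \<and> \<psi> (f x) = 0 \<and>
        (\<forall>u \<in> U. \<psi> (f u) = \<phi> u ^ d))"

definition fibre :: "'a surface \<Rightarrow> ('a \<Rightarrow> 'b) \<Rightarrow> 'b \<Rightarrow> 'a set" where
  "fibre R f y = {x \<in> topspace (surf_top R). f x = y}"

definition branched_covering :: "'a surface \<Rightarrow> 'b surface \<Rightarrow> ('a \<Rightarrow> 'b) \<Rightarrow> bool" where
  "branched_covering R C f \<longleftrightarrow>
     oriented_surface R \<and> oriented_surface C \<and>
     continuous_map (surf_top R) (surf_top C) f \<and>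
     (\<forall>y \<in> topspace (surf_top C). \<exists>V \<U>.
        openin (surf_top C) V \<and> y \<in> V \<and>
        \<U> \<noteq> {} \<and> disjoint \<U> \<and> (\<forall>U \<in> \<U>. openin (surf_top R) U) \<and>
        \<Union>\<U> = {x \<in> topspace (surf_top R). f x \<in> V} \<and>
        (\<forall>U \<in> \<U>. \<exists>x d. U \<inter> fibre R f y = {x} \<and> power_form R C f x U V d))"

definition local_degree :: "'a surface \<Rightarrow> 'b surface \<Rightarrow> ('a \<Rightarrow> 'b) \<Rightarrow> 'a \<Rightarrow> nat" where
  "local_degree R C f x = (THE d. \<exists>U V. power_form R C f x U V d)"

text \<open>The global degree is the number of preimages, counted with multiplicity, of any point of the
  target. It is defined for maps with finite fibres, such as those between closed surfaces.\<close>

definition global_degree :: "'a surface \<Rightarrow> 'b surface \<Rightarrow> ('a \<Rightarrow> 'b) \<Rightarrow> nat" where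
  "global_degree R C f = (THE n. \<forall>y \<in> topspace (surf_top C).
     finite (fibre R f y) \<and> (\<Sum>x \<in> fibre R f y. local_degree R C f x) = n)"

section \<open>Euler characteristic\<close>

definition int_independent :: "('g, 'm) monoid_scheme \<Rightarrow> 'g set \<Rightarrow> bool" where
  "int_independent G B \<longleftrightarrow> finite B \<and> B \<subseteq> carrier G \<and>
     (\<forall>c :: 'g \<Rightarrow> int. finprod G (\<lambda>b. b [^]\<^bsub>G\<^esub> c b) B = \<one>\<^bsub>G\<^esub> \<longrightarrow> (\<forall>b \<in> B. c b = 0))"

text \<open>The rank of an abelian group (written multiplicatively), assumed to be finite.\<close>

definition ab_rank :: "('g, 'm) monoid_scheme \<Rightarrow> nat" where
  "ab_rank G = Sup {card B | B. int_independent G B}"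

definition betti :: "nat \<Rightarrow> 'a topology \<Rightarrow> nat" where
  "betti k X = ab_rank (homology_group (int k) X)"

definition euler_char :: "'a topology \<Rightarrow> int" where
  "euler_char X = (\<Sum>k | betti k X \<noteq> 0. (- 1) ^ k * int (betti k X))"

section \<open>Orbifolds\<close>

type_synonym 'a orbifold = "'a surface \<times> ('a \<Rightarrow> nat)"

text \<open>Isolatedness is meant in the surface: the points with \<open>\<nu> z \<noteq> 1\<close> have no accumulation point,
  so on a closed surface there are only finitely many of them.\<close>

definition is_orbifold :: "'a orbifold \<Rightarrow> bool" where
  "is_orbifold = (\<lambda>(R, \<nu>). oriented_surface R \<and>
     (\<forall>z \<in> topspace (surf_top R). \<nu> z \<ge> 1) \<and>
     surf_top R derived_set_of {z \<in> topspace (surf_top R). \<nu> z \<noteq> 1} = {})"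

definition orbifold_euler_char :: "'a orbifold \<Rightarrow> real" where
  "orbifold_euler_char = (\<lambda>(R, \<nu>). of_int (euler_char (surf_top R)) +
     (\<Sum>z | z \<in> topspace (surf_top R) \<and> \<nu> z \<noteq> 1. 1 / real (\<nu> z) - 1))"

definition nonramified :: "'a surface \<Rightarrow> 'a orbifold" where
  "nonramified R = (R, \<lambda>_. 1)"

definition orbifold_covering :: "'a orbifold \<Rightarrow> 'b orbifold \<Rightarrow> ('a \<Rightarrow> 'b) \<Rightarrow> bool" where
  "orbifold_covering = (\<lambda>(R1, \<nu>1) (R2, \<nu>2) f.
     is_orbifold (R1, \<nu>1) \<and> is_orbifold (R2, \<nu>2) \<and> branched_covering R1 R2 f \<and>
     (\<forall>z \<in> topspace (surf_top R1). \<nu>2 (f z) = \<nu>1 z * local_degree R1 R2 f z))"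

end

(*
  No orientation theory is needed. For a map g of the plane that looks like z ^ e up to local homeomorphisms,
  the loop g (z + h) - g z with a small fixed h winds eps * (e - 1) times around a critical point and
  -2 * eps times around a simple pole, where the local sign eps is constant on the connected set of all
  other points. If g is periodic up to additive constants, the total winding along the boundary of a period
  square vanishes. Applied to a lift of q this shows that q is unramified; applied to p composed with a chart
  of the punctured sphere it is the Riemann-Hurwitz formula "sum of (deg_x p - 1) = 2 deg p".

  Multiplicativity of local degrees gives deg_{q x} p = deg_{p x} f * deg_x p. The image of a generic fibre
  of p under q^k has a cardinality that does not depend on the fibre and decreases with k, hence is
  eventually constant. For large k it follows that every y over f^k z satisfies q^k y = q^(2k) x for some x
  over z, so that deg_y p = deg_z f^k * deg_x p. As q^k has (deg f)^k >= 2^k sheets, z can be chosen outside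
  the finitely many branch values of p, so deg_y p = deg_z f^k depends on p y only. This common value is
  the ramification function of the orbifold.
*)
theory Submission
  imports Defs
begin

section \<open>Winding numbers of differences\<close>

text \<open>Charts are only homeomorphisms, so no derivative is available whose zeros could be
  counted. The increment \<open>g (z + h) - g z\<close> takes over that role: additive periods of g
  cancel in it, and its indices follow from winding numbers alone. Near a critical point it behaves
  like h times a derivative with a zero of order e - 1; near a simple pole like -h divided by the
  square of the local coordinate, whence -2. Composing with a homeomorphism of a disc multiplies
  every such winding number by one nonzero constant, so comparing orientations reduces to showing
  that this constant does not vary over the plane. Multiplicities are treated without charts as
  well: they are recovered by counting preimages close to a point, which makes them unique and
  multiplicative under composition. The zero Euler characteristic comes from the same -2. Each of
  the deg p simple poles contributes it, and dividing the resulting identity by deg p turns the sum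
  over critical points into the sum of 1 / \<nu> - 1 over branch values, with value -2, against the
  Euler characteristic 2 of the sphere.\<close>

definition nz_path :: "(real \<Rightarrow> complex) \<Rightarrow> bool" where
  "nz_path p \<longleftrightarrow> continuous_on {0..1} p \<and> (\<forall>t\<in>{0..1}. p t \<noteq> 0)"

definition nz_loop :: "(real \<Rightarrow> complex) \<Rightarrow> bool" where
  "nz_loop p \<longleftrightarrow> nz_path p \<and> p 0 = p 1"

abbreviation wn :: "(real \<Rightarrow> complex) \<Rightarrow> complex" where
  "wn p \<equiv> winding_number p 0"

lemma nz_loopI:
  "continuous_on {0..1} p \<Longrightarrow> (\<And>t. t \<in> {0..1} \<Longrightarrow> p t \<noteq> 0) \<Longrightarrow> p 0 = p 1 \<Longrightarrow> nz_loop p"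
  by (auto simp: nz_loop_def nz_path_def)

lemma wn_exp:
  assumes "continuous_on {0..1} L" "\<And>t. t \<in> {0..1} \<Longrightarrow> p t = exp (L t)"
  shows "wn p = (L 1 - L 0) / (2 * of_real pi * \<i>)"
proof -
  have "wn p = wn (exp \<circ> L)"
    using assms by (intro winding_number_cong) auto
  also have "\<dots> = (L 1 - L 0) / (2 * of_real pi * \<i>)"
    using winding_number_compose_exp[of L] assms by (simp add: path_def pathstart_def pathfinish_def)
  finally show ?thesis .
qed

lemma nz_path_log:
  assumes "nz_path p"
  obtains L where "continuous_on {0..1} L" "\<And>t. t \<in> {0..1} \<Longrightarrow> p t = exp (L t)"
    "L 1 - L 0 = 2 * of_real pi * \<i> * wn p"
proof -
  have "path p" "0 \<notin> path_image p"
    using assms by (auto simp: nz_path_def path_def path_image_def)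
  then show ?thesis
    using winding_number_as_continuous_log[of p 0] that
    by (auto simp: path_def pathstart_def pathfinish_def)
qed

lemma wn_mult:
  assumes "nz_path p" "nz_path q"
  shows "wn (\<lambda>t. p t * q t) = wn p + wn q"
proof -
  obtain L where L: "continuous_on {0..1} L" "\<And>t. t \<in> {0..1} \<Longrightarrow> p t = exp (L t)"
    using nz_path_log[OF assms(1)] by metis
  obtain M where M: "continuous_on {0..1} M" "\<And>t. t \<in> {0..1} \<Longrightarrow> q t = exp (M t)"
    using nz_path_log[OF assms(2)] by metis
  have "wn (\<lambda>t. p t * q t) = ((L 1 + M 1) - (L 0 + M 0)) / (2 * of_real pi * \<i>)"
    by (rule wn_exp) (auto intro!: continuous_intros L M simp: L(2) M(2) exp_add)
  then show ?thesis
    using wn_exp[of L p] wn_exp[of M q] L M by (simp add: add_divide_distrib diff_divide_distrib)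
qed

lemma nz_path_mult: "nz_path p \<Longrightarrow> nz_path q \<Longrightarrow> nz_path (\<lambda>t. p t * q t)"
  by (auto simp: nz_path_def intro!: continuous_intros)

lemma nz_path_power: "nz_path p \<Longrightarrow> nz_path (\<lambda>t. p t ^ n)"
  by (auto simp: nz_path_def intro!: continuous_intros)

lemma nz_path_inverse: "nz_path p \<Longrightarrow> nz_path (\<lambda>t. inverse (p t))"
  by (auto simp: nz_path_def intro!: continuous_intros)

lemma nz_path_const: "c \<noteq> 0 \<Longrightarrow> nz_path (\<lambda>t. c)"
  by (auto simp: nz_path_def)

lemma wn_const: "c \<noteq> 0 \<Longrightarrow> wn (\<lambda>t. c) = 0"
  using winding_number_zero_const[of c 0] by simp

lemma wn_inverse:
  assumes "nz_path p"
  shows "wn (\<lambda>t. inverse (p t)) = - wn p"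
proof -
  have "wn (\<lambda>t. p t * inverse (p t)) = wn (\<lambda>t. 1)"
    using assms by (intro winding_number_cong) (auto simp: nz_path_def)
  then show ?thesis
    using wn_mult[OF assms nz_path_inverse[OF assms]] wn_const[of 1] by (simp add: add_eq_0_iff)
qed

lemma wn_power:
  assumes "nz_path p"
  shows "wn (\<lambda>t. p t ^ n) = of_nat n * wn p"
proof (induction n)
  case 0
  then show ?case using wn_const[of 1] by simp
next
  case (Suc n)
  then show ?case
    using wn_mult[OF assms nz_path_power[OF assms, of n]] by (simp add: algebra_simps)
qed

lemma wn_powi:
  assumes "nz_path p"
  shows "wn (\<lambda>t. p t powi n) = of_int n * wn p"
  using wn_power[OF assms] wn_inverse[OF nz_path_power[OF assms]]
  by (cases n rule: int_cases2) (auto simp: power_int_minus)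

lemma nz_path_powi: "nz_path p \<Longrightarrow> nz_path (\<lambda>t. p t powi n)"
  by (cases n rule: int_cases2)
    (auto simp: power_int_minus intro: nz_path_power nz_path_inverse)

lemma wn_scale: "c \<noteq> 0 \<Longrightarrow> nz_path p \<Longrightarrow> wn (\<lambda>t. c * p t) = wn p"
  using wn_mult[of "\<lambda>t. c" p] by (simp add: nz_path_const wn_const)

lemma wn_minus: "nz_path p \<Longrightarrow> wn (\<lambda>t. - p t) = wn p"
  using wn_scale[of "-1" p] by simp

lemma wn_int:
  assumes "nz_loop p"
  obtains m where "wn p = of_int m"
proof -
  have "path p" "0 \<notin> path_image p" "pathfinish p = pathstart p"
    using assms by (auto simp: nz_loop_def nz_path_def path_def path_image_def pathstart_def pathfinish_def)
  then have "wn p \<in> \<int>"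
    by (metis integer_winding_number)
  then show ?thesis
    using that by (auto elim: Ints_cases)
qed

lemma wn_homotopy:
  fixes H :: "real \<Rightarrow> real \<Rightarrow> complex"
  assumes cont: "continuous_on ({0..1} \<times> {0..1}) (\<lambda>(u,t). H u t)"
    and nz: "\<And>u t. u \<in> {0..1} \<Longrightarrow> t \<in> {0..1} \<Longrightarrow> H u t \<noteq> 0"
    and loop: "\<And>u. u \<in> {0..1} \<Longrightarrow> H u 0 = H u 1"
  shows "wn (H 0) = wn (H 1)"
proof (rule winding_number_homotopic_loops)
  show "homotopic_loops (- {0}) (H 0) (H 1)"
    unfolding homotopic_loops_def homotopic_with_def
    using assms
    by (intro exI[of _ "\<lambda>(u,t). H u t"]) (auto simp: pathstart_def pathfinish_def)
qed

lemma wn_nearby: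
  assumes "nz_loop p" "continuous_on {0..1} q" "q 0 = q 1"
    "\<And>t. t \<in> {0..1} \<Longrightarrow> cmod (q t - p t) < cmod (p t)"
  shows "wn q = wn p" "nz_loop q"
proof -
  show "wn q = wn p"
    by (rule winding_number_nearby_loops_eq)
      (use assms in \<open>auto simp: nz_loop_def nz_path_def path_def pathstart_def pathfinish_def\<close>)
  show "nz_loop q"
    using assms by (intro nz_loopI) (force simp: norm_minus_commute)+
qed

lemma circlepath_eq: "circlepath z r t = z + of_real r * exp (2 * of_real pi * \<i> * of_real t)"
  by (simp add: circlepath)

lemma circlepath_01: "circlepath z r 0 = circlepath z r 1"
  using exp_two_pi_i by (simp add: circlepath_eq)

lemma norm_circlepath: "0 \<le> r \<Longrightarrow> cmod (circlepath z r t - z) = r"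
  by (simp add: circlepath_eq norm_mult)

lemma continuous_on_circlepath [continuous_intros]: "continuous_on A (circlepath z r)"
  unfolding circlepath_eq[abs_def] by (intro continuous_intros)

lemma circlepath_wn: "0 < r \<Longrightarrow> wn (\<lambda>t. circlepath z r t - z) = 1"
  using winding_number_circlepath_centre[of r z] winding_number_offset[of "circlepath z r" z] by simp

text \<open>The logarithm of \<open>\<Phi>\<close> along the circle extends to the whole line and gains the same amount over
  each period.\<close>

lemma wn_circle_multiple:
  fixes \<Phi> :: "complex \<Rightarrow> complex"
  assumes cont: "continuous_on (sphere 0 r) \<Phi>" and nz: "\<And>z. z \<in> sphere 0 r \<Longrightarrow> \<Phi> z \<noteq> 0" and r: "r > 0"
  shows "wn (\<lambda>t. \<Phi> (of_real r * exp (2 * of_real pi * \<i> * of_int m * of_real t)))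
       = of_int m * wn (\<lambda>t. \<Phi> (circlepath 0 r t))"
proof -
  define c where "c x = of_real r * exp (2 * of_real pi * \<i> * of_real x)" for x :: real
  have cs: "c x \<in> sphere 0 r" for x
    using r by (simp add: c_def norm_mult)
  have contc: "continuous_on A c" for A
    unfolding c_def[abs_def] by (intro continuous_intros)
  have c1: "c (x + 1) = c x" for x
    using exp_two_pi_i by (simp add: c_def ring_distribs exp_add)
  have "continuous_on UNIV (\<lambda>x. \<Phi> (c x))"
    by (rule continuous_on_compose2[OF cont contc]) (use cs in auto)
  moreover have "contractible (UNIV :: real set)"
    by (simp add: contractible_UNIV)
  ultimately obtain L where L: "continuous_on UNIV L" "\<And>x. \<Phi> (c x) = exp (L x)"
    using continuous_logarithm_on_contractible[of UNIV "\<lambda>x. \<Phi> (c x)"] nz cs by (metis UNIV_I)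
  have per: "\<exists>n::int. L (x + 1) - L x = of_int n * (2 * of_real pi * \<i>)" for x
  proof -
    have "exp (L (x + 1)) = exp (L x)"
      using L(2) c1 by metis
    then show ?thesis
      by (auto simp: exp_eq algebra_simps)
  qed
  have "\<exists>k. \<forall>x\<in>UNIV. L (x + 1) - L x = k"
  proof -
    \<comment> \<open>The increments lie in 2 pi i Z, whose distinct elements are at least 2 pi
      apart; a continuous function with such values is constant.\<close>
    have ge: "\<exists>e>0. \<forall>y. y \<in> UNIV \<and> L (y + 1) - L y \<noteq> L (x + 1) - L x \<longrightarrow>
               e \<le> cmod ((L (y + 1) - L y) - (L (x + 1) - L x))" for x
    proof (intro exI[of _ "2*pi"] conjI allI impI)
      fix y assume *: "y \<in> UNIV \<and> L (y + 1) - L y \<noteq> L (x + 1) - L x"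
      obtain n m where nm: "L (x + 1) - L x = of_int n * (2 * of_real pi * \<i>)"
         "L (y + 1) - L y = of_int m * (2 * of_real pi * \<i>)"
        using per by metis
      then have "n \<noteq> m" using * by auto
      have "cmod ((L (y + 1) - L y) - (L (x + 1) - L x)) = cmod (of_int (m - n) * (2 * of_real pi * \<i>))"
        by (simp only: nm of_int_diff left_diff_distrib)
      also have "\<dots> = \<bar>of_int (m - n)\<bar> * (2 * pi)"
        by (simp add: norm_mult del: of_int_diff)
      also have "\<dots> \<ge> 1 * (2 * pi)"
        using \<open>n \<noteq> m\<close> by (intro mult_right_mono) auto
      finally show "2 * pi \<le> cmod ((L (y + 1) - L y) - (L (x + 1) - L x))" by simp
    qed auto
    have "continuous_on UNIV (\<lambda>x. L (x + 1) - L x)"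
      by (intro continuous_intros continuous_on_compose2[OF L(1)]) auto
    then have "(\<lambda>x. L (x + 1) - L x) constant_on UNIV"
      by (rule continuous_discrete_range_constant[rotated]) (use ge in auto)
    then show ?thesis by (auto simp: constant_on_def)
  qed
  then obtain k where "\<forall>x. L (x + 1) - L x = k"
    by blast
  then have k: "L (x + 1) = L x + k" for x
    by (metis add.commute diff_eq_eq)
  have kn: "L (of_nat n) = L 0 + of_nat n * k" for n
  proof (induction n)
    case (Suc n)
    have "of_nat (Suc n) = (of_nat n + 1 :: real)" by simp
    then have "L (of_nat (Suc n)) = L (of_nat n) + k" by (simp only: k)
    then show ?case using Suc by (simp add: algebra_simps)
  qed auto
  have kn': "L (- of_nat n) = L 0 - of_nat n * k" for n
  proof (induction n)
    case (Suc n)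
    have "L (- of_nat n) = L (- of_nat (Suc n)) + k"
      using k[of "- of_nat (Suc n)"] by simp
    then show ?case using Suc by (simp add: algebra_simps)
  qed auto
  have km: "L (of_int m) = L 0 + of_int m * k"
    using kn kn' by (cases m rule: int_cases2) auto
  have A: "wn (\<lambda>t. \<Phi> (c (of_int m * t))) = (L (of_int m * 1) - L (of_int m * 0)) / (2 * of_real pi * \<i>)"
    by (rule wn_exp) (auto intro!: continuous_intros continuous_on_compose2[OF L(1)] simp: L(2))
  have B: "wn (\<lambda>t. \<Phi> (c t)) = (L 1 - L 0) / (2 * of_real pi * \<i>)"
    by (rule wn_exp) (auto intro!: continuous_on_subset[OF L(1)] simp: L(2))
  have "wn (\<lambda>t. \<Phi> (c (of_int m * t))) = of_int m * wn (\<lambda>t. \<Phi> (c t))"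
    using km k[of 0] by (simp add: A B)
  then show ?thesis
    by (simp add: c_def[abs_def] circlepath_eq mult.assoc)
qed

section \<open>Injective maps of a disc and windings of differences\<close>

text \<open>Loops A and B that never meet at equal times form a pure braid on two strands. In a disc
  such braids are classified by the winding of A - B, so an injective b can only scale this number.
  Both points move because later B runs along a circle and A along its translate.\<close>

definition wn_factor :: "(complex \<Rightarrow> complex) \<Rightarrow> complex set \<Rightarrow> complex \<Rightarrow> bool" where
  "wn_factor b D \<epsilon> \<longleftrightarrow> (\<forall>A B. continuous_on {0..1} A \<and> continuous_on {0..1} B \<and> A 0 = A 1 \<and> B 0 = B 1 \<and>
     (\<forall>t\<in>{0..1}. A t \<in> D \<and> B t \<in> D \<and> A t \<noteq> B t) \<longrightarrow>
     wn (\<lambda>t. b (A t) - b (B t)) = \<epsilon> * wn (\<lambda>t. A t - B t))"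

lemma wn_factorD:
  assumes "wn_factor b D \<epsilon>" "continuous_on {0..1} A" "continuous_on {0..1} B" "A 0 = A 1" "B 0 = B 1"
    "\<And>t. t \<in> {0..1} \<Longrightarrow> A t \<in> D \<and> B t \<in> D \<and> A t \<noteq> B t"
  shows "wn (\<lambda>t. b (A t) - b (B t)) = \<epsilon> * wn (\<lambda>t. A t - B t)"
  using assms by (simp add: wn_factor_def)

text \<open>The homotopy \<open>b ((A - u B) / (1 + u)) - b ((1 - u) B / (1 + u))\<close> reduces the claim to \<open>B = 0\<close>.\<close>

lemma wn_diff_inj:
  fixes b :: "complex \<Rightarrow> complex"
  assumes s: "s > 0" and cont: "continuous_on (ball c s) b" and inj: "inj_on b (ball c s)"
  obtains \<epsilon> where "\<epsilon> \<noteq> 0" "wn_factor b (ball c s) \<epsilon>"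
proof -
  define d where "d z = b (c + z)" for z
  define \<epsilon> where "\<epsilon> = wn (\<lambda>t. d (circlepath 0 (s/2) t) - d 0)"
  have contd: "continuous_on (ball 0 s) d"
    unfolding d_def[abs_def] by (intro continuous_on_compose2[OF cont] continuous_intros) (auto simp: dist_norm)
  have injd: "inj_on d (ball 0 s)"
    using inj by (force simp: inj_on_def d_def dist_norm)
  have main: "wn (\<lambda>t. d (A t) - d (B t)) = \<epsilon> * wn (\<lambda>t. A t - B t)"
    if A: "continuous_on {0..1} A" and B: "continuous_on {0..1} B" and l: "A 0 = A 1" "B 0 = B 1"
      and AB: "\<And>t. t \<in> {0..1} \<Longrightarrow> A t \<in> ball 0 s \<and> B t \<in> ball 0 s \<and> A t \<noteq> B t" for A B
  proof -
    \<comment> \<open>Dividing by 1 + u keeps both points in the disc, and U - V equals (A - B) / (1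
      + u), so the two points never collide during the homotopy.\<close>
    define U where "U u t = (A t - of_real u * B t) / of_real (1 + u)" for u t :: real
    define V where "V u t = of_real ((1 - u) / (1 + u)) * B t" for u t :: real
    have Us: "U u t \<in> ball 0 s" if "u \<in> {0..1}" "t \<in> {0..1}" for u t
    proof -
      have "cmod (A t - of_real u * B t) \<le> cmod (A t) + u * cmod (B t)"
        using that by (metis abs_of_nonneg atLeastAtMost_iff norm_mult norm_of_real norm_triangle_ineq4)
      also have "\<dots> < s + u * s"
        using AB[OF that(2)] that by (intro add_less_le_mono mult_left_mono) auto
      also have "\<dots> = (1 + u) * s" by (simp add: algebra_simps)
      finally show ?thesis
        using that by (simp add: U_def norm_divide field_simps del: of_real_add)
    qed
    have Vs: "V u t \<in> ball 0 s" if "u \<in> {0..1}" "t \<in> {0..1}" for u t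
    proof -
      have "\<bar>(1 - u) / (1 + u)\<bar> * cmod (B t) \<le> 1 * cmod (B t)"
        using that by (intro mult_right_mono) (auto simp: field_simps)
      moreover have "cmod (B t) < s" using AB[OF that(2)] by auto
      ultimately have "\<bar>(1 - u) / (1 + u)\<bar> * cmod (B t) < s" by linarith
      then show ?thesis
        unfolding V_def mem_ball dist_0_norm norm_mult norm_of_real .
    qed
    have UV: "U u t \<noteq> V u t" if "u \<in> {0..1}" "t \<in> {0..1}" for u t
    proof -
      have "U u t - V u t = (A t - B t) / of_real (1 + u)"
      proof -
        have "U u t - V u t = (A t - of_real u * B t) / of_real (1 + u) - (of_real (1 - u) * B t) / of_real (1 + u)"
          by (simp add: U_def V_def)
        also have "\<dots> = (A t - B t) / of_real (1 + u)"
          unfolding diff_divide_distrib[symmetric] by (simp add: algebra_simps)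
        finally show ?thesis .
      qed
      moreover have "(of_real (1 + u) :: complex) \<noteq> 0"
        using that by (simp del: of_real_add)
      ultimately show ?thesis
        using AB[OF that(2)] by (metis divide_eq_0_iff right_minus_eq)
    qed
    define H where "H u t = d (U u t) - d (V u t)" for u t
    have A2: "continuous_on ({0..1} \<times> {0..1}) (\<lambda>x. A (snd x))"
      by (rule continuous_on_compose2[OF A]) (auto intro!: continuous_intros)
    have B2: "continuous_on ({0..1} \<times> {0..1}) (\<lambda>x. B (snd x))"
      by (rule continuous_on_compose2[OF B]) (auto intro!: continuous_intros)
    have nz1: "1 + (of_real u :: complex) \<noteq> 0" "1 + u \<noteq> 0" if "u \<ge> 0" for u :: real
    proof -
      show "1 + u \<noteq> 0" using that by simp
      then show "1 + (of_real u :: complex) \<noteq> 0" by (metis of_real_1 of_real_add of_real_eq_0_iff)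
    qed
    have "wn (H 0) = wn (H 1)"
    proof (rule wn_homotopy)
      show "continuous_on ({0..1} \<times> {0..1}) (\<lambda>(u, t). H u t)"
        unfolding H_def U_def V_def split_def
        by (intro continuous_intros continuous_on_compose2[OF contd] A2 B2)
          (use Us Vs nz1 in \<open>auto simp: U_def V_def nz1\<close>)
      show "H u t \<noteq> 0" if "u \<in> {0..1}" "t \<in> {0..1}" for u t
        using UV[OF that] Us[OF that] Vs[OF that] injd by (auto simp: H_def inj_on_def)
      show "H u 0 = H u 1" for u
        using l by (simp add: H_def U_def V_def)
    qed
    define C where "C t = (A t - B t) / 2" for t
    have H0: "H 0 = (\<lambda>t. d (A t) - d (B t))"
      by (simp add: H_def[abs_def] U_def V_def)
    have H1: "H 1 = (\<lambda>t. d (C t) - d 0)"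
      by (simp add: H_def[abs_def] U_def V_def C_def)
    have C: "nz_path C" "C 0 = C 1"
      using A B AB l by (auto simp: nz_path_def C_def[abs_def] intro!: continuous_intros)
    have Cs: "C t \<in> ball 0 s" if "t \<in> {0..1}" for t
      using Us[of 1 t] that by (simp add: U_def C_def)
    obtain m where m: "wn C = of_int m"
      using wn_int[of C] C by (auto simp: nz_loop_def)
    obtain L where L: "continuous_on {0..1} L" "\<And>t. t \<in> {0..1} \<Longrightarrow> C t = exp (L t)"
      "L 1 - L 0 = 2 * of_real pi * \<i> * wn C"
      using nz_path_log[OF C(1)] by metis
    have ReL: "Re (L t) < ln s" if "t \<in> {0..1}" for t
    proof -
      have "exp (Re (L t)) < s"
        using Cs[OF that] L(2)[OF that] by simp
      then show ?thesis using s by (metis exp_ln exp_less_cancel_iff)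
    qed
    \<comment> \<open>A straight-line homotopy between logarithms, from C to the m-fold circle of
      radius s / 2. Both ends gain 2 pi i m over the parameter interval, so every stage is a closed
      loop; real parts stay below ln s by convexity.\<close>
    define M where "M u t = (1 - of_real u) * L t + of_real u * (of_real (ln (s/2)) + 2 * of_real pi * \<i> * of_int m * of_real t)"
      for u t :: real
    have Ms: "exp (M u t) \<in> ball 0 s" if "u \<in> {0..1}" "t \<in> {0..1}" for u t
    proof -
      have "Re (M u t) = (1 - u) * Re (L t) + u * ln (s/2)"
        by (simp add: M_def)
      also have "\<dots> < ln s"
      proof (rule convex_bound_lt)
        show "Re (L t) < ln s" using ReL that by auto
        show "ln (s/2) < ln s" using s by simp
      qed (use that in auto)
      finally have "exp (Re (M u t)) < s"
        using s by (metis exp_less_cancel_iff exp_ln)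
      then show ?thesis by simp
    qed
    define K where "K u t = d (exp (M u t)) - d 0" for u t
    have L2: "continuous_on ({0..1} \<times> {0..1}) (\<lambda>x. L (snd x))"
      by (rule continuous_on_compose2[OF L(1)]) (auto intro!: continuous_intros)
    have "wn (K 0) = wn (K 1)"
    proof (rule wn_homotopy)
      show "continuous_on ({0..1} \<times> {0..1}) (\<lambda>(u, t). K u t)"
        unfolding K_def split_def M_def
        by (intro continuous_intros continuous_on_compose2[OF contd] L2)
          (use Ms in \<open>auto simp: M_def\<close>)
      show "K u t \<noteq> 0" if "u \<in> {0..1}" "t \<in> {0..1}" for u t
      proof -
        have "exp (M u t) \<noteq> 0" "0 \<in> ball (0::complex) s"
          using s by auto
        then show ?thesis
          using inj_onD[OF injd _ Ms[OF that], of 0] by (auto simp: K_def)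
      qed
      show "K u 0 = K u 1" for u
      proof -
        have "M u 1 = M u 0 + 2 * of_real pi * \<i> * of_int m"
          using L(3) m by (simp add: M_def algebra_simps)
        then have "exp (M u 1) = exp (M u 0)"
          using exp_integer_2pi[of "of_int m"] by (simp add: exp_add mult.commute mult.left_commute)
        then show ?thesis by (simp add: K_def)
      qed
    qed
    moreover have "wn (K 0) = wn (\<lambda>t. d (C t) - d 0)"
      by (rule winding_number_cong) (simp add: K_def M_def L(2))
    moreover have "K 1 = (\<lambda>t. d (of_real (s/2) * exp (2 * of_real pi * \<i> * of_int m * of_real t)) - d 0)"
    proof -
      have e: "exp (complex_of_real (ln (s/2))) = of_real (s/2)"
        using s by (simp only: exp_of_real) simp
      show ?thesis
        unfolding K_def[abs_def] M_def e[symmetric] by (simp add: exp_add)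
    qed
    moreover have "wn (\<lambda>t. d (of_real (s/2) * exp (2 * of_real pi * \<i> * of_int m * of_real t)) - d 0)
       = of_int m * \<epsilon>"
      unfolding \<epsilon>_def
    proof (rule wn_circle_multiple[of "s/2" "\<lambda>z. d z - d 0"])
      have "sphere 0 (s/2) \<subseteq> ball (0::complex) s" using s by auto
      then show "continuous_on (sphere 0 (s / 2)) (\<lambda>z. d z - d 0)"
        by (intro continuous_intros continuous_on_subset[OF contd])
      show "d z - d 0 \<noteq> 0" if "z \<in> sphere 0 (s/2)" for z
      proof -
        have "z \<in> ball 0 s" "z \<noteq> 0" using that s by auto
        then show ?thesis using injd s by (auto simp: inj_on_def)
      qed
    qed (use s in auto)
    moreover have "wn C = wn (\<lambda>t. A t - B t)"
    proof -
      have "nz_path (\<lambda>t. A t - B t)"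
        using A B AB by (auto simp: nz_path_def intro!: continuous_intros)
      from wn_scale[of "1/2", OF _ this] show ?thesis by (simp add: C_def[abs_def])
    qed
    ultimately show ?thesis
      using \<open>wn (H 0) = wn (H 1)\<close> m unfolding H0 H1 by (metis mult.commute)
  qed
  \<comment> \<open>Pulling back a small round circle about d 0 by the inverse of d gives a loop
    whose image winds once, so 1 is a multiple of \<epsilon>.\<close>
  have "\<epsilon> \<noteq> 0"
  proof -
    have "open (d ` ball 0 s)"
      by (rule invariance_of_domain[OF contd _ injd]) auto
    moreover have "d 0 \<in> d ` ball 0 s" using s by auto
    ultimately obtain \<rho> where \<rho>: "\<rho> > 0" "cball (d 0) \<rho> \<subseteq> d ` ball 0 s"
      by (metis open_contains_cball)
    obtain i where i: "homeomorphism (ball 0 s) (d ` ball 0 s) d i"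
      using invariance_of_domain_homeomorphism[OF _ contd _ injd] by auto
    define A where "A t = i (circlepath (d 0) \<rho> t)" for t
    have im: "circlepath (d 0) \<rho> t \<in> d ` ball 0 s" for t
      using \<rho> norm_circlepath[of \<rho> "d 0" t] by (auto simp: dist_norm norm_minus_commute subset_iff)
    have As: "A t \<in> ball 0 s" "d (A t) = circlepath (d 0) \<rho> t" for t
      using i im[of t] by (auto simp: A_def homeomorphism_def)
    have A0: "A t \<noteq> 0" for t
      using As(2)[of t] norm_circlepath[of \<rho> "d 0" t] \<rho> by auto
    have contA: "continuous_on {0..1} A"
      unfolding A_def[abs_def]
      by (rule continuous_on_compose2[of "d ` ball 0 s" i]) (use i im in \<open>auto simp: homeomorphism_def intro!: continuous_intros\<close>)
    have "wn (\<lambda>t. d (A t) - d 0) = \<epsilon> * wn (\<lambda>t. A t - 0)"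
      by (rule main) (use contA As A0 s circlepath_01 in \<open>auto simp: A_def\<close>)
    moreover have "wn (\<lambda>t. d (A t) - d 0) = 1"
      using circlepath_wn[OF \<rho>(1)] by (simp add: As)
    ultimately show ?thesis by auto
  qed
  moreover have "wn_factor b (ball c s) \<epsilon>"
    unfolding wn_factor_def
  proof (intro allI impI, elim conjE)
    fix A B :: "real \<Rightarrow> complex"
    assume *: "continuous_on {0..1} A" "continuous_on {0..1} B" "A 0 = A 1" "B 0 = B 1"
      "\<forall>t\<in>{0..1}. A t \<in> ball c s \<and> B t \<in> ball c s \<and> A t \<noteq> B t"
    have "wn (\<lambda>t. d (A t - c) - d (B t - c)) = \<epsilon> * wn (\<lambda>t. (A t - c) - (B t - c))"
      by (rule main) (use * in \<open>auto intro!: continuous_intros simp: dist_norm norm_minus_commute\<close>)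
    then show "wn (\<lambda>t. b (A t) - b (B t)) = \<epsilon> * wn (\<lambda>t. A t - B t)"
      by (simp add: d_def)
  qed
  ultimately show ?thesis by (rule that)
qed

section \<open>Local indices at critical points and simple poles\<close>

text \<open>Factor X^e - Y^e as (X - Y) Y^(e - 1) S(X / Y), where S(u) is the sum of the u^i with i
  < e. As S(1) = e is nonzero, continuity yields \<eta> such that S(X / Y) stays within distance e
  of e and hence does not wind around 0.\<close>

lemma wn_power_diff:
  assumes e: "e \<ge> (1::nat)"
  obtains \<eta> :: real where "\<eta> > 0"
    "\<forall>X Y. continuous_on {0..1} X \<and> X 0 = X 1 \<and> nz_loop Y \<and>
       (\<forall>t\<in>{0..1}. X t \<noteq> Y t \<and> cmod (X t - Y t) < \<eta> * cmod (Y t)) \<longrightarrow>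
       wn (\<lambda>t. X t ^ e - Y t ^ e) = wn (\<lambda>t. X t - Y t) + of_nat (e - 1) * wn Y
       \<and> nz_loop (\<lambda>t. X t ^ e - Y t ^ e)"
proof -
  define S where "S u = (\<Sum>i<e. u ^ i)" for u :: complex
  have S1: "S 1 = of_nat e" by (simp add: S_def)
  have contS: "continuous_on UNIV S"
    unfolding S_def[abs_def] by (intro continuous_intros)
  then have "isCont S 1" by (simp add: continuous_on_eq_continuous_at)
  then obtain \<eta> where \<eta>: "\<eta> > 0" "\<And>u. dist u 1 < \<eta> \<Longrightarrow> dist (S u) (S 1) < real e"
    using e unfolding continuous_at_eps_delta by (metis of_nat_0_less_iff zero_less_one less_le_trans)
  show ?thesis
  proof (rule that[OF \<eta>(1)], intro allI impI, elim conjE)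
    fix X Y :: "real \<Rightarrow> complex"
    assume X: "continuous_on {0..1} X" "X 0 = X 1" and Y: "nz_loop Y"
      and XY': "\<forall>t\<in>{0..1}. X t \<noteq> Y t \<and> cmod (X t - Y t) < \<eta> * cmod (Y t)"
    have XY: "X t \<noteq> Y t \<and> cmod (X t - Y t) < \<eta> * cmod (Y t)" if "t \<in> {0..1}" for t
      using XY' that by blast
    have Yc: "continuous_on {0..1} Y" and Y0: "\<And>t. t \<in> {0..1} \<Longrightarrow> Y t \<noteq> 0" and Yl: "Y 0 = Y 1"
      using Y by (auto simp: nz_loop_def nz_path_def)
    define Q where "Q t = S (X t / Y t)" for t
    have l: "nz_loop (\<lambda>t. of_nat e)" using e by (intro nz_loopI) auto
    have cQ: "continuous_on {0..1} Q"
      unfolding Q_def[abs_def]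
      by (rule continuous_on_compose2[OF contS]) (use X Yc Y0 in \<open>auto intro!: continuous_intros\<close>)
    have Q01: "Q 0 = Q 1" using X Yl by (simp add: Q_def)
    have Qe: "cmod (Q t - of_nat e) < cmod (of_nat e)" if "t \<in> {0..1}" for t
    proof -
      have "X t / Y t - 1 = (X t - Y t) / Y t" using Y0[OF that] by (simp add: diff_divide_distrib)
      then have "dist (X t / Y t) 1 < \<eta>"
        using XY[OF that] Y0[OF that] by (simp add: dist_norm norm_divide divide_less_eq)
      from \<eta>(2)[OF this] show ?thesis by (simp add: Q_def S1 dist_norm)
    qed
    note Qn = wn_nearby[OF l cQ Q01 Qe]
    have fac: "X t ^ e - Y t ^ e = (X t - Y t) * (Y t ^ (e - 1) * Q t)" if "t \<in> {0..1}" for t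
    proof -
      have "Y t ^ (e - Suc i) * X t ^ i = Y t ^ (e - 1) * (X t / Y t) ^ i" if "i < e" for i
      proof -
        have "Y t ^ (e - 1) = Y t ^ (e - Suc i) * Y t ^ i"
          using that by (simp flip: power_add)
        then show ?thesis using Y0[OF \<open>t \<in> {0..1}\<close>] by (simp add: power_divide)
      qed
      then show ?thesis
        by (simp add: power_diff_sumr2 Q_def S_def sum_distrib_left)
    qed
    have n1: "nz_path (\<lambda>t. X t - Y t)"
      using X Yc XY by (auto simp: nz_path_def intro!: continuous_intros)
    have n2: "nz_path (\<lambda>t. Y t ^ (e - 1))" "nz_path Q" "nz_path Y"
      using Y Qn by (auto simp: nz_loop_def intro: nz_path_power)
    have "wn (\<lambda>t. X t ^ e - Y t ^ e) = wn (\<lambda>t. (X t - Y t) * (Y t ^ (e - 1) * Q t))"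
      by (rule winding_number_cong) (use fac in auto)
    also have "\<dots> = wn (\<lambda>t. X t - Y t) + of_nat (e - 1) * wn Y"
      unfolding wn_mult[OF n1 nz_path_mult[OF n2(1,2)]] wn_mult[OF n2(1,2)] wn_power[OF n2(3)]
      using Qn(1) wn_const[of "of_nat e"] e by simp
    finally show "wn (\<lambda>t. X t ^ e - Y t ^ e) = wn (\<lambda>t. X t - Y t) + of_nat (e - 1) * wn Y
       \<and> nz_loop (\<lambda>t. X t ^ e - Y t ^ e)"
      using nz_path_mult[OF n1 nz_path_mult[OF n2(1,2)]] X Yl Yc
      by (auto intro!: nz_loopI continuous_intros simp: fac nz_path_def)
  qed
qed

text \<open>\<open>a\<close> and \<open>b\<close> are local homeomorphisms by invariance of domain; both may reverse the orientation.\<close>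

definition pow_at :: "(complex \<Rightarrow> complex) \<Rightarrow> complex \<Rightarrow> nat \<Rightarrow> bool" where
  "pow_at g c e \<longleftrightarrow> e \<ge> 1 \<and> (\<exists>r>0. \<exists>s>0. \<exists>(a :: complex \<Rightarrow> complex) b.
     continuous_on (ball c r) a \<and> inj_on a (ball c r) \<and> a c = 0 \<and>
     continuous_on (ball 0 s) b \<and> inj_on b (ball 0 s) \<and>
     (\<forall>z\<in>ball c r. a z ^ e \<in> ball 0 s \<and> g z = b (a z ^ e)))"

lemma pow_atE:
  assumes "pow_at g c e"
  obtains r s and a b :: "complex \<Rightarrow> complex" where "e \<ge> 1" "r > 0" "s > 0"
    "continuous_on (ball c r) a" "inj_on a (ball c r)" "a c = 0"
    "continuous_on (ball 0 s) b" "inj_on b (ball 0 s)"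
    "\<forall>z\<in>ball c r. a z ^ e \<in> ball 0 s \<and> g z = b (a z ^ e)"
proof -
  have "e \<ge> 1" and "\<exists>r>0. \<exists>s>0. \<exists>(a :: complex \<Rightarrow> complex) b.
     continuous_on (ball c r) a \<and> inj_on a (ball c r) \<and> a c = 0 \<and>
     continuous_on (ball 0 s) b \<and> inj_on b (ball 0 s) \<and>
     (\<forall>z\<in>ball c r. a z ^ e \<in> ball 0 s \<and> g z = b (a z ^ e))"
    using assms by (auto simp only: pow_at_def)
  then show ?thesis
    by (elim exE conjE) (rule that)
qed

text \<open>The local degree of g at z. Asking for one value at all small radii lets two values
  obtained from different neighbourhoods be compared at a common radius.\<close>

definition loc_sign :: "(complex \<Rightarrow> complex) \<Rightarrow> complex \<Rightarrow> complex \<Rightarrow> bool" where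
  "loc_sign g z \<epsilon> \<longleftrightarrow> (\<exists>r0>0. \<forall>r. 0 < r \<and> r < r0 \<longrightarrow> wn (\<lambda>t. g (circlepath z r t) - g z) = \<epsilon>)"

lemma loc_sign_unique: "loc_sign g z \<epsilon> \<Longrightarrow> loc_sign g z \<epsilon>' \<Longrightarrow> \<epsilon> = \<epsilon>'"
proof -
  assume "loc_sign g z \<epsilon>" "loc_sign g z \<epsilon>'"
  then obtain r1 r2 where "r1 > 0" "r2 > 0"
    "\<forall>r. 0 < r \<and> r < r1 \<longrightarrow> wn (\<lambda>t. g (circlepath z r t) - g z) = \<epsilon>"
    "\<forall>r. 0 < r \<and> r < r2 \<longrightarrow> wn (\<lambda>t. g (circlepath z r t) - g z) = \<epsilon>'"
    by (auto simp: loc_sign_def)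
  moreover have "\<exists>r. 0 < r \<and> r < min r1 r2"
    using \<open>r1 > 0\<close> \<open>r2 > 0\<close> by (intro dense) auto
  ultimately show ?thesis by auto
qed

lemma circlepath_in_ball: "0 \<le> r \<Longrightarrow> r < s \<Longrightarrow> circlepath z r t \<in> ball z s"
  using norm_circlepath[of r z t] by (simp add: dist_norm norm_minus_commute)

lemma circlepath_in_cball: "0 \<le> r \<Longrightarrow> circlepath z r t \<in> cball z r"
  using norm_circlepath[of r z t] by (simp add: dist_norm norm_minus_commute)

lemma circlepath_neq: "0 < r \<Longrightarrow> circlepath z r t \<noteq> z"
  using norm_circlepath[of r z t] by auto

lemma uniformly_small_shift:
  fixes a :: "complex \<Rightarrow> complex"
  assumes cont: "continuous_on (ball c r) a" and \<rho>: "0 < \<rho>" "\<rho> < r" and \<eta>: "\<eta> > 0"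
  obtains \<delta> where "\<delta> > 0" "\<rho> + \<delta> < r"
    "\<And>h t. cmod h < \<delta> \<Longrightarrow> cmod (a (circlepath c \<rho> t + h) - a (circlepath c \<rho> t)) < \<eta>"
proof -
  have "uniformly_continuous_on (cball c ((\<rho> + r) / 2)) a"
    using \<rho> by (intro compact_uniformly_continuous continuous_on_subset[OF cont]) auto
  then obtain d where d: "d > 0"
    "\<And>x y. x \<in> cball c ((\<rho> + r) / 2) \<Longrightarrow> y \<in> cball c ((\<rho> + r) / 2) \<Longrightarrow> dist y x < d \<Longrightarrow> dist (a y) (a x) < \<eta>"
    using \<eta> unfolding uniformly_continuous_on_def by metis
  show ?thesis
  proof (rule that[of "min d ((r - \<rho>) / 2)"])
    fix h :: complex and t :: real
    assume h: "cmod h < min d ((r - \<rho>) / 2)"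
    have n: "cmod (circlepath c \<rho> t - c) = \<rho>" using \<rho> by (simp add: norm_circlepath)
    have "cmod ((circlepath c \<rho> t - c) + h) \<le> \<rho> + cmod h"
      using norm_triangle_ineq[of "circlepath c \<rho> t - c" h] n by simp
    then have "cmod (circlepath c \<rho> t + h - c) \<le> (\<rho> + r) / 2"
      using h by (simp add: algebra_simps)
    then show "cmod (a (circlepath c \<rho> t + h) - a (circlepath c \<rho> t)) < \<eta>"
      using d(2)[of "circlepath c \<rho> t" "circlepath c \<rho> t + h"] n h \<rho>
      by (simp add: dist_norm norm_minus_commute)
  qed (use d \<rho> in \<open>auto simp: field_simps min_def\<close>)
qed

lemma circle_shift_in_ball:
  assumes "0 < \<rho>" "\<rho> + \<delta> < r" "cmod h < \<delta>"
  shows "circlepath c \<rho> t + h \<in> ball c r"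
proof -
  have "cmod ((circlepath c \<rho> t - c) + h) \<le> \<rho> + cmod h"
    using norm_triangle_ineq[of "circlepath c \<rho> t - c" h] norm_circlepath[of \<rho> c t] assms by simp
  then show ?thesis using assms by (simp add: dist_norm norm_minus_commute algebra_simps)
qed

text \<open>The bound is relative to the modulus of a because \<open>wn_power_diff\<close> compares
  X and Y in that way. On the compact circle the modulus has a positive minimum, which reduces the
  claim to uniform continuity.\<close>

lemma relatively_small_shift:
  fixes a :: "complex \<Rightarrow> complex"
  assumes cont: "continuous_on (ball c r) a" and nz: "\<And>z. z \<in> ball c r \<Longrightarrow> z \<noteq> c \<Longrightarrow> a z \<noteq> 0"
    and \<rho>: "0 < \<rho>" "\<rho> < r" and \<eta>: "\<eta> > 0"
  obtains \<delta> where "\<delta> > 0" "\<rho> + \<delta> < r"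
    "\<And>h t. cmod h < \<delta> \<Longrightarrow> cmod (a (circlepath c \<rho> t + h) - a (circlepath c \<rho> t)) < \<eta> * cmod (a (circlepath c \<rho> t))"
proof -
  have "compact (sphere c \<rho>)" "sphere c \<rho> \<noteq> {}" using \<rho> by auto
  moreover have "continuous_on (sphere c \<rho>) (\<lambda>z. cmod (a z))"
    using \<rho> by (intro continuous_intros continuous_on_subset[OF cont]) auto
  ultimately obtain z0 where z0: "z0 \<in> sphere c \<rho>" "\<And>z. z \<in> sphere c \<rho> \<Longrightarrow> cmod (a z0) \<le> cmod (a z)"
    using continuous_attains_inf[of "sphere c \<rho>" "\<lambda>z. cmod (a z)"] by blast
  have "z0 \<in> ball c r" "z0 \<noteq> c" using z0(1) \<rho> by auto
  then have "\<eta> * cmod (a z0) > 0" using nz \<eta> by simp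
  from uniformly_small_shift[OF cont \<rho> this] obtain \<delta> where \<delta>: "\<delta> > 0" "\<rho> + \<delta> < r"
    "\<And>h t. cmod h < \<delta> \<Longrightarrow> cmod (a (circlepath c \<rho> t + h) - a (circlepath c \<rho> t)) < \<eta> * cmod (a z0)"
    by metis
  show ?thesis
  proof (rule that[OF \<delta>(1,2)])
    fix h :: complex and t assume h: "cmod h < \<delta>"
    have "circlepath c \<rho> t \<in> sphere c \<rho>"
      using norm_circlepath[of \<rho> c t] \<rho> by (simp add: dist_norm norm_minus_commute)
    then have "\<eta> * cmod (a z0) \<le> \<eta> * cmod (a (circlepath c \<rho> t))"
      using z0(2) \<eta> by (intro mult_left_mono) auto
    then show "cmod (a (circlepath c \<rho> t + h) - a (circlepath c \<rho> t)) < \<eta> * cmod (a (circlepath c \<rho> t))"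
      using \<delta>(3)[OF h, of t] by linarith
  qed
qed

lemma wn_inj_circle:
  assumes a: "continuous_on (ball c r) a" "inj_on a (ball c r)"
    and \<alpha>: "wn_factor a (ball c r) \<alpha>"
    and z: "cball z \<rho> \<subseteq> ball c r" "\<rho> > 0"
  shows "wn (\<lambda>t. a (circlepath z \<rho> t) - a z) = \<alpha>" "nz_loop (\<lambda>t. a (circlepath z \<rho> t) - a z)"
proof -
  have im: "circlepath z \<rho> t \<in> ball c r" for t
    using subsetD[OF z(1) circlepath_in_cball] z(2) by simp
  have zc: "z \<in> ball c r" using subsetD[OF z(1), of z] z(2) by simp
  have "wn (\<lambda>t. a (circlepath z \<rho> t) - a z) = \<alpha> * wn (\<lambda>t. circlepath z \<rho> t - z)"
    by (rule wn_factorD[OF \<alpha>]) (use im zc circlepath_01 circlepath_neq[OF z(2)] in \<open>auto intro!: continuous_intros\<close>)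
  then show "wn (\<lambda>t. a (circlepath z \<rho> t) - a z) = \<alpha>"
    using circlepath_wn[OF z(2)] by simp
  show "nz_loop (\<lambda>t. a (circlepath z \<rho> t) - a z)"
  proof (rule nz_loopI)
    show "continuous_on {0..1} (\<lambda>t. a (circlepath z \<rho> t) - a z)"
      by (intro continuous_intros continuous_on_compose2[OF a(1)]) (use im in auto)
    show "a (circlepath z \<rho> t) - a z \<noteq> 0" for t
      using inj_onD[OF a(2) _ im zc, of t] circlepath_neq[OF z(2), of z t] by auto
  qed (simp add: circlepath_01)
qed

text \<open>A substitute for the winding number of g' along the circle of radius \<rho> around c.
  The bound on h may depend on \<rho>, since h has to be small compared with the circle.\<close>

definition diff_index :: "(complex \<Rightarrow> complex) \<Rightarrow> complex \<Rightarrow> real \<Rightarrow> complex \<Rightarrow> bool" where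
  "diff_index g c \<rho> w \<longleftrightarrow> (\<exists>\<delta>>0. \<forall>h. h \<noteq> 0 \<and> cmod h < \<delta> \<longrightarrow>
     wn (\<lambda>t. g (circlepath c \<rho> t + h) - g (circlepath c \<rho> t)) = w)"

text \<open>Write g as b after the e-th power after a. The outer b contributes a factor \<beta>, the
  power adds e - 1 windings of a, and a winds \<alpha> times around its zero. The difference of a
  along the circle and its translate does not wind, because the translation vector h is constant.
  Around a point z other than c it is the other way round: the difference winds \<alpha> times and
  the constant a z not at all.\<close>

lemma pow_at_index:
  assumes "pow_at g c e"
  shows "\<exists>\<epsilon> R. \<epsilon> \<noteq> 0 \<and> R > 0 \<and>
    (\<forall>\<rho>. 0 < \<rho> \<longrightarrow> \<rho> < R \<longrightarrow> diff_index g c \<rho> (\<epsilon> * of_nat (e - 1))) \<and>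
    (\<forall>z\<in>ball c R. z \<noteq> c \<or> e = 1 \<longrightarrow> loc_sign g z \<epsilon>)"
proof -
  obtain r s and a b :: "complex \<Rightarrow> complex" where e: "e \<ge> 1" and r: "r > 0" and s: "s > 0"
    and a: "continuous_on (ball c r) a" "inj_on a (ball c r)" "a c = 0"
    and b: "continuous_on (ball 0 s) b" "inj_on b (ball 0 s)"
    and ab': "\<forall>z\<in>ball c r. a z ^ e \<in> ball 0 s \<and> g z = b (a z ^ e)"
    by (rule pow_atE[OF assms])
  have ab: "a z ^ e \<in> ball 0 s \<and> g z = b (a z ^ e)" if "z \<in> ball c r" for z
    using ab' that by blast
  obtain \<alpha> where \<alpha>0: "\<alpha> \<noteq> 0"
    and \<alpha>: "wn_factor a (ball c r) \<alpha>"
    by (rule wn_diff_inj[OF r a(1,2)])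
  obtain \<beta> where \<beta>0: "\<beta> \<noteq> 0"
    and \<beta>: "wn_factor b (ball 0 s) \<beta>"
    by (rule wn_diff_inj[OF s b])
  obtain \<eta> :: real where \<eta>: "\<eta> > 0"
    and pd: "\<forall>X Y. continuous_on {0..1} X \<and> X 0 = X 1 \<and> nz_loop Y \<and>
       (\<forall>t\<in>{0..1}. X t \<noteq> Y t \<and> cmod (X t - Y t) < \<eta> * cmod (Y t)) \<longrightarrow>
       wn (\<lambda>t. X t ^ e - Y t ^ e) = wn (\<lambda>t. X t - Y t) + of_nat (e - 1) * wn Y
       \<and> nz_loop (\<lambda>t. X t ^ e - Y t ^ e)"
    by (rule wn_power_diff[OF e])
  have az: "a z \<noteq> 0" if "z \<in> ball c r" "z \<noteq> c" for z
    using inj_onD[OF a(2), of z c] that a(3) r by auto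
  \<comment> \<open>Used twice: with G a circle around c and F its translate by h, and with G
    constant and F a small circle around that point.\<close>
  have gab: "wn (\<lambda>t. g (F t) - g (G t)) = \<beta> * (wn (\<lambda>t. a (F t) - a (G t)) + of_nat (e - 1) * wn (\<lambda>t. a (G t)))"
    if F: "continuous_on {0..1} F" "F 0 = F 1" and G: "continuous_on {0..1} G" "G 0 = G 1"
      and FG: "\<And>t. F t \<in> ball c r \<and> G t \<in> ball c r \<and> F t \<noteq> G t \<and> G t \<noteq> c
          \<and> cmod (a (F t) - a (G t)) < \<eta> * cmod (a (G t))" for F G
  proof -
    have aF: "continuous_on {0..1} (\<lambda>t. a (F t))" "continuous_on {0..1} (\<lambda>t. a (G t))"
      using FG by (auto intro!: continuous_on_compose2[OF a(1)] F G)
    have l: "nz_loop (\<lambda>t. a (G t))"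
    proof (rule nz_loopI)
      show "a (G t) \<noteq> 0" for t using az FG by blast
    qed (use aF G in auto)
    have *: "wn (\<lambda>t. a (F t) ^ e - a (G t) ^ e) = wn (\<lambda>t. a (F t) - a (G t)) + of_nat (e - 1) * wn (\<lambda>t. a (G t))
       \<and> nz_loop (\<lambda>t. a (F t) ^ e - a (G t) ^ e)"
      by (rule pd[rule_format]) (use aF l F FG inj_onD[OF a(2)] in auto)
    have "wn (\<lambda>t. g (F t) - g (G t)) = wn (\<lambda>t. b (a (F t) ^ e) - b (a (G t) ^ e))"
      by (rule winding_number_cong) (use FG ab in auto)
    also have "\<dots> = \<beta> * wn (\<lambda>t. a (F t) ^ e - a (G t) ^ e)"
      by (rule wn_factorD[OF \<beta>]) (use FG ab aF F G * in \<open>auto intro!: continuous_intros simp: nz_loop_def nz_path_def\<close>)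
    finally show ?thesis using * by simp
  qed
  show ?thesis
  proof (rule exI[of _ "\<beta> * \<alpha>"], rule exI[of _ r], intro conjI allI ballI impI)
    show "\<beta> * \<alpha> \<noteq> 0" using \<alpha>0 \<beta>0 by simp
    show "diff_index g c \<rho> (\<beta> * \<alpha> * of_nat (e - 1))"
      if \<rho>: "0 < \<rho>" "\<rho> < r" for \<rho>
    proof -
      obtain \<delta> where \<delta>: "\<delta> > 0" "\<rho> + \<delta> < r"
        "\<And>h t. cmod h < \<delta> \<Longrightarrow> cmod (a (circlepath c \<rho> t + h) - a (circlepath c \<rho> t)) < \<eta> * cmod (a (circlepath c \<rho> t))"
        using relatively_small_shift[OF a(1) az \<rho> \<eta>] by blast
      show ?thesis
        unfolding diff_index_def
      proof (intro exI[of _ \<delta>] conjI allI impI)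
        fix h :: complex assume h: "h \<noteq> 0 \<and> cmod h < \<delta>"
        have in1: "circlepath c \<rho> t \<in> ball c r" "circlepath c \<rho> t + h \<in> ball c r" for t
          using circlepath_in_ball[of \<rho> r c t] \<rho> circle_shift_in_ball[OF \<rho>(1) \<delta>(2)] h by auto
        have sm: "cmod (a (circlepath c \<rho> t + h) - a (circlepath c \<rho> t)) < \<eta> * cmod (a (circlepath c \<rho> t))" for t
          using \<delta>(3) h by blast
        have "wn (\<lambda>t. g (circlepath c \<rho> t + h) - g (circlepath c \<rho> t)) =
          \<beta> * (wn (\<lambda>t. a (circlepath c \<rho> t + h) - a (circlepath c \<rho> t)) + of_nat (e - 1) * wn (\<lambda>t. a (circlepath c \<rho> t)))"
          by (rule gab) (use in1 sm h circlepath_neq[OF \<rho>(1)] in \<open>auto intro!: continuous_intros simp: circlepath_01\<close>)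
        also have "wn (\<lambda>t. a (circlepath c \<rho> t + h) - a (circlepath c \<rho> t)) =
            \<alpha> * wn (\<lambda>t. (circlepath c \<rho> t + h) - circlepath c \<rho> t)"
          by (rule wn_factorD[OF \<alpha>]) (use in1 h in \<open>auto intro!: continuous_intros simp: circlepath_01\<close>)
        also have "wn (\<lambda>t. (circlepath c \<rho> t + h) - circlepath c \<rho> t) = 0"
          using h wn_const[of h] by simp
        also have "wn (\<lambda>t. a (circlepath c \<rho> t)) = \<alpha>"
        proof -
          have "cball c \<rho> \<subseteq> ball c r" using \<rho> by auto
          from wn_inj_circle(1)[OF a(1,2) \<alpha> this] show ?thesis using \<rho> a(3) by simp
        qed
        finally show "wn (\<lambda>t. g (circlepath c \<rho> t + h) - g (circlepath c \<rho> t)) = \<beta> * \<alpha> * of_nat (e - 1)"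
          by simp
      qed (use \<delta> in auto)
    qed
    show "loc_sign g z (\<beta> * \<alpha>)" if z: "z \<in> ball c r" "z \<noteq> c \<or> e = 1" for z
    proof (cases "z = c")
      case False
      have "\<eta> * cmod (a z) > 0" using az[OF z(1) False] \<eta> by simp
      moreover have "continuous (at z) a"
        using a(1) z(1) by (simp add: continuous_on_eq_continuous_at)
      ultimately obtain d where d: "d > 0" "\<And>w. dist w z < d \<Longrightarrow> dist (a w) (a z) < \<eta> * cmod (a z)"
        unfolding continuous_at_eps_delta by metis
      show ?thesis
        unfolding loc_sign_def
      proof (intro exI[of _ "min d (r - dist c z)"] conjI allI impI)
        fix \<rho> assume \<rho>: "0 < \<rho> \<and> \<rho> < min d (r - dist c z)"
        have sub: "cball z \<rho> \<subseteq> ball c r"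
        proof
          fix x assume "x \<in> cball z \<rho>"
          then show "x \<in> ball c r" using \<rho> dist_triangle[of c x z] by simp
        qed
        have in1: "circlepath z \<rho> t \<in> ball c r" for t
          using subsetD[OF sub circlepath_in_cball] \<rho> by simp
        have sm: "cmod (a (circlepath z \<rho> t) - a z) < \<eta> * cmod (a z)" for t
          using d(2)[of "circlepath z \<rho> t"] norm_circlepath[of \<rho> z t] \<rho> by (simp add: dist_norm)
        have "wn (\<lambda>t. g (circlepath z \<rho> t) - g z) =
          \<beta> * (wn (\<lambda>t. a (circlepath z \<rho> t) - a z) + of_nat (e - 1) * wn (\<lambda>t. a z))"
          by (rule gab) (use in1 sm z False circlepath_neq[of \<rho> z] \<rho> in \<open>auto intro!: continuous_intros simp: circlepath_01\<close>)
        also have "wn (\<lambda>t. a (circlepath z \<rho> t) - a z) = \<alpha>"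
          using wn_inj_circle(1)[OF a(1,2) \<alpha> sub] \<rho> by simp
        also have "wn (\<lambda>t. a z) = 0" using az[OF z(1) False] wn_const by simp
        finally show "wn (\<lambda>t. g (circlepath z \<rho> t) - g z) = \<beta> * \<alpha>" by simp
      qed (use d z in auto)
    next
      case True
      then have e1: "e = 1" using z by simp
      show ?thesis
        unfolding loc_sign_def
      proof (intro exI[of _ r] conjI allI impI)
        fix \<rho> assume \<rho>: "0 < \<rho> \<and> \<rho> < r"
        then have sub: "cball z \<rho> \<subseteq> ball c r" using True by auto
        have in1: "circlepath z \<rho> t \<in> ball c r" for t
          using subsetD[OF sub circlepath_in_cball] \<rho> by simp
        have "wn (\<lambda>t. g (circlepath z \<rho> t) - g z) = wn (\<lambda>t. b (a (circlepath z \<rho> t)) - b (a z))"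
          by (rule winding_number_cong) (use in1 ab[of "circlepath z \<rho> _"] ab[OF z(1)] e1 in simp)
        also have "\<dots> = \<beta> * wn (\<lambda>t. a (circlepath z \<rho> t) - a z)"
        proof (rule wn_factorD[OF \<beta>])
          show "continuous_on {0..1} (\<lambda>t. a (circlepath z \<rho> t))"
            by (rule continuous_on_compose2[OF a(1)]) (use in1 in \<open>auto intro!: continuous_intros\<close>)
          show "a (circlepath z \<rho> t) \<in> ball 0 s \<and> a z \<in> ball 0 s \<and> a (circlepath z \<rho> t) \<noteq> a z" for t
            using ab[OF in1[of t]] ab[OF z(1)] e1 inj_onD[OF a(2) _ in1 z(1), of t] circlepath_neq[of \<rho> z t] \<rho>
            by auto
        qed (auto simp: circlepath_01)
        also have "wn (\<lambda>t. a (circlepath z \<rho> t) - a z) = \<alpha>"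
          using wn_inj_circle(1)[OF a(1,2) \<alpha> sub] \<rho> by simp
        finally show "wn (\<lambda>t. g (circlepath z \<rho> t) - g z) = \<beta> * \<alpha>" by simp
      qed (use r in auto)
    qed
  qed (use r in auto)
qed

text \<open>The identity 1/u - 1/v = -(u - v) / (u v) reduces everything to the local coordinate u.
  Along a circle around the pole the numerator does not wind and each denominator winds \<alpha>
  times, giving -2 \<alpha>; away from the pole only the numerator winds, giving \<alpha>.\<close>

lemma pole_index:
  assumes r: "r > 0" and u: "continuous_on (ball c r) u" "inj_on u (ball c r)" "u c = 0"
    and "\<forall>z\<in>ball c r. z \<noteq> c \<longrightarrow> g z = inverse (u z)"
  shows "\<exists>\<epsilon>. (\<forall>\<rho>. 0 < \<rho> \<longrightarrow> \<rho> < r \<longrightarrow> diff_index g c \<rho> (- 2 * \<epsilon>)) \<and>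
    (\<forall>z\<in>ball c r. z \<noteq> c \<longrightarrow> loc_sign g z \<epsilon>)"
proof -
  have g: "g z = inverse (u z)" if "z \<in> ball c r" "z \<noteq> c" for z
    using assms(5) that by blast
  obtain \<alpha> where \<alpha>: "wn_factor u (ball c r) \<alpha>"
    by (rule wn_diff_inj[OF r u(1,2)])
  have uz: "u z \<noteq> 0" if "z \<in> ball c r" "z \<noteq> c" for z
    using inj_onD[OF u(2), of z c] that u(3) r by auto
  have diff: "g z - g w = (- (u z - u w)) * (inverse (u z) * inverse (u w))"
    if "z \<in> ball c r" "z \<noteq> c" "w \<in> ball c r" "w \<noteq> c" for z w
    unfolding g[OF that(1,2)] g[OF that(3,4)] using uz[OF that(1,2)] uz[OF that(3,4)]
    by (simp add: field_simps)
  have gu: "wn (\<lambda>t. g (F t) - g (G t)) = wn (\<lambda>t. u (F t) - u (G t)) - wn (\<lambda>t. u (F t)) - wn (\<lambda>t. u (G t))"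
    if F: "continuous_on {0..1} F" and G: "continuous_on {0..1} G"
      and FG: "\<And>t. F t \<in> ball c r \<and> G t \<in> ball c r \<and> F t \<noteq> G t \<and> F t \<noteq> c \<and> G t \<noteq> c" for F G
  proof -
    have uF: "continuous_on {0..1} (\<lambda>t. u (F t))" "continuous_on {0..1} (\<lambda>t. u (G t))"
      using FG by (auto intro!: continuous_on_compose2[OF u(1)] F G)
    have n1: "nz_path (\<lambda>t. u (F t))" "nz_path (\<lambda>t. u (G t))"
      using uF FG uz by (auto simp: nz_path_def)
    have n2: "nz_path (\<lambda>t. u (F t) - u (G t))"
      using uF FG inj_onD[OF u(2)] by (force simp: nz_path_def intro!: continuous_intros)
    then have n3: "nz_path (\<lambda>t. - (u (F t) - u (G t)))"
      using nz_path_mult[OF nz_path_const[of "-1"] n2] by simp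
    have "wn (\<lambda>t. g (F t) - g (G t)) = wn (\<lambda>t. (- (u (F t) - u (G t))) * (inverse (u (F t)) * inverse (u (G t))))"
      using FG by (intro winding_number_cong diff) auto
    also have "\<dots> = wn (\<lambda>t. u (F t) - u (G t)) - wn (\<lambda>t. u (F t)) - wn (\<lambda>t. u (G t))"
      using wn_mult[OF n3 nz_path_mult[OF n1[THEN nz_path_inverse]]]
        wn_mult[OF n1[THEN nz_path_inverse]] wn_inverse[OF n1(1)] wn_inverse[OF n1(2)] wn_minus[OF n2]
      by simp
    finally show ?thesis .
  qed
  show ?thesis
  proof (intro exI[of _ \<alpha>] conjI allI ballI impI)
    show "diff_index g c \<rho> (- 2 * \<alpha>)"
      if \<rho>: "0 < \<rho>" "\<rho> < r" for \<rho>
    proof -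
      obtain \<delta> where \<delta>: "\<delta> > 0" "\<rho> + \<delta> < r"
        "\<And>h t. cmod h < \<delta> \<Longrightarrow> cmod (u (circlepath c \<rho> t + h) - u (circlepath c \<rho> t)) < 1 * cmod (u (circlepath c \<rho> t))"
        using relatively_small_shift[OF u(1) uz \<rho> zero_less_one] by blast
      show ?thesis
        unfolding diff_index_def
      proof (intro exI[of _ "min \<delta> \<rho>"] conjI allI impI)
        fix h :: complex assume h: "h \<noteq> 0 \<and> cmod h < min \<delta> \<rho>"
        have in1: "circlepath c \<rho> t \<in> ball c r" "circlepath c \<rho> t + h \<in> ball c r" for t
          using circlepath_in_ball[of \<rho> r c t] \<rho> circle_shift_in_ball[OF \<rho>(1) \<delta>(2)] h by auto
        \<comment> \<open>The bound of h by \<rho> keeps the translated circle off the pole.\<close>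
        have nc: "circlepath c \<rho> t + h \<noteq> c" for t
        proof
          assume *: "circlepath c \<rho> t + h = c"
          have "c - circlepath c \<rho> t = h" by (metis * add_diff_cancel_left')
          then show False using norm_circlepath[of \<rho> c t] \<rho> h by (simp add: norm_minus_commute)
        qed
        have sm: "cmod (u (circlepath c \<rho> t + h) - u (circlepath c \<rho> t)) < cmod (u (circlepath c \<rho> t))" for t
          using \<delta>(3)[of h t] h by simp
        have ucirc: "wn (\<lambda>t. u (circlepath c \<rho> t)) = \<alpha>" "nz_loop (\<lambda>t. u (circlepath c \<rho> t))"
        proof -
          have "cball c \<rho> \<subseteq> ball c r" using \<rho> by auto
          from wn_inj_circle[OF u(1,2) \<alpha> this] 
          show "wn (\<lambda>t. u (circlepath c \<rho> t)) = \<alpha>" "nz_loop (\<lambda>t. u (circlepath c \<rho> t))"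
            using \<rho> u(3) by auto
        qed
        have "wn (\<lambda>t. g (circlepath c \<rho> t + h) - g (circlepath c \<rho> t)) =
          wn (\<lambda>t. u (circlepath c \<rho> t + h) - u (circlepath c \<rho> t)) - wn (\<lambda>t. u (circlepath c \<rho> t + h)) - wn (\<lambda>t. u (circlepath c \<rho> t))"
          by (rule gu) (use in1 nc h circlepath_neq[OF \<rho>(1)] in \<open>auto intro!: continuous_intros\<close>)
        also have "wn (\<lambda>t. u (circlepath c \<rho> t + h) - u (circlepath c \<rho> t)) =
            \<alpha> * wn (\<lambda>t. (circlepath c \<rho> t + h) - circlepath c \<rho> t)"
          by (rule wn_factorD[OF \<alpha>]) (use in1 h in \<open>auto intro!: continuous_intros simp: circlepath_01\<close>)
        also have "wn (\<lambda>t. (circlepath c \<rho> t + h) - circlepath c \<rho> t) = 0"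
          using h wn_const[of h] by simp
        also have "wn (\<lambda>t. u (circlepath c \<rho> t + h)) = wn (\<lambda>t. u (circlepath c \<rho> t))"
        proof (rule wn_nearby(1)[OF ucirc(2)])
          show "continuous_on {0..1} (\<lambda>t. u (circlepath c \<rho> t + h))"
            by (rule continuous_on_compose2[OF u(1)]) (use in1 in \<open>auto intro!: continuous_intros\<close>)
        qed (use sm in \<open>auto simp: circlepath_01\<close>)
        finally show "wn (\<lambda>t. g (circlepath c \<rho> t + h) - g (circlepath c \<rho> t)) = - 2 * \<alpha>"
          by (simp add: ucirc(1))
      qed (use \<delta> \<rho> in auto)
    qed
    show "loc_sign g z \<alpha>" if z: "z \<in> ball c r" "z \<noteq> c" for z
    proof -
      have "continuous (at z) u"
        using u(1) z(1) by (simp add: continuous_on_eq_continuous_at)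
      moreover have "cmod (u z) > 0" using uz[OF z] by simp
      ultimately obtain d where d: "d > 0" "\<And>w. dist w z < d \<Longrightarrow> dist (u w) (u z) < cmod (u z)"
        unfolding continuous_at_eps_delta by metis
      show ?thesis
        unfolding loc_sign_def
      proof (intro exI[of _ "min d (min (dist z c) (r - dist c z))"] conjI allI impI)
        fix \<rho> assume \<rho>: "0 < \<rho> \<and> \<rho> < min d (min (dist z c) (r - dist c z))"
        have sub: "cball z \<rho> \<subseteq> ball c r"
        proof
          fix x assume "x \<in> cball z \<rho>"
          then show "x \<in> ball c r" using \<rho> dist_triangle[of c x z] by simp
        qed
        have in1: "circlepath z \<rho> t \<in> ball c r" for t
          using subsetD[OF sub circlepath_in_cball] \<rho> by simp
        have nc: "circlepath z \<rho> t \<noteq> c" for t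
          using norm_circlepath[of \<rho> z t] \<rho> by (auto simp: dist_norm norm_minus_commute)
        have sm: "cmod (u (circlepath z \<rho> t) - u z) < cmod (u z)" for t
          using d(2)[of "circlepath z \<rho> t"] norm_circlepath[of \<rho> z t] \<rho> by (simp add: dist_norm)
        have "wn (\<lambda>t. g (circlepath z \<rho> t) - g z) =
          wn (\<lambda>t. u (circlepath z \<rho> t) - u z) - wn (\<lambda>t. u (circlepath z \<rho> t)) - wn (\<lambda>t. u z)"
          by (rule gu) (use in1 nc z circlepath_neq[of \<rho> z] \<rho> in \<open>auto intro!: continuous_intros\<close>)
        also have "wn (\<lambda>t. u (circlepath z \<rho> t) - u z) = \<alpha>"
          using wn_inj_circle(1)[OF u(1,2) \<alpha> sub] \<rho> by simp
        also have "wn (\<lambda>t. u (circlepath z \<rho> t)) = wn (\<lambda>t. u z)"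
        proof (rule wn_nearby(1))
          show "continuous_on {0..1} (\<lambda>t. u (circlepath z \<rho> t))"
            by (rule continuous_on_compose2[OF u(1)]) (use in1 in \<open>auto intro!: continuous_intros\<close>)
        qed (use sm uz[OF z] in \<open>auto simp: circlepath_01 intro!: nz_loopI\<close>)
        also have "wn (\<lambda>t. u z) = 0" using uz[OF z] wn_const by simp
        finally show "wn (\<lambda>t. g (circlepath z \<rho> t) - g z) = \<alpha>" by simp
      qed (use d z in auto)
    qed
  qed
qed

section \<open>Index sums of doubly periodic maps\<close>

text \<open>A loop in the punctured plane with winding number 0 is null-homotopic, and a
  null-homotopic map on the circle extends to the disc. \<open>Arg2pi\<close> converts between loops
  on the unit interval and maps on the circle.\<close>

lemma extend_nonvanishing_from_circle:
  fixes H :: "complex \<Rightarrow> complex"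
  assumes \<rho>: "\<rho> > 0" and H: "continuous_on (sphere c \<rho>) H" "\<And>z. z \<in> sphere c \<rho> \<Longrightarrow> H z \<noteq> 0"
    and w: "wn (\<lambda>t. H (circlepath c \<rho> t)) = 0"
  obtains K where "continuous_on (cball c \<rho>) K" "\<And>z. z \<in> cball c \<rho> \<Longrightarrow> K z \<noteq> 0"
    "\<And>z. z \<in> sphere c \<rho> \<Longrightarrow> K z = H z"
proof -
  define p where "p t = H (circlepath c \<rho> t)" for t
  have cs: "circlepath c \<rho> t \<in> sphere c \<rho>" for t
    using norm_circlepath[of \<rho> c t] \<rho> by (simp add: dist_norm norm_minus_commute)
  have "continuous_on {0..1} p"
    unfolding p_def[abs_def] by (rule continuous_on_compose2[OF H(1)]) (use cs in \<open>auto intro!: continuous_intros\<close>)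
  then have "path p" "0 \<notin> path_image p"
    using H(2) cs by (auto simp: path_def path_image_def p_def)
  then obtain a where "homotopic_loops (-{0}) p (\<lambda>t. a)"
    using winding_number_homotopic_loops_null_eq[of p 0] w by (auto simp: p_def[abs_def])
  then have "homotopic_with_canon (\<lambda>h. True) (sphere 0 1) (-{0}) (p \<circ> (\<lambda>z. Arg2pi z / (2 * pi)))
      ((\<lambda>t. a) \<circ> (\<lambda>z. Arg2pi z / (2 * pi)))"
    by (rule homotopic_loops_imp_homotopic_circlemaps)
  then have "\<exists>c. homotopic_with_canon (\<lambda>h. True) (sphere 0 1) (-{0}) (p \<circ> (\<lambda>z. Arg2pi z / (2 * pi))) (\<lambda>x. c)"
    by (auto simp: o_def)
  then obtain k where k: "continuous_on (cball 0 1) k" "k ` cball 0 1 \<subseteq> - {0}"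
    "\<And>x. x \<in> sphere 0 1 \<Longrightarrow> k x = p (Arg2pi x / (2 * pi))"
    unfolding nullhomotopic_from_sphere_extension by auto
  show ?thesis
  proof (rule that[of "\<lambda>z. k ((z - c) / of_real \<rho>)"])
    have im: "(z - c) / of_real \<rho> \<in> cball 0 1" if "z \<in> cball c \<rho>" for z
      using that \<rho> by (simp add: norm_divide dist_norm norm_minus_commute)
    show "continuous_on (cball c \<rho>) (\<lambda>z. k ((z - c) / of_real \<rho>))"
      by (rule continuous_on_compose2[OF k(1)]) (use im \<rho> in \<open>auto intro!: continuous_intros\<close>)
    show "k ((z - c) / of_real \<rho>) \<noteq> 0" if "z \<in> cball c \<rho>" for z
      using k(2) im[OF that] by blast
    show "k ((z - c) / of_real \<rho>) = H z" if "z \<in> sphere c \<rho>" for z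
    proof -
      define x where "x = (z - c) / of_real \<rho>"
      have x: "cmod x = 1" using that \<rho> by (simp add: x_def norm_divide dist_norm norm_minus_commute)
      have "exp (2 * of_real pi * \<i> * of_real (Arg2pi x / (2 * pi))) = exp (\<i> * of_real (Arg2pi x))"
        by (simp add: mult.commute)
      also have "\<dots> = x" using Arg2pi_eq[of x] x by simp
      finally have "circlepath c \<rho> (Arg2pi x / (2 * pi)) = z"
        using \<rho> by (simp add: circlepath_eq x_def)
      then show ?thesis
        using k(3)[of x] x by (simp add: p_def flip: x_def)
    qed
  qed
qed

lemma wn_cong_01: "(\<And>t. t \<in> {0..1} \<Longrightarrow> p t = q t) \<Longrightarrow> wn p = wn q"
  by (rule winding_number_cong) auto

lemma rectpath_in: "Re a < Re b \<Longrightarrow> Im a < Im b \<Longrightarrow> t \<in> {0..1} \<Longrightarrow> rectpath a b t \<in> cbox a b - box a b"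
  using path_image_rectpath_cbox_minus_box[of a b] by (auto simp: path_image_def)

lemma nz_loop_rectpath:
  assumes "Re a < Re b" "Im a < Im b" "continuous_on (cbox a b - box a b) F" "\<And>z. z \<in> cbox a b - box a b \<Longrightarrow> F z \<noteq> 0"
  shows "nz_loop (\<lambda>t. F (rectpath a b t))"
proof (rule nz_loopI)
  have "continuous_on {0..1} (rectpath a b)" using path_rectpath[of a b] by (simp add: path_def)
  then show "continuous_on {0..1} (\<lambda>t. F (rectpath a b t))"
    using rectpath_in[OF assms(1,2)] by (intro continuous_on_compose2[OF assms(3)]) auto
  show "F (rectpath a b 0) = F (rectpath a b 1)"
    using pathstart_rectpath[of a b] pathfinish_rectpath[of a b] by (simp add: pathstart_def pathfinish_def)
qed (use assms rectpath_in in blast)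

text \<open>Dividing by powers of \<open>z - c\<close> makes the function extend without zeros over the discs; a function
  without zeros on the whole rectangle has a logarithm.\<close>

lemma argument_principle_rect:
  fixes F :: "complex \<Rightarrow> complex"
  assumes "finite C" and \<rho>: "\<rho> > 0" and ab: "Re a < Re b" "Im a < Im b"
    and "\<And>c. c \<in> C \<Longrightarrow> cball c \<rho> \<subseteq> box a b"
    and "\<And>c c'. c \<in> C \<Longrightarrow> c' \<in> C \<Longrightarrow> c \<noteq> c' \<Longrightarrow> cball c \<rho> \<inter> cball c' \<rho> = {}"
    and "continuous_on (cbox a b - (\<Union>c\<in>C. ball c \<rho>)) F"
    and "\<And>z. z \<in> cbox a b - (\<Union>c\<in>C. ball c \<rho>) \<Longrightarrow> F z \<noteq> 0"
  shows "wn (\<lambda>t. F (rectpath a b t)) = (\<Sum>c\<in>C. wn (\<lambda>t. F (circlepath c \<rho> t)))"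
  using assms(1,5-)
proof (induction C arbitrary: F rule: finite_induct)
  case empty
  then have cF: "continuous_on (cbox a b) F" and F0: "\<And>z. z \<in> cbox a b \<Longrightarrow> F z \<noteq> 0"
    by auto
  have "contractible (cbox a b)" by (simp add: convex_imp_contractible)
  then obtain L where L: "continuous_on (cbox a b) L" "\<And>z. z \<in> cbox a b \<Longrightarrow> F z = exp (L z)"
    using continuous_logarithm_on_contractible[OF cF _ F0] by metis
  have cr: "continuous_on {0..1} (rectpath a b)" using path_rectpath[of a b] by (simp add: path_def)
  have "wn (\<lambda>t. F (rectpath a b t)) = (L (rectpath a b 1) - L (rectpath a b 0)) / (2 * of_real pi * \<i>)"
    using rectpath_in[OF ab] by (intro wn_exp continuous_on_compose2[OF L(1) cr] L(2)) auto
  then show ?case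
    using pathstart_rectpath[of a b] pathfinish_rectpath[of a b] by (simp add: pathstart_def pathfinish_def)
next
  case (insert c C)
  let ?K = "cbox a b - (\<Union>c\<in>insert c C. ball c \<rho>)"
  let ?K' = "cbox a b - (\<Union>c\<in>C. ball c \<rho>)"
  have cb: "cball c \<rho> \<subseteq> box a b" using insert.prems by auto
  have box_sub: "box a b \<subseteq> cbox a b" by (rule box_subset_cbox)
  have disj: "cball c \<rho> \<inter> cball c' \<rho> = {}" if "c' \<in> C" for c'
    using insert.prems(2)[of c c'] insert.hyps that by auto
  have sphere_K: "sphere c' \<rho> \<subseteq> ?K" if "c' \<in> insert c C" for c'
  proof
    fix z assume z: "z \<in> sphere c' \<rho>"
    have "z \<in> cbox a b" using insert.prems(1)[OF that] z box_sub by auto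
    moreover have "z \<notin> ball c'' \<rho>" if "c'' \<in> insert c C" for c''
      using insert.prems(2)[OF \<open>c' \<in> insert c C\<close> that] z by (cases "c'' = c'") auto
    ultimately show "z \<in> ?K" by auto
  qed
  have circle_loop: "nz_loop (\<lambda>t. G (circlepath c' \<rho> t))"
    if "continuous_on (sphere c' \<rho>) G" "\<And>z. z \<in> sphere c' \<rho> \<Longrightarrow> G z \<noteq> 0" for G c'
  proof -
    have "circlepath c' \<rho> t \<in> sphere c' \<rho>" for t
      using norm_circlepath[of \<rho> c' t] \<rho> by (simp add: dist_norm norm_minus_commute)
    then show ?thesis
      using that by (intro nz_loopI continuous_on_compose2[OF that(1)])
        (auto intro!: continuous_intros simp: circlepath_01)
  qed
  have cF: "nz_loop (\<lambda>t. F (circlepath c' \<rho> t))" if "c' \<in> insert c C" for c'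
    by (rule circle_loop[OF continuous_on_subset[OF insert.prems(3) sphere_K[OF that]]])
      (use insert.prems(4) sphere_K[OF that] in blast)
  obtain m where m: "wn (\<lambda>t. F (circlepath c \<rho> t)) = of_int m"
    using wn_int[OF cF[of c]] by auto
  define G where "G z = F z * (z - c) powi (- m)" for z
  have zc: "z \<noteq> c" if "z \<in> ?K" for z using that \<rho> by auto
  have contG: "continuous_on ?K G"
    unfolding G_def[abs_def] using zc by (intro continuous_intros insert.prems(3)) auto
  have G0: "G z \<noteq> 0" if "z \<in> ?K" for z
    using zc[OF that] insert.prems(4)[OF that] by (simp add: G_def)
  have lin: "nz_loop (\<lambda>t. circlepath c' \<rho> t - c)" if "c' \<in> insert c C" for c'
  proof (rule circle_loop[of c' "\<lambda>z. z - c"])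
    show "z - c \<noteq> 0" if "z \<in> sphere c' \<rho>" for z
      using zc sphere_K[OF \<open>c' \<in> insert c C\<close>] that by (metis right_minus_eq subsetD)
  qed (auto intro!: continuous_intros)
  have wnG: "wn (\<lambda>t. G (circlepath c' \<rho> t)) = wn (\<lambda>t. F (circlepath c' \<rho> t)) - of_int m * wn (\<lambda>t. circlepath c' \<rho> t - c)"
    if "c' \<in> insert c C" for c'
    using wn_mult[of "\<lambda>t. F (circlepath c' \<rho> t)" "\<lambda>t. (circlepath c' \<rho> t - c) powi (- m)"]
      cF[OF that] lin[OF that] wn_powi[of "\<lambda>t. circlepath c' \<rho> t - c" "-m"]
    by (simp add: G_def nz_loop_def nz_path_powi del: power_int_minus)
  have "wn (\<lambda>t. G (circlepath c \<rho> t)) = 0"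
    using wnG[of c] m circlepath_wn[OF \<rho>, of c] by simp
  then obtain k where k: "continuous_on (cball c \<rho>) k" "\<And>z. z \<in> cball c \<rho> \<Longrightarrow> k z \<noteq> 0"
    "\<And>z. z \<in> sphere c \<rho> \<Longrightarrow> k z = G z"
    using extend_nonvanishing_from_circle[OF \<rho>, of c G] G0 sphere_K[of c]
      continuous_on_subset[OF contG sphere_K[of c]] by (metis insertI1 subsetD)
  \<comment> \<open>On the disc around c the quotient G is replaced by its extension without zeros.
    This removes c from the exceptional set, so the induction hypothesis applies to G'.\<close>
  define G' where "G' z = (if z \<in> cball c \<rho> then k z else G z)" for z
  have K'_eq: "?K' = cball c \<rho> \<union> ?K"
    using cb box_sub disj by (fastforce simp: less_imp_le)
  have G'G: "G' z = G z" if "z \<in> ?K" for z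
    using that k(3) by (auto simp: G'_def)
  have contG': "continuous_on ?K' G'"
    unfolding K'_eq
  proof (rule continuous_on_closed_Un)
    show "closed ?K" by (intro closed_Diff open_UN) auto
    show "continuous_on (cball c \<rho>) G'"
      by (rule continuous_on_eq[OF k(1)]) (simp add: G'_def)
    show "continuous_on ?K G'"
      by (rule continuous_on_eq[OF contG]) (simp add: G'G)
  qed auto
  have IH: "wn (\<lambda>t. G' (rectpath a b t)) = (\<Sum>c\<in>C. wn (\<lambda>t. G' (circlepath c \<rho> t)))"
  proof (rule insert.IH)
    show "G' z \<noteq> 0" if "z \<in> ?K'" for z
      using that G0 G'G k(2) unfolding K'_eq by (auto simp: G'_def)
  qed (use insert.prems contG' in auto)
  have circle_in: "circlepath c' \<rho> t \<in> sphere c' \<rho>" for c' t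
    using norm_circlepath[of \<rho> c' t] \<rho> by (simp add: dist_norm norm_minus_commute)
  have "wn (\<lambda>t. G' (circlepath c' \<rho> t)) = wn (\<lambda>t. F (circlepath c' \<rho> t))" if c': "c' \<in> C" for c'
  proof -
    have "wn (\<lambda>t. G' (circlepath c' \<rho> t)) = wn (\<lambda>t. G (circlepath c' \<rho> t))"
      using subsetD[OF sphere_K circle_in] c' by (intro wn_cong_01 G'G) blast
    moreover have "wn (\<lambda>t. circlepath c' \<rho> t - c) = 0"
    proof -
      have "c \<notin> cball c' \<rho>" using disj[OF c'] \<rho> by force
      then have "winding_number (circlepath c' \<rho>) c = 0"
        using \<rho> by (intro winding_number_zero_outside[of _ "cball c' \<rho>"]) auto
      then show ?thesis using winding_number_offset[of "circlepath c' \<rho>" c] by simp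
    qed
    ultimately show ?thesis using wnG[of c'] c' by simp
  qed
  moreover have "wn (\<lambda>t. F (rectpath a b t)) = wn (\<lambda>t. G' (rectpath a b t)) + of_int m"
  proof -
    have bK: "cbox a b - box a b \<subseteq> ?K"
      using insert.prems(1) by (force simp: less_imp_le)
    have nF: "nz_loop (\<lambda>t. F (rectpath a b t))"
      by (rule nz_loop_rectpath[OF ab continuous_on_subset[OF insert.prems(3) bK]]) (use bK insert.prems(4) in blast)
    have nL: "nz_loop (\<lambda>t. rectpath a b t - c)"
      by (rule nz_loop_rectpath[OF ab, of "\<lambda>z. z - c"]) (use subsetD[OF cb, of c] \<rho> in \<open>auto intro!: continuous_intros\<close>)
    have "c \<in> box a b" using subsetD[OF cb, of c] \<rho> by auto
    then have 1: "wn (\<lambda>t. rectpath a b t - c) = 1"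
      using winding_number_rectpath winding_number_offset[of "rectpath a b" c] by simp
    have "wn (\<lambda>t. G' (rectpath a b t)) = wn (\<lambda>t. G (rectpath a b t))"
      using bK rectpath_in[OF ab] by (intro wn_cong_01 G'G) blast
    also have "\<dots> = wn (\<lambda>t. F (rectpath a b t)) - of_int m"
      using wn_mult[of "\<lambda>t. F (rectpath a b t)" "\<lambda>t. (rectpath a b t - c) powi (- m)"]
        nF nL wn_powi[of "\<lambda>t. rectpath a b t - c" "-m"] 1
      by (simp add: G_def nz_loop_def nz_path_powi del: power_int_minus)
    finally show ?thesis by simp
  qed
  ultimately show ?case
    using IH m insert.hyps by simp
qed

text \<open>Opposite sides of the square carry the same values of F and are traversed in opposite
  directions, so their contributions cancel.\<close>

lemma wn_rectpath_periodic:
  fixes F :: "complex \<Rightarrow> complex"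
  assumes F: "continuous_on (cbox a (a + 1 + \<i>) - box a (a + 1 + \<i>)) F"
      "\<And>z. z \<in> cbox a (a + 1 + \<i>) - box a (a + 1 + \<i>) \<Longrightarrow> F z \<noteq> 0"
    and per: "\<And>z. F (z + 1) = F z" "\<And>z. F (z + \<i>) = F z"
  shows "wn (\<lambda>t. F (rectpath a (a + 1 + \<i>) t)) = 0"
proof -
  let ?b = "a + 1 + \<i>"
  let ?a2 = "a + 1" and ?a4 = "a + \<i>"
  have R: "rectpath a ?b = linepath a ?a2 +++ linepath ?a2 ?b +++ linepath ?b ?a4 +++ linepath ?a4 a"
  proof -
    have "Complex (Re ?b) (Im a) = ?a2" "Complex (Re a) (Im ?b) = ?a4"
      by (auto simp: complex_eq_iff)
    then show ?thesis by (simp add: rectpath_def Let_def)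
  qed
  let ?S = "cbox a ?b - box a ?b"
  have "path_image (rectpath a ?b) = ?S"
    by (rule path_image_rectpath_cbox_minus_box) auto
  moreover have "path_image (rectpath a ?b) = closed_segment a ?a2 \<union> closed_segment ?a2 ?b \<union> closed_segment ?b ?a4 \<union> closed_segment ?a4 a"
    unfolding R by (simp add: path_image_join Un_assoc)
  ultimately have seg: "closed_segment a ?a2 \<subseteq> ?S" "closed_segment ?a2 ?b \<subseteq> ?S" "closed_segment ?b ?a4 \<subseteq> ?S"
      "closed_segment ?a4 a \<subseteq> ?S"
    by auto
  have pth: "path (F \<circ> linepath x y)" "0 \<notin> path_image (F \<circ> linepath x y)"
    if "closed_segment x y \<subseteq> ?S" for x y
  proof -
    show "path (F \<circ> linepath x y)"
      using that by (intro path_continuous_image continuous_on_subset[OF F(1)]) auto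
    show "0 \<notin> path_image (F \<circ> linepath x y)"
      using that F(2) by (auto simp: path_image_compose)
  qed
  have "wn (\<lambda>t. F (rectpath a ?b t)) = wn ((F \<circ> linepath a ?a2) +++ (F \<circ> linepath ?a2 ?b) +++ (F \<circ> linepath ?b ?a4) +++ (F \<circ> linepath ?a4 a))"
    unfolding R path_compose_join[symmetric] by (simp add: o_def)
  also have "\<dots> = wn (F \<circ> linepath a ?a2) + wn (F \<circ> linepath ?a2 ?b) + wn (F \<circ> linepath ?b ?a4) + wn (F \<circ> linepath ?a4 a)"
    using pth[OF seg(1)] pth[OF seg(2)] pth[OF seg(3)] pth[OF seg(4)]
    by (simp add: winding_number_join path_image_join pathstart_compose pathfinish_compose)
  also have "F \<circ> linepath ?b ?a4 = reversepath (F \<circ> linepath a ?a2)"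
  proof
    fix t
    have "linepath ?b ?a4 t = linepath a ?a2 (1 - t) + \<i>"
      by (simp add: linepath_def algebra_simps scaleR_conv_of_real)
    then show "(F \<circ> linepath ?b ?a4) t = reversepath (F \<circ> linepath a ?a2) t"
      using per(2) by (simp add: reversepath_def)
  qed
  also have "F \<circ> linepath ?a2 ?b = reversepath (F \<circ> linepath ?a4 a)"
  proof
    fix t
    have "linepath ?a2 ?b t = linepath ?a4 a (1 - t) + 1"
      by (simp add: linepath_def algebra_simps scaleR_conv_of_real)
    then show "(F \<circ> linepath ?a2 ?b) t = reversepath (F \<circ> linepath ?a4 a) t"
      using per(1) by (simp add: reversepath_def)
  qed
  also have "wn (F \<circ> linepath a ?a2) + wn (reversepath (F \<circ> linepath ?a4 a)) + wn (reversepath (F \<circ> linepath a ?a2)) + wn (F \<circ> linepath ?a4 a) = 0"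
    using pth[OF seg(1)] pth[OF seg(4)] by (simp add: winding_number_reversepath)
  finally show ?thesis .
qed

text \<open>The weights are indices divided by a common nonzero factor, so the conclusion is free of
  orientations. The constants \<kappa>1 and \<kappa>2 cover lifts of torus maps as well as functions
  on the torus itself. The first conjunct guarantees that no exceptional point sits on the boundary
  of the square, so the sum can later be read as a sum over the torus.\<close>

theorem doubly_periodic_index:
  fixes g :: "complex \<Rightarrow> complex" and e :: "complex \<Rightarrow> nat" and Pol Bd :: "complex set"
  defines "Bd \<equiv> Pol \<union> {z. e z \<noteq> 1}"
  assumes fin: "\<And>a b. finite (Bd \<inter> cbox a b)"
    and good: "\<And>z. z \<notin> Pol \<Longrightarrow> pow_at g z (e z)"
    and pol: "\<And>z. z \<in> Pol \<Longrightarrow> \<exists>r>0. \<exists>u. continuous_on (ball z r) u \<and> inj_on u (ball z r) \<and> u z = 0 \<and>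
        (\<forall>w\<in>ball z r. w \<noteq> z \<longrightarrow> g w = inverse (u w))"
    and per: "\<And>z. g (z + 1) = g z + \<kappa>1" "\<And>z. g (z + \<i>) = g z + \<kappa>2"
  shows "\<exists>a. (\<forall>z\<in>Bd \<inter> cbox a (a + 1 + \<i>). z \<in> box a (a + 1 + \<i>)) \<and>
    (\<Sum>z\<in>Bd \<inter> box a (a + 1 + \<i>). if z \<in> Pol then - 2 else int (e z) - 1) = 0"
proof -
  have cb: "countable Bd"
  proof -
    have "z \<in> (\<Union>n. Bd \<inter> cbox (- of_nat n * (1 + \<i>)) (of_nat n * (1 + \<i>)))" if "z \<in> Bd" for z
    proof -
      obtain n :: nat where "\<bar>Re z\<bar> + \<bar>Im z\<bar> \<le> real n" using real_arch_simple by blast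
      then have "z \<in> cbox (- of_nat n * (1 + \<i>)) (of_nat n * (1 + \<i>))"
        by (auto simp: in_cbox_complex_iff)
      then show ?thesis using that by blast
    qed
    then have "Bd \<subseteq> (\<Union>n. Bd \<inter> cbox (- of_nat n * (1 + \<i>)) (of_nat n * (1 + \<i>)))" by blast
    then show ?thesis
      by (rule countable_subset) (intro countable_UN countableI_type countable_finite fin)
  qed
  have ex_avoid: "\<exists>x::real. x \<notin> A" if "countable A" for A
    using that uncountable_UNIV_real by (metis UNIV_eq_I)
  \<comment> \<open>Only countably many vertical lines meet Bd. Avoiding also the real parts shifted
    by 1 clears both vertical sides of the square; y0 does the same for the horizontal ones.\<close>
  obtain x0 where x0: "x0 \<notin> Re ` Bd \<union> (\<lambda>z. Re z - 1) ` Bd"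
    using ex_avoid[of "Re ` Bd \<union> (\<lambda>z. Re z - 1) ` Bd"] cb by (meson countable_Un countable_image)
  obtain y0 where y0: "y0 \<notin> Im ` Bd \<union> (\<lambda>z. Im z - 1) ` Bd"
    using ex_avoid[of "Im ` Bd \<union> (\<lambda>z. Im z - 1) ` Bd"] cb by (meson countable_Un countable_image)
  define a where "a = Complex x0 y0"
  define b where "b = a + 1 + \<i>"
  have ab: "Re a < Re b" "Im a < Im b" by (auto simp: b_def)
  have bd: "z \<in> box a b" if "z \<in> Bd" "z \<in> cbox a b" for z
  proof -
    have "Re z \<noteq> x0" "Re z \<noteq> x0 + 1" "Im z \<noteq> y0" "Im z \<noteq> y0 + 1"
      using that(1) x0 y0 by (auto simp: image_iff)
    then show ?thesis
      using that(2) by (auto simp: in_cbox_complex_iff in_box_complex_iff a_def b_def)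
  qed
  define C where "C = Bd \<inter> box a b"
  have finC: "finite C"
    using finite_subset[OF _ fin[of a b], of C] box_subset_cbox[of a b] by (auto simp: C_def)
  have isol: "\<exists>d>0. \<forall>w\<in>ball z d. w \<in> Bd \<longrightarrow> w = z" for z
  proof -
    have sub: "ball z 1 \<subseteq> cbox (z - (1 + \<i>)) (z + (1 + \<i>))"
    proof
      fix w assume "w \<in> ball z 1"
      then have "cmod (w - z) < 1" by (simp add: dist_norm norm_minus_commute)
      then have "\<bar>Re (w - z)\<bar> < 1" "\<bar>Im (w - z)\<bar> < 1"
        using abs_Re_le_cmod[of "w - z"] abs_Im_le_cmod[of "w - z"] by linarith+
      then show "w \<in> cbox (z - (1 + \<i>)) (z + (1 + \<i>))"
        by (auto simp: in_cbox_complex_iff)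
    qed
    have "finite (Bd \<inter> ball z 1)"
      by (rule finite_subset[OF _ fin[of "z - (1 + \<i>)" "z + (1 + \<i>)"]]) (use sub in auto)
    then obtain d where "d > 0" "\<forall>w\<in>Bd \<inter> ball z 1. w \<noteq> z \<longrightarrow> d \<le> dist z w"
      using finite_set_avoid[of "Bd \<inter> ball z 1" z] by auto
    then show ?thesis
      by (intro exI[of _ "min d 1"]) force
  qed
  have oBd: "open (- Bd)"
    unfolding open_contains_ball
  proof
    fix z assume "z \<in> - Bd"
    then show "\<exists>d>0. ball z d \<subseteq> - Bd" using isol[of z] by blast
  qed
  have conD: "connected (- Bd)"
    using connected_open_diff_countable[of UNIV Bd] cb connected_UNIV by (simp add: Compl_eq_Diff_UNIV)
  have near: "\<exists>w\<in>ball z r. w \<notin> Bd \<and> w \<noteq> z" if "r > 0" for z r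
  proof -
    have "countable (insert z Bd)" using cb by simp
    then have "\<not> ball z r \<subseteq> insert z Bd"
      using countable_subset uncountable_ball[OF that] by blast
    then show ?thesis by auto
  qed
  have sgn1: "\<exists>\<epsilon> d. \<epsilon> \<noteq> 0 \<and> d > 0 \<and> (\<forall>w\<in>ball z d. loc_sign g w \<epsilon>)" if "z \<notin> Bd" for z
  proof -
    have "pow_at g z 1" using good[of z] that by (auto simp: Bd_def)
    from pow_at_index[OF this] obtain \<epsilon> R where "\<epsilon> \<noteq> 0" "R > 0" "\<forall>w\<in>ball z R. w \<noteq> z \<or> 1 = (1::nat) \<longrightarrow> loc_sign g w \<epsilon>"
      by (elim exE conjE) (rule that)
    then show ?thesis by (intro exI[of _ \<epsilon>] exI[of _ R]) simp
  qed
  \<comment> \<open>The sign is locally constant off Bd, and the plane minus the countable set Bd is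
    connected.\<close>
  have same: "\<exists>\<epsilon>. loc_sign g x \<epsilon> \<and> loc_sign g y \<epsilon>" if "x \<in> - Bd" "y \<in> - Bd" for x y
  proof (rule connected_equivalence_relation[OF conD that])
    show "\<exists>T. openin (top_of_set (- Bd)) T \<and> z \<in> T \<and> (\<forall>x\<in>T. \<exists>\<epsilon>. loc_sign g z \<epsilon> \<and> loc_sign g x \<epsilon>)" if "z \<in> - Bd" for z
    proof -
      obtain \<epsilon> d where "d > 0" "\<forall>w\<in>ball z d. loc_sign g w \<epsilon>" using sgn1[of z] \<open>z \<in> - Bd\<close> by blast
      then show ?thesis
        using \<open>z \<in> - Bd\<close> by (intro exI[of _ "- Bd \<inter> ball z d"] conjI ballI exI[of _ \<epsilon>] openin_open_Int) auto
    qed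
    show "\<exists>\<epsilon>. loc_sign g x \<epsilon> \<and> loc_sign g z \<epsilon>"
      if "\<exists>\<epsilon>. loc_sign g x \<epsilon> \<and> loc_sign g y \<epsilon>" "\<exists>\<epsilon>. loc_sign g y \<epsilon> \<and> loc_sign g z \<epsilon>" for x y z
      using that loc_sign_unique by metis
  qed auto
  obtain w0 where w0: "w0 \<notin> Bd" using near[of 1 0] by auto
  obtain \<epsilon>0 where \<epsilon>0: "\<epsilon>0 \<noteq> 0" "loc_sign g w0 \<epsilon>0"
    using sgn1[OF w0] by (metis centre_in_ball)
  have all: "loc_sign g w \<epsilon>0" if "w \<notin> Bd" for w
    using same[of w0 w] w0 that \<epsilon>0(2) loc_sign_unique by (metis ComplI)
  define wt where "wt z = (if z \<in> Pol then - 2 else int (e z) - 1)" for z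
  \<comment> \<open>The factor found at an exceptional point is also the sign at ordinary points
    next to it, so it must be the global \<epsilon>0.\<close>
  have index: "\<exists>R>0. \<forall>\<rho>. 0 < \<rho> \<and> \<rho> < R \<longrightarrow> diff_index g c \<rho> (\<epsilon>0 * of_int (wt c))" for c
  proof (cases "c \<in> Pol")
    case True
    then obtain r u where r: "r > 0" "continuous_on (ball c r) u" "inj_on u (ball c r)" "u c = 0"
        "\<forall>w\<in>ball c r. w \<noteq> c \<longrightarrow> g w = inverse (u w)"
      using pol[OF True] by (elim exE conjE) (rule that)
    obtain \<epsilon> where \<epsilon>: "\<forall>\<rho>. 0 < \<rho> \<longrightarrow> \<rho> < r \<longrightarrow> diff_index g c \<rho> (- 2 * \<epsilon>)"
      "\<forall>z\<in>ball c r. z \<noteq> c \<longrightarrow> loc_sign g z \<epsilon>"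
      using pole_index[OF r] by (elim exE conjE) (rule that)
    obtain w where "w \<in> ball c r" "w \<notin> Bd" "w \<noteq> c" using near[OF r(1)] by blast
    then have "\<epsilon> = \<epsilon>0" using \<epsilon>(2) all loc_sign_unique by blast
    then show ?thesis
      using \<epsilon>(1) r(1) True by (intro exI[of _ r]) (auto simp: wt_def mult.commute)
  next
    case False
    obtain \<epsilon> R where \<epsilon>: "R > 0" "\<forall>\<rho>. 0 < \<rho> \<longrightarrow> \<rho> < R \<longrightarrow> diff_index g c \<rho> (\<epsilon> * of_nat (e c - 1))"
      "\<forall>z\<in>ball c R. z \<noteq> c \<or> e c = 1 \<longrightarrow> loc_sign g z \<epsilon>"
      using pow_at_index[OF good[OF False]] by (elim exE conjE) (rule that)
    obtain w where "w \<in> ball c R" "w \<notin> Bd" "w \<noteq> c" using near[OF \<epsilon>(1)] by blast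
    then have "\<epsilon> = \<epsilon>0" using \<epsilon>(3) all loc_sign_unique by blast
    moreover have "e c \<ge> 1" using good[OF False] by (simp add: pow_at_def)
    ultimately show ?thesis
      using \<epsilon>(1,2) False by (intro exI[of _ R]) (auto simp: wt_def of_nat_diff)
  qed
  \<comment> \<open>The radius is fixed before h: \<open>diff_index\<close> lets the bound on h
    depend on \<rho>. As C is finite, one radius and then one bound serve all its points.\<close>
  define ok where "ok c \<rho> \<longleftrightarrow> cball c \<rho> \<subseteq> box a b \<and> (\<forall>c'\<in>C. c \<noteq> c' \<longrightarrow> cball c \<rho> \<inter> cball c' \<rho> = {})
      \<and> diff_index g c \<rho> (\<epsilon>0 * of_int (wt c))" for c \<rho>
  have "\<forall>\<^sub>F \<rho> in at_right 0. \<forall>c\<in>C. ok c \<rho>"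
  proof (intro eventually_ball_finite[OF finC] ballI)
    fix c assume c: "c \<in> C"
    obtain R where R: "R > 0" "\<And>\<rho>. 0 < \<rho> \<Longrightarrow> \<rho> < R \<Longrightarrow> diff_index g c \<rho> (\<epsilon>0 * of_int (wt c))"
      using index[of c] by blast
    obtain R1 where R1: "R1 > 0" "cball c R1 \<subseteq> box a b"
      using c open_box[of a b] unfolding open_contains_cball C_def by blast
    obtain d where d: "d > 0" "\<forall>w\<in>ball c d. w \<in> Bd \<longrightarrow> w = c" using isol[of c] by blast
    have "\<forall>\<^sub>F \<rho> in at_right 0. \<rho> \<in> {0<..<min R (min R1 (d/2))}"
      using R R1 d by (intro eventually_at_right_real) auto
    then show "\<forall>\<^sub>F \<rho> in at_right 0. ok c \<rho>"
    proof (rule eventually_mono)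
      fix \<rho> assume \<rho>: "\<rho> \<in> {0<..<min R (min R1 (d/2))}"
      have "cball c \<rho> \<subseteq> box a b" using R1(2) \<rho> by force
      moreover have "cball c \<rho> \<inter> cball c' \<rho> = {}" if "c' \<in> C" "c \<noteq> c'" for c'
      proof -
        have "c' \<notin> ball c d" using d(2) that by (auto simp: C_def)
        then have "dist c c' \<ge> d" by simp
        then show ?thesis
          using \<rho> disjoint_cballI[of \<rho> \<rho> c c'] by auto
      qed
      ultimately show "ok c \<rho>" using \<rho> R(2)[of \<rho>] by (auto simp: ok_def)
    qed
  qed
  moreover have "\<forall>\<^sub>F \<rho> in at_right 0. \<rho> > (0::real)"
    by (rule eventually_at_right_less)
  ultimately have "\<exists>\<rho>::real. (\<forall>c\<in>C. ok c \<rho>) \<and> \<rho> > 0"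
    using eventually_happens'[OF trivial_limit_at_right_real] eventually_conj by blast
  then obtain \<rho> :: real where \<rho>: "\<rho> > 0" "\<And>c. c \<in> C \<Longrightarrow> cball c \<rho> \<subseteq> box a b"
      "\<And>c c'. c \<in> C \<Longrightarrow> c' \<in> C \<Longrightarrow> c \<noteq> c' \<Longrightarrow> cball c \<rho> \<inter> cball c' \<rho> = {}"
    and \<rho>\<delta>: "\<And>c. c \<in> C \<Longrightarrow> diff_index g c \<rho> (\<epsilon>0 * of_int (wt c))"
    unfolding ok_def by blast
  have "\<forall>\<^sub>F \<delta> in at_right 0. \<forall>c\<in>C. \<forall>h. h \<noteq> 0 \<and> cmod h < \<delta> \<longrightarrow>
        wn (\<lambda>t. g (circlepath c \<rho> t + h) - g (circlepath c \<rho> t)) = \<epsilon>0 * of_int (wt c)"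
  proof (intro eventually_ball_finite[OF finC] ballI)
    fix c assume "c \<in> C"
    then obtain \<delta> where \<delta>: "\<delta> > 0" "\<forall>h. h \<noteq> 0 \<and> cmod h < \<delta> \<longrightarrow>
        wn (\<lambda>t. g (circlepath c \<rho> t + h) - g (circlepath c \<rho> t)) = \<epsilon>0 * of_int (wt c)"
      using \<rho>\<delta> unfolding diff_index_def by blast
    show "\<forall>\<^sub>F \<delta> in at_right 0. \<forall>h. h \<noteq> 0 \<and> cmod h < \<delta> \<longrightarrow>
        wn (\<lambda>t. g (circlepath c \<rho> t + h) - g (circlepath c \<rho> t)) = \<epsilon>0 * of_int (wt c)"
      using eventually_at_right_real[OF \<delta>(1)] by (rule eventually_mono) (use \<delta>(2) in auto)
  qed
  moreover have "\<forall>\<^sub>F \<delta> in at_right 0. \<delta> > (0::real)"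
    by (rule eventually_at_right_less)
  ultimately have "\<exists>\<delta>::real. (\<forall>c\<in>C. \<forall>h. h \<noteq> 0 \<and> cmod h < \<delta> \<longrightarrow>
        wn (\<lambda>t. g (circlepath c \<rho> t + h) - g (circlepath c \<rho> t)) = \<epsilon>0 * of_int (wt c)) \<and> \<delta> > 0"
    using eventually_happens'[OF trivial_limit_at_right_real] eventually_conj by blast
  then obtain \<delta>1 :: real where \<delta>1: "\<delta>1 > 0" "\<And>c h. c \<in> C \<Longrightarrow> h \<noteq> 0 \<Longrightarrow> cmod h < \<delta>1 \<Longrightarrow>
        wn (\<lambda>t. g (circlepath c \<rho> t + h) - g (circlepath c \<rho> t)) = \<epsilon>0 * of_int (wt c)"
    by blast
  define K where "K = cbox a b - (\<Union>c\<in>C. ball c \<rho>)"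
  have compK: "compact K"
    unfolding K_def by (intro compact_diff open_UN) auto
  have K_good: "z \<notin> Bd" if "z \<in> K" for z
  proof
    assume zB: "z \<in> Bd"
    then have "z \<in> C" using bd[of z] that by (auto simp: K_def C_def)
    then have "z \<in> (\<Union>c\<in>C. ball c \<rho>)" using \<rho>(1) by force
    then show False using that by (simp add: K_def)
  qed
  have "\<exists>r>0. inj_on g (ball z r) \<and> continuous_on (ball z r) g" if z: "z \<in> K" for z
  proof -
    have "pow_at g z 1" using good[of z] K_good[OF z] by (auto simp: Bd_def)
    then obtain r s and A B :: "complex \<Rightarrow> complex" where r: "r > 0" "s > 0" "continuous_on (ball z r) A" "inj_on A (ball z r)"
       "continuous_on (ball 0 s) B" "inj_on B (ball 0 s)" "\<forall>w\<in>ball z r. A w \<in> ball 0 s \<and> g w = B (A w)"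
      unfolding power_one_right by (elim pow_atE) (simp only: power_one_right)
    have "inj_on g (ball z r)"
      using r(4,6,7) by (auto simp: inj_on_def)
    moreover have "continuous_on (ball z r) (\<lambda>w. B (A w))"
      by (rule continuous_on_compose2[OF r(5) r(3)]) (use r(7) in auto)
    then have "continuous_on (ball z r) g"
      by (rule continuous_on_eq) (use r(7) in auto)
    ultimately show ?thesis using r(1) by blast
  qed
  then obtain rr where rr: "\<And>z. z \<in> K \<Longrightarrow> rr z > 0 \<and> inj_on g (ball z (rr z)) \<and> continuous_on (ball z (rr z)) g"
    by metis
  \<comment> \<open>A Lebesgue number for the cover of K by balls on which g is injective: a shift
    by less than \<delta>0 stays in one of these balls, so the increment has no zero on K.\<close>
  obtain \<delta>0 where \<delta>0: "\<delta>0 > 0" "\<And>x. x \<in> K \<Longrightarrow> \<exists>G\<in>(\<lambda>z. ball z (rr z)) ` K. ball x \<delta>0 \<subseteq> G"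
  proof (rule Heine_Borel_lemma[OF compK, of "(\<lambda>z. ball z (rr z)) ` K"])
    show "K \<subseteq> \<Union> ((\<lambda>z. ball z (rr z)) ` K)" using rr by force
  qed auto
  define h :: complex where "h = of_real (min \<delta>0 \<delta>1 / 2)"
  have h: "h \<noteq> 0" "cmod h < \<delta>0" "cmod h < \<delta>1"
    using \<delta>0(1) \<delta>1(1) by (auto simp: h_def min_def)
  have Kg: "isCont g z \<and> isCont g (z + h) \<and> g (z + h) \<noteq> g z" if z: "z \<in> K" for z
  proof -
    obtain x where x: "x \<in> K" "ball z \<delta>0 \<subseteq> ball x (rr x)" using \<delta>0(2)[OF z] by auto
    have in2: "z \<in> ball x (rr x)" "z + h \<in> ball x (rr x)"
      using x(2) h(2) \<delta>0(1) by (auto simp: dist_norm subset_iff)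
    have "g (z + h) \<noteq> g z"
      using rr[OF x(1)] inj_onD[of g "ball x (rr x)" "z + h" z] in2 h(1) by auto
    then show ?thesis
      using rr[OF x(1)] in2 by (simp add: continuous_on_eq_continuous_at)
  qed
  define F where "F z = g (z + h) - g z" for z
  have contF: "continuous_on K F"
    unfolding F_def[abs_def]
  proof (intro continuous_at_imp_continuous_on ballI)
    fix z assume "z \<in> K"
    then have "isCont g z" "isCont g (z + h)" using Kg by auto
    moreover have "isCont (\<lambda>z. z + h) z" by (intro continuous_intros)
    ultimately show "isCont (\<lambda>z. g (z + h) - g z) z"
      using isCont_o2[of z "\<lambda>z. z + h" g] by (intro continuous_diff) auto
  qed
  have F0: "F z \<noteq> 0" if "z \<in> K" for z
    using Kg[OF that] by (simp add: F_def)
  have "wn (\<lambda>t. F (rectpath a b t)) = (\<Sum>c\<in>C. wn (\<lambda>t. F (circlepath c \<rho> t)))"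
    by (rule argument_principle_rect[OF finC \<rho>(1) ab \<rho>(2,3)]) (use contF F0 in \<open>auto simp: K_def\<close>)
  also have "\<dots> = (\<Sum>c\<in>C. \<epsilon>0 * of_int (wt c))"
    using h \<delta>1(2) by (intro sum.cong) (auto simp: F_def)
  also have "\<dots> = \<epsilon>0 * of_int (\<Sum>c\<in>C. wt c)"
    by (simp add: sum_distrib_left)
  finally have 1: "wn (\<lambda>t. F (rectpath a b t)) = \<epsilon>0 * of_int (\<Sum>c\<in>C. wt c)" .
  have bK: "cbox a b - box a b \<subseteq> K"
    using \<rho>(2) by (force simp: K_def less_imp_le)
  have "wn (\<lambda>t. F (rectpath a (a + 1 + \<i>) t)) = 0"
  proof (rule wn_rectpath_periodic)
    show "continuous_on (cbox a (a + 1 + \<i>) - box a (a + 1 + \<i>)) F"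
      using continuous_on_subset[OF contF bK] by (simp add: b_def)
    show "F z \<noteq> 0" if "z \<in> cbox a (a + 1 + \<i>) - box a (a + 1 + \<i>)" for z
      using that bK F0 by (auto simp: b_def)
    show "F (z + 1) = F z" "F (z + \<i>) = F z" for z
      using per(1)[of z] per(1)[of "z + h"] per(2)[of z] per(2)[of "z + h"]
      by (simp_all add: F_def add.assoc add.commute[of h])
  qed
  then have "\<epsilon>0 * of_int (\<Sum>c\<in>C. wt c) = 0"
    using 1 unfolding b_def by (simp only:)
  then have "(\<Sum>c\<in>C. wt c) = 0"
    using \<epsilon>0(1) by (simp only: mult_eq_0_iff of_int_eq_0_iff) auto
  then show ?thesis
    using bd by (intro exI[of _ a]) (auto simp: C_def wt_def b_def)
qed

section \<open>The Euler characteristic of the sphere\<close>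

lemma ab_rank_trivial:
  assumes "group G" "trivial_group G"
  shows "ab_rank G = 0"
proof -
  have c: "carrier G = {\<one>\<^bsub>G\<^esub>}" using assms(2) by (simp add: trivial_group_def)
  interpret group G by fact
  interpret comm_group G
    by (rule group_comm_groupI) (use c in auto)
  have "B = {}" if "int_independent G B" for B
  proof (rule ccontr)
    assume "B \<noteq> {}"
    then have "B = {\<one>\<^bsub>G\<^esub>}"
      using that c by (auto simp: int_independent_def)
    moreover have "finprod G (\<lambda>b. b [^]\<^bsub>G\<^esub> ((\<lambda>_. 1) b :: int)) {\<one>\<^bsub>G\<^esub>} = \<one>\<^bsub>G\<^esub>"
      using finprod_one_eqI[of "{\<one>\<^bsub>G\<^esub>}"] by simp
    ultimately have fp: "finprod G (\<lambda>b. b [^]\<^bsub>G\<^esub> ((\<lambda>_. 1) b :: int)) B = \<one>\<^bsub>G\<^esub>"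
      by simp
    have "finprod G (\<lambda>b. b [^]\<^bsub>G\<^esub> c b) B = \<one>\<^bsub>G\<^esub> \<Longrightarrow> \<forall>b\<in>B. c b = 0" for c :: "'a \<Rightarrow> int"
      using that by (simp add: int_independent_def)
    from this[OF fp] have "\<forall>b\<in>B. (1::int) = 0" by simp
    then show False using \<open>B \<noteq> {}\<close> by auto
  qed
  moreover have "int_independent G {}"
    by (simp add: int_independent_def)
  ultimately have "{B. int_independent G B} = {{}}"
    by blast
  then show ?thesis by (simp add: ab_rank_def setcompr_eq_image)
qed

lemma ab_rank_integer_group:
  fixes G (structure)
  assumes "group G" "G \<cong> integer_group"
  shows "ab_rank G = 1"
proof -
  interpret group G by fact
  have "cyclic_group G"
    using isomorphic_group_cyclicity[OF assms(2,1) group_integer_group] by simp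
  then interpret comm_group G by (rule cyclic_imp_abelian_group)
  obtain x where x: "x \<in> carrier G" "carrier G = range (\<lambda>n::int. x [^] n)"
    using \<open>cyclic_group G\<close> cyclic_group by auto
  have inf: "infinite (carrier G)"
    using iso_finite[OF assms(2)] by (simp add: infinite_UNIV_int)
  \<comment> \<open>If x had finite order, its powers with exponents below \<bar>n\<bar> would
    exhaust the infinite group.\<close>
  have x1: "n = 0" if "x [^] n = \<one>" for n :: int
  proof (rule ccontr)
    assume "n \<noteq> 0"
    have "carrier G \<subseteq> (\<lambda>m. x [^] m) ` {0..<\<bar>n\<bar>}"
    proof
      fix y assume "y \<in> carrier G"
      then obtain m :: int where m: "y = x [^] m" using x by auto
      have n1: "x [^] \<bar>n\<bar> = \<one>" using that x(1) by (cases "n \<ge> 0") (auto simp: int_pow_neg)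
      have "x [^] m = x [^] (\<bar>n\<bar> * (m div \<bar>n\<bar>) + m mod \<bar>n\<bar>)" by simp
      also have "\<dots> = x [^] (\<bar>n\<bar> * (m div \<bar>n\<bar>)) \<otimes> x [^] (m mod \<bar>n\<bar>)"
        using int_pow_mult[OF x(1)] by blast
      also have "x [^] (\<bar>n\<bar> * (m div \<bar>n\<bar>)) = (x [^] \<bar>n\<bar>) [^] (m div \<bar>n\<bar>)"
        using int_pow_pow[OF x(1)] by metis
      also have "\<dots> \<otimes> x [^] (m mod \<bar>n\<bar>) = x [^] (m mod \<bar>n\<bar>)"
        unfolding n1 using x(1) by simp
      finally have m': "y = x [^] (m mod \<bar>n\<bar>)" using m by simp
      then show "y \<in> (\<lambda>m. x [^] m) ` {0..<\<bar>n\<bar>}"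
        using m' \<open>n \<noteq> 0\<close> by auto
    qed
    then show False using inf finite_surj by blast
  qed
  have "card B \<le> 1" if B: "int_independent G B" for B
  proof (rule ccontr)
    assume "\<not> card B \<le> 1"
    then obtain b1 b2 where b: "b1 \<in> B" "b2 \<in> B" "b1 \<noteq> b2"
      using B card_le_Suc0_iff_eq[of B] by (auto simp: int_independent_def)
    then obtain n1 n2 :: int where n: "b1 = x [^] n1" "b2 = x [^] n2"
      using B x(2) unfolding int_independent_def by (metis (no_types, lifting) imageE subsetD)
    \<comment> \<open>Two powers of one generator satisfy the relation n1 n2 - n2 n1 = 0 between
      exponents, so at most one element can be independent.\<close>
    define c where "c b = (if b = b1 then n2 else if b = b2 then - n1 else 0)" for b
    have bc: "B \<subseteq> carrier G" "finite B" using B by (auto simp: int_independent_def)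
    have "finprod G (\<lambda>b. b [^] c b) B = finprod G (\<lambda>b. b [^] c b) {b1, b2}"
      by (rule finprod_mono_neutral_cong_right) (use bc b in \<open>auto simp: c_def\<close>)
    also have "\<dots> = b1 [^] n2 \<otimes> b2 [^] (- n1)"
      using bc b by (subst finprod_insert) (auto simp: c_def)
    also have "\<dots> = x [^] (n1 * n2 + n2 * (- n1))"
      using x(1) by (simp add: n int_pow_pow int_pow_mult del: mult_minus_right)
    also have "\<dots> = \<one>" by (simp add: mult.commute)
    finally have "\<forall>b\<in>B. c b = 0" using B unfolding int_independent_def by blast
    then have "n1 = n2" using b by (auto simp: c_def split: if_splits)
    then show False using b n by simp
  qed
  moreover have "int_independent G {x}"
    unfolding int_independent_def using x(1) x1 by auto
  ultimately have "Sup {card B |B. int_independent G B} = 1"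
    by (intro cSup_eq_maximum) (auto intro!: exI[of _ "{x}"])
  then show ?thesis by (simp add: ab_rank_def)
qed

text \<open>\<open>nsphere\<close> consists of functions on the natural numbers. The type
  \<open>complex \<times> real\<close> is a three-dimensional Euclidean space, in which facts about
  Euclidean spheres apply.\<close>

lemma nsphere2_homeo:
  obtains f :: "(nat \<Rightarrow> real) \<Rightarrow> complex \<times> real" and g
  where "homeomorphic_maps (nsphere 2) (top_of_set (sphere 0 1)) f g"
proof (rule homeomorphic_maps_nsphere_euclidean_sphere[OF independent_Basis orthogonal_Basis refl])
  show "DIM(complex \<times> real) \<noteq> 0" by simp
  show "norm u = 1" if "u \<in> Basis" for u :: "complex \<times> real" using that by simp
  fix f :: "(nat \<Rightarrow> real) \<Rightarrow> complex \<times> real" and g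
  assume "homeomorphic_maps (nsphere (DIM(complex \<times> real) - 1)) (top_of_set (sphere 0 1 \<inter> span Basis)) f g"
  then show ?thesis by (intro that[of f g]) (simp add: numeral_2_eq_2)
qed

lemma euler_char_nsphere2: "euler_char (nsphere 2) = 2"
proof -
  obtain f :: "(nat \<Rightarrow> real) \<Rightarrow> complex \<times> real" and g
    where fg: "homeomorphic_maps (nsphere 2) (top_of_set (sphere 0 1)) f g"
    by (rule nsphere2_homeo)
  have "path_connectedin euclidean (sphere (0::complex \<times> real) 1)"
    using path_connected_sphere[of "0::complex \<times> real" 1] by simp
  then have "path_connected_space (top_of_set (sphere (0::complex \<times> real) 1))"
    unfolding path_connectedin_def by blast
  then have pc: "path_connected_space (nsphere 2)"
    using homeomorphic_path_connected_space[of "nsphere 2" "top_of_set (sphere (0::complex \<times> real) 1)"] fg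
    by (auto simp: homeomorphic_space_def)
  have ne: "topspace (nsphere 2) \<noteq> {}" using in_topspace_nsphere by blast
  \<comment> \<open>Degree 0 is separate because reduced and unreduced homology differ there; path
    connectedness gives the integers.\<close>
  have b0: "betti 0 (nsphere 2) = 1"
    using ab_rank_integer_group[OF _ isomorphic_integer_zeroth_homology_group[OF pc ne]]
    by (simp add: betti_def)
  have bk: "betti k (nsphere 2) = (if k = 2 then 1 else 0)" if "k \<noteq> 0" for k
  proof -
    have eq: "homology_group (int k) (nsphere 2) = reduced_homology_group (int k) (nsphere 2)"
      using un_reduced_homology_group[of "int k" "nsphere 2"] that by simp
    show ?thesis
    proof (cases "k = 2")
      case True
      then show ?thesis
        using reduced_homology_group_nsphere(1)[of 2] ab_rank_integer_group[of "reduced_homology_group (int k) (nsphere 2)"]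
        unfolding betti_def eq by simp
    next
      case False
      then show ?thesis
        using reduced_homology_group_nsphere(2)[of "int k" 2] ab_rank_trivial[of "reduced_homology_group (int k) (nsphere 2)"]
        unfolding betti_def eq by simp
    qed
  qed
  have "{k. betti k (nsphere 2) \<noteq> 0} = {0, 2}"
    using b0 bk by (auto split: if_splits)
  then show ?thesis
    using b0 bk by (simp add: euler_char_def)
qed

section \<open>Branched coverings as counting data\<close>

text \<open>Every point near \<open>f x\<close>, other than \<open>f x\<close> itself, has exactly \<open>d\<close> preimages near \<open>x\<close>. This is insensitive
  to the choice of charts.\<close>

definition local_mult :: "'a::topological_space set \<Rightarrow> ('a \<Rightarrow> 'b::topological_space) \<Rightarrow> 'b set \<Rightarrow> 'a \<Rightarrow> nat \<Rightarrow> bool" where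
  "local_mult X f Y x d \<longleftrightarrow> d \<ge> 1 \<and> (\<forall>U. openin (top_of_set X) U \<and> x \<in> U \<longrightarrow>
     (\<exists>W N. openin (top_of_set X) W \<and> x \<in> W \<and> W \<subseteq> U \<and> openin (top_of_set Y) N \<and> f x \<in> N \<and>
        {u\<in>W. f u = f x} = {x} \<and> (\<forall>v\<in>N - {f x}. card {u\<in>W. f u = v} = d)))"

lemma local_mult_ge1: "local_mult X f Y x d \<Longrightarrow> d \<ge> 1"
  by (simp add: local_mult_def)

text \<open>Beyond unfolding, this delivers that the image of W covers N: since d is positive, no
  point of N has an empty fibre in W. Openness of f and the covering of nearby fibres rest on
  this.\<close>

lemma local_multE:
  assumes "local_mult X f Y x d" "openin (top_of_set X) U" "x \<in> U"
  obtains W N where "openin (top_of_set X) W" "x \<in> W" "W \<subseteq> U" "openin (top_of_set Y) N" "f x \<in> N"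
    "{u\<in>W. f u = f x} = {x}" "\<forall>v\<in>N - {f x}. card {u\<in>W. f u = v} = d" "N \<subseteq> f ` W"
proof -
  have d: "d \<ge> 1" using assms(1) by (simp add: local_mult_def)
  from assms(1) have "\<forall>U. openin (top_of_set X) U \<and> x \<in> U \<longrightarrow>
     (\<exists>W N. openin (top_of_set X) W \<and> x \<in> W \<and> W \<subseteq> U \<and> openin (top_of_set Y) N \<and> f x \<in> N \<and>
        {u\<in>W. f u = f x} = {x} \<and> (\<forall>v\<in>N - {f x}. card {u\<in>W. f u = v} = d))"
    unfolding local_mult_def by (rule conjunct2)
  from this[rule_format, OF conjI[OF assms(2,3)]]
  obtain W N where WN: "openin (top_of_set X) W" "x \<in> W" "W \<subseteq> U" "openin (top_of_set Y) N" "f x \<in> N"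
    "{u\<in>W. f u = f x} = {x}" "\<forall>v\<in>N - {f x}. card {u\<in>W. f u = v} = d"
    by (elim exE conjE) (rule that)
  have "N \<subseteq> f ` W"
  proof
    fix v assume v: "v \<in> N"
    show "v \<in> f ` W"
    proof (cases "v = f x")
      case False
      then have "card {u\<in>W. f u = v} \<noteq> 0" using WN(7) v d by auto
      then have "{u\<in>W. f u = v} \<noteq> {}" by fastforce
      then show ?thesis by auto
    qed (use WN in auto)
  qed
  with WN show ?thesis by (rule that)
qed

text \<open>Choose the window for e inside the window for d and compare the counts at a common value
  v other than f x; this gives e \<le> d, and symmetry gives equality. Such a v exists because the
  target has no isolated points, where the counting condition would be vacuous.\<close>

lemma local_mult_unique:
  fixes f :: "'a::topological_space \<Rightarrow> 'b::topological_space"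
  assumes l: "local_mult X f Y x d" "local_mult X f Y x e" and x: "x \<in> X"
    and perf: "\<forall>U. openin (top_of_set Y) U \<and> U \<noteq> {} \<longrightarrow> infinite U"
  shows "d = e"
proof -
  have le: "e \<le> d" if l: "local_mult X f Y x d" "local_mult X f Y x e" for d e
  proof -
    obtain W N where W: "openin (top_of_set X) W" "x \<in> W" "openin (top_of_set Y) N" "f x \<in> N"
      "\<forall>v\<in>N - {f x}. card {u\<in>W. f u = v} = d"
      by (rule local_multE[OF l(1) openin_subtopology_self x]) (rule that)
    obtain W' N' where W': "openin (top_of_set X) W'" "W' \<subseteq> W" "openin (top_of_set Y) N'" "f x \<in> N'"
      "\<forall>v\<in>N' - {f x}. card {u\<in>W'. f u = v} = e"
      by (rule local_multE[OF l(2) W(1,2)]) (rule that)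
    have "infinite (N \<inter> N')"
      using perf[rule_format, of "N \<inter> N'"] W W' by auto
    then have "infinite (N \<inter> N' - {f x})" by simp
    then obtain v where v: "v \<in> N \<inter> N' - {f x}"
      by (metis ex_in_conv finite.emptyI)
    have "finite {u\<in>W. f u = v}"
      using W(5) v local_mult_ge1[OF l(1)] by (intro card_ge_0_finite) auto
    then have "card {u\<in>W'. f u = v} \<le> card {u\<in>W. f u = v}"
      using W'(2) by (intro card_mono) auto
    then show ?thesis using W(5) W'(5) v by auto
  qed
  show ?thesis using le[OF l] le[OF l(2,1)] by simp
qed

text \<open>Over v lie e points of M, all different from f x because v differs from g (f x), and M
  lies in N, so each of them has d preimages in W.\<close>

lemma local_mult_compose:
  assumes f: "local_mult X f Y x d" and g: "local_mult Y g Z (f x) e"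
    and cont: "continuous_on X f" and im: "f ` X \<subseteq> Y"
  shows "local_mult X (\<lambda>x. g (f x)) Z x (e * d)"
  unfolding local_mult_def
proof (intro conjI allI impI)
  have d1: "d \<ge> 1" and e1: "e \<ge> 1" using f g by (auto simp: local_mult_def)
  then have "1 * 1 \<le> e * d" by (intro mult_le_mono) auto
  then show "1 \<le> e * d" by simp
  fix U assume U: "openin (top_of_set X) U \<and> x \<in> U"
  obtain W N where W: "openin (top_of_set X) W" "x \<in> W" "W \<subseteq> U" "openin (top_of_set Y) N" "f x \<in> N"
    "{u\<in>W. f u = f x} = {x}" "\<forall>v\<in>N - {f x}. card {u\<in>W. f u = v} = d"
    by (rule local_multE[OF f conjunct1[OF U] conjunct2[OF U]]) (rule that)
  obtain M L where M: "openin (top_of_set Y) M" "f x \<in> M" "M \<subseteq> N" "openin (top_of_set Z) L" "g (f x) \<in> L"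
    "{u\<in>M. g u = g (f x)} = {f x}" "\<forall>v\<in>L - {g (f x)}. card {u\<in>M. g u = v} = e"
    by (rule local_multE[OF g W(4,5)]) (rule that)
  have o: "openin (top_of_set X) (X \<inter> f -` M)"
    using continuous_openin_preimage[OF cont, of Y M] im M(1) by auto
  have WX: "W \<subseteq> X" using openin_imp_subset[OF W(1)] .
  have "{u\<in>W \<inter> f -` M. g (f u) = g (f x)} = {x}"
  proof -
    have "u = x" if "u \<in> W" "f u \<in> M" "g (f u) = g (f x)" for u
    proof -
      have "f u = f x" using that M(6) by auto
      then show ?thesis using W(6) that by auto
    qed
    then show ?thesis using W(2) M(2) by auto
  qed
  moreover have "card {u\<in>W \<inter> f -` M. g (f u) = v} = e * d" if v: "v \<in> L - {g (f x)}" for v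
  proof -
    let ?A = "{m\<in>M. g m = v}"
    have cA: "card ?A = e" using M(7) v by blast
    then have fA: "finite ?A" using e1 by (intro card_ge_0_finite) simp
    have Ad: "card {u\<in>W. f u = m} = d" if "m \<in> ?A" for m
      using that W(7) M(3) v by auto
    then have Af: "finite {u\<in>W. f u = m}" if "m \<in> ?A" for m
      using d1 that by (intro card_ge_0_finite) simp
    have "{u\<in>W \<inter> f -` M. g (f u) = v} = (\<Union>m\<in>?A. {u\<in>W. f u = m})" by auto
    moreover have "card (\<Union>m\<in>?A. {u\<in>W. f u = m}) = (\<Sum>m\<in>?A. card {u\<in>W. f u = m})"
      using fA Af by (intro card_UN_disjoint) auto
    ultimately show ?thesis using Ad cA by simp
  qed
  moreover have "openin (top_of_set X) (W \<inter> f -` M)"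
  proof -
    have "W \<inter> f -` M = W \<inter> (X \<inter> f -` M)" using WX by auto
    then show ?thesis using openin_Int[OF W(1) o] by simp
  qed
  ultimately show "\<exists>W N. openin (top_of_set X) W \<and> x \<in> W \<and> W \<subseteq> U \<and> openin (top_of_set Z) N \<and> g (f x) \<in> N \<and>
        {u\<in>W. g (f u) = g (f x)} = {x} \<and> (\<forall>v\<in>N - {g (f x)}. card {u\<in>W. g (f u) = v} = e * d)"
    using W M by (intro exI[of _ "W \<inter> f -` M"] exI[of _ L]) auto
qed

section \<open>Degree and critical set from fibre counts\<close>

text \<open>What remains of a branched covering with compact source once the charts are forgotten.
  In \<open>cluster\<close>, the number of points over a nearby v is the total multiplicity over y,
  and all of them are simple: the first half makes the degree constant, the second isolates branch
  values.\<close>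

locale branched =
  fixes X :: "'a::metric_space set" and Y :: "'b::metric_space set" and f :: "'a \<Rightarrow> 'b" and m :: "'a \<Rightarrow> nat"
  assumes compX: "compact X" and connY: "connected Y" and neY: "Y \<noteq> {}"
    and cont: "continuous_on X f" and im: "f ` X \<subseteq> Y"
    and perf: "\<forall>U. openin (top_of_set Y) U \<and> U \<noteq> {} \<longrightarrow> infinite U"
    and mult: "\<And>x. x \<in> X \<Longrightarrow> local_mult X f Y x (m x)"
    and cluster: "\<And>y. y \<in> Y \<Longrightarrow> finite {x\<in>X. f x = y} \<and> {x\<in>X. f x = y} \<noteq> {} \<and>
       (\<exists>V. openin (top_of_set Y) V \<and> y \<in> V \<and>
         (\<forall>v\<in>V - {y}. card {x\<in>X. f x = v} = (\<Sum>x | x \<in> X \<and> f x = y. m x) \<and> (\<forall>x\<in>X. f x = v \<longrightarrow> m x = 1)))"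
begin

abbreviation "F y \<equiv> {x\<in>X. f x = y}"

definition crit where "crit = {x\<in>X. m x \<noteq> 1}"

lemma finite_fibre: "y \<in> Y \<Longrightarrow> finite (F y)"
  using cluster by blast

lemma fibre_nonempty: "y \<in> Y \<Longrightarrow> F y \<noteq> {}"
  using cluster by blast

lemma im_eq: "f ` X = Y"
proof
  show "Y \<subseteq> f ` X"
  proof
    fix y assume "y \<in> Y"
    then show "y \<in> f ` X" using fibre_nonempty[of y] by blast
  qed
qed (rule im)

lemma m_ge1: "x \<in> X \<Longrightarrow> m x \<ge> 1"
  using local_mult_ge1[OF mult] by blast

lemma compY: "compact Y"
  using compact_continuous_image[OF cont compX] im_eq by simp

lemma clusterE:
  assumes "y \<in> Y"
  obtains V where "openin (top_of_set Y) V" "y \<in> V"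
    "\<forall>v\<in>V - {y}. card (F v) = sum m (F y)" "\<forall>v\<in>V - {y}. \<forall>x\<in>F v. m x = 1"
proof -
  from cluster[OF assms] obtain V where "openin (top_of_set Y) V" "y \<in> V"
         "\<forall>v\<in>V - {y}. card (F v) = sum m (F y) \<and> (\<forall>x\<in>X. f x = v \<longrightarrow> m x = 1)"
    by blast
  then show ?thesis using that by simp
qed

text \<open>Close to y every other fibre is simple, so its total multiplicity is its cardinality,
  which \<open>cluster\<close> equates with the total over y. The total is thus locally constant on
  the connected set Y.\<close>

lemma degree_ex: "\<exists>n. \<forall>y\<in>Y. sum m (F y) = n"
proof -
  have "sum m (F x) = sum m (F y)" if xy: "x \<in> Y" "y \<in> Y" for x y
  proof (rule connected_equivalence_relation[OF connY xy])
    show "\<exists>T. openin (top_of_set Y) T \<and> y \<in> T \<and> (\<forall>v\<in>T. sum m (F y) = sum m (F v))" if y: "y \<in> Y" for y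
    proof -
      obtain V where V: "openin (top_of_set Y) V" "y \<in> V"
        "\<forall>v\<in>V - {y}. card (F v) = sum m (F y)" "\<forall>v\<in>V - {y}. \<forall>x\<in>F v. m x = 1"
        by (rule clusterE[OF y])
      have "sum m (F y) = sum m (F v)" if "v \<in> V" for v
      proof (cases "v = y")
        case False
        then have "sum m (F v) = sum (\<lambda>_. 1) (F v)" using V(4) that by (intro sum.cong) auto
        then show ?thesis using V(3) that False by simp
      qed simp
      then show ?thesis using V by blast
    qed
  qed auto
  then show ?thesis using neY by blast
qed

definition deg where "deg = (THE n. \<forall>y\<in>Y. sum m (F y) = n)"

lemma deg: "y \<in> Y \<Longrightarrow> sum m (F y) = deg"
proof -
  obtain n where n: "\<forall>y\<in>Y. sum m (F y) = n" using degree_ex by blast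
  have "deg = n" unfolding deg_def by (rule the_equality) (use n neY in auto)
  then show "y \<in> Y \<Longrightarrow> sum m (F y) = deg" using n by simp
qed

lemma card_F_le: "y \<in> Y \<Longrightarrow> card (F y) \<le> deg"
proof -
  assume y: "y \<in> Y"
  have "card (F y) = sum (\<lambda>_. 1) (F y)" by simp
  also have "\<dots> \<le> sum m (F y)" using m_ge1 by (intro sum_mono) auto
  finally show ?thesis using deg[OF y] by simp
qed

lemma card_F_unram: "y \<in> Y \<Longrightarrow> (\<And>x. x \<in> F y \<Longrightarrow> m x = 1) \<Longrightarrow> card (F y) = deg"
  using deg[of y] sum.cong[of "F y" "F y" m "\<lambda>_. 1"] by simp

lemma deg_pos: "deg \<ge> 1"
proof -
  obtain y where y: "y \<in> Y" using neY by blast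
  have "card (F y) \<noteq> 0" using fibre_nonempty[OF y] finite_fibre[OF y] by simp
  then show ?thesis using card_F_le[OF y] by simp
qed

text \<open>Every y has a neighbourhood over which critical points can lie only above y itself.
  Finitely many such neighbourhoods cover the compact target, and the fibres over their centres are
  finite.\<close>

lemma finite_crit: "finite crit"
proof -
  have "\<exists>V. open V \<and> y \<in> V \<and> (\<forall>v\<in>V \<inter> Y - {y}. \<forall>x\<in>F v. m x = 1)" if y: "y \<in> Y" for y
  proof -
    obtain V where V: "openin (top_of_set Y) V" "y \<in> V"
        "\<forall>v\<in>V - {y}. card (F v) = sum m (F y)" "\<forall>v\<in>V - {y}. \<forall>x\<in>F v. m x = 1"
        by (rule clusterE[OF y])
    then show ?thesis unfolding openin_open by blast
  qed
  then have "\<forall>y\<in>Y. \<exists>V. open V \<and> y \<in> V \<and> (\<forall>v\<in>V \<inter> Y - {y}. \<forall>x\<in>F v. m x = 1)" by blast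
  from bchoice[OF this] obtain V where V: "\<And>y. y \<in> Y \<Longrightarrow> open (V y) \<and> y \<in> V y \<and> (\<forall>v\<in>V y \<inter> Y - {y}. \<forall>x\<in>F v. m x = 1)"
    by blast
  obtain C where C: "C \<subseteq> Y" "finite C" "Y \<subseteq> (\<Union>c\<in>C. V c)"
    by (rule compactE_image[OF compY, of Y V]) (use V in auto)
  have "crit \<subseteq> (\<Union>c\<in>C. F c)"
  proof
    fix x assume x: "x \<in> crit"
    then have "f x \<in> Y" "x \<in> X" using im by (auto simp: crit_def)
    then obtain c where c: "c \<in> C" "f x \<in> V c" using C by blast
    have "f x = c"
    proof (rule ccontr)
      assume "f x \<noteq> c"
      then have "m x = 1" using V[of c] c C \<open>f x \<in> Y\<close> \<open>x \<in> X\<close> by auto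
      then show False using x by (simp add: crit_def)
    qed
    then show "x \<in> (\<Union>c\<in>C. F c)" using c \<open>x \<in> X\<close> by auto
  qed
  moreover have "finite (\<Union>c\<in>C. F c)"
    using C finite_fibre by (intro finite_UN_I) auto
  ultimately show ?thesis by (rule finite_subset)
qed

lemma finite_crit_values: "finite (f ` crit)"
  using finite_crit by simp

lemma open_image:
  assumes "openin (top_of_set X) B"
  shows "openin (top_of_set Y) (f ` B)"
proof (subst openin_subopen, intro ballI)
  fix y assume "y \<in> f ` B"
  then obtain x where x: "x \<in> B" "y = f x" by blast
  then have "x \<in> X" using openin_imp_subset[OF assms] by blast
  obtain W N where WN: "openin (top_of_set X) W" "x \<in> W" "W \<subseteq> B" "openin (top_of_set Y) N" "f x \<in> N" "N \<subseteq> f ` W"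
    by (rule local_multE[OF mult[OF \<open>x \<in> X\<close>] assms x(1)]) (rule that)
  have "N \<subseteq> f ` B" using WN(3,6) by (meson image_mono order_trans)
  then show "\<exists>T. openin (top_of_set Y) T \<and> y \<in> T \<and> T \<subseteq> f ` B"
    using x WN(4,5) by (intro exI[of _ N] conjI) auto
qed

text \<open>The part of X outside W is compact, so its image is closed, and it misses y.\<close>

lemma fibre_nbhd:
  assumes y: "y \<in> Y" and W: "openin (top_of_set X) W" "F y \<subseteq> W"
  obtains N where "openin (top_of_set Y) N" "y \<in> N" "\<forall>v\<in>N. F v \<subseteq> W"
proof -
  have "closedin (top_of_set X) (X - W)" using W(1) by (auto simp: openin_closedin_eq)
  then have "compact (X - W)"
    using compX closedin_compact by blast
  then have "compact (f ` (X - W))"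
    by (intro compact_continuous_image continuous_on_subset[OF cont]) auto
  then have "closed (f ` (X - W))" by (rule compact_imp_closed)
  then have "openin (top_of_set Y) (Y - f ` (X - W))"
    unfolding Diff_eq by (intro openin_open_Int) (rule open_Compl)
  then show ?thesis
    by (rule that) (use y W in auto)
qed

end

lemma sum_fibres:
  fixes h :: "'a \<Rightarrow> 'c::comm_monoid_add"
  assumes "finite A" "g ` A \<subseteq> B" "finite B"
  shows "(\<Sum>b\<in>B. \<Sum>a | a \<in> A \<and> g a = b. h a) = sum h A"
  using sum.group[OF assms(1,3,2), of h] by simp

lemma finite_separated:
  fixes Z :: "'a::metric_space set"
  assumes "finite Z"
  shows "\<exists>\<delta>>0. \<forall>x\<in>Z. \<forall>y\<in>Z. x \<noteq> y \<longrightarrow> \<delta> \<le> dist x y"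
proof -
  define D where "D = (\<lambda>(x, y). dist x y) ` {(x, y). x \<in> Z \<and> y \<in> Z \<and> x \<noteq> y}"
  have "finite {(x, y). x \<in> Z \<and> y \<in> Z \<and> x \<noteq> y}"
    by (rule finite_subset[of _ "Z \<times> Z"]) (use assms in auto)
  \<comment> \<open>Inserting 1 keeps \<open>Min\<close> meaningful when Z has fewer than two
    points.\<close>
  then have "finite (insert 1 D)" by (simp add: D_def)
  moreover have "\<forall>d\<in>insert 1 D. d > 0" by (auto simp: D_def)
  ultimately have "Min (insert 1 D) > 0" "\<forall>d\<in>D. Min (insert 1 D) \<le> d" by auto
  then show ?thesis by (intro exI[of _ "Min (insert 1 D)"]) (auto simp: D_def)
qed

lemma (in branched) local_inj:
  assumes x: "x \<in> X" "m x = 1" and U: "openin (top_of_set X) U" "x \<in> U"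
  shows "\<exists>B. openin (top_of_set X) B \<and> x \<in> B \<and> B \<subseteq> U \<and> inj_on f B"
proof -
  obtain W N where W: "openin (top_of_set X) W" "x \<in> W" "W \<subseteq> U" "openin (top_of_set Y) N" "f x \<in> N"
     "{u\<in>W. f u = f x} = {x}" "\<forall>v\<in>N - {f x}. card {u\<in>W. f u = v} = m x"
    by (rule local_multE[OF mult[OF x(1)] U]) (rule that)
  have oN: "openin (top_of_set X) (X \<inter> f -` N)"
    using continuous_openin_preimage[OF cont, of Y N] W(4) im by auto
  have "inj_on f (W \<inter> (X \<inter> f -` N))"
  proof (rule inj_onI)
    fix u u' assume u: "u \<in> W \<inter> (X \<inter> f -` N)" "u' \<in> W \<inter> (X \<inter> f -` N)" "f u = f u'"
    show "u = u'"
    proof (cases "f u = f x")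
      case True
      then have "u \<in> {u\<in>W. f u = f x}" "u' \<in> {u\<in>W. f u = f x}" using u by auto
      then show ?thesis using W(6) by auto
    next
      case False
      then have "card {x\<in>W. f x = f u} = 1" using W(7) x u by auto
      moreover have "u \<in> {x\<in>W. f x = f u}" "u' \<in> {x\<in>W. f x = f u}" using u by auto
      ultimately show ?thesis by (metis card_1_singletonE singletonD)
    qed
  qed
  then show ?thesis
    using openin_Int[OF W(1) oN] W(2,3,5) x(1) by (intro exI[of _ "W \<inter> (X \<inter> f -` N)"]) auto
qed

section \<open>From disc charts to fibre counts\<close>

lemma chart_homeo:
  assumes "is_chart (top_of_set X) (U, \<phi>)"
  obtains \<phi>' where "openin (top_of_set X) U" "open (\<phi> ` U)" "homeomorphism U (\<phi> ` U) \<phi> \<phi>'"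
proof -
  have oU: "openin (top_of_set X) U" and o: "open (\<phi> ` U)"
    and h: "homeomorphic_map (subtopology (top_of_set X) U) (top_of_set (\<phi> ` U)) \<phi>"
    using assms by (auto simp: is_chart_def)
  have "subtopology (top_of_set X) U = top_of_set U"
    using openin_imp_subset[OF oU] by (simp add: subtopology_subtopology Int_absorb1)
  then obtain \<phi>' where m: "homeomorphic_maps (top_of_set U) (top_of_set (\<phi> ` U)) \<phi> \<phi>'"
    using h homeomorphic_map_maps by metis
  have "homeomorphism U (\<phi> ` U) \<phi> \<phi>'"
    using m by (auto simp: homeomorphic_maps_def homeomorphism_def image_iff continuous_map_in_subtopology)
  then show ?thesis using that oU o by blast
qed

lemma disk_chart_homeo:
  assumes "disk_chart R U \<phi>" "surf_top R = top_of_set X"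
  obtains \<phi>' where "openin (top_of_set X) U" "homeomorphism U (ball 0 1) \<phi> \<phi>'"
proof -
  have "is_chart (top_of_set X) (U, \<phi>)" and i: "\<phi> ` U = ball 0 1"
    using assms by (auto simp: disk_chart_def)
  then obtain \<phi>' where "openin (top_of_set X) U" "homeomorphism U (\<phi> ` U) \<phi> \<phi>'"
    by (elim chart_homeo) (rule that)
  then show ?thesis using that[of \<phi>'] i by simp
qed

lemma openin_Int_subset:
  assumes "openin (top_of_set X) T" "U \<subseteq> X"
  shows "openin (top_of_set U) (U \<inter> T)"
proof -
  obtain T' where T': "open T'" "T = X \<inter> T'" using assms(1) by (auto simp: openin_open)
  then have "U \<inter> T = U \<inter> T'" using assms(2) by blast
  then show ?thesis using openin_open_Int[OF T'(1)] by simp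
qed

text \<open>A chart carries a piece of the open set to a nonempty open subset of the plane, which is
  infinite. This supplies the test values needed for uniqueness of multiplicities.\<close>

lemma surface_perfect:
  fixes R :: "'a::metric_space surface"
  assumes os: "oriented_surface R" and t: "surf_top R = top_of_set X"
  shows "\<forall>U. openin (top_of_set X) U \<and> U \<noteq> {} \<longrightarrow> infinite U"
proof (intro allI impI, elim conjE)
  fix O' assume O: "openin (top_of_set X) O'" "O' \<noteq> {}"
  then obtain y where y: "y \<in> O'" by blast
  then have "y \<in> topspace (surf_top R)" using openin_imp_subset[OF O(1)] t by auto
  then obtain U \<phi> where c: "(U, \<phi>) \<in> surf_atlas R" "y \<in> U"
    using os unfolding oriented_surface_def by blast
  then have "is_chart (top_of_set X) (U, \<phi>)" using os t unfolding oriented_surface_def by auto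
  then obtain \<phi>' where h: "openin (top_of_set X) U" "open (\<phi> ` U)" "homeomorphism U (\<phi> ` U) \<phi> \<phi>'"
    by (rule chart_homeo)
  have "openin (top_of_set U) (U \<inter> O')"
    by (rule openin_Int_subset[OF O(1) openin_imp_subset[OF h(1)]])
  then have "openin (top_of_set (\<phi> ` U)) (\<phi> ` (U \<inter> O'))"
    by (rule homeomorphism_imp_open_map[OF h(3)])
  then have "open (\<phi> ` (U \<inter> O'))" using openin_open_trans[OF _ h(2)] by blast
  moreover have "\<phi> ` (U \<inter> O') \<noteq> {}" using c y by blast
  ultimately have "infinite (\<phi> ` (U \<inter> O'))"
    using finite_imp_not_open by blast
  then show "infinite O'" by (meson finite_Int finite_imageI)
qed

lemma power_formE:
  fixes R :: "'a::topological_space surface" and C :: "'b::topological_space surface"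
  assumes "power_form R C f x U V d" "surf_top R = top_of_set X" "surf_top C = top_of_set Y"
  obtains \<phi> :: "'a \<Rightarrow> complex" and \<phi>' and \<psi> :: "'b \<Rightarrow> complex" and \<psi>' where "d \<ge> 1" "x \<in> U" "f ` U \<subseteq> V" "\<phi> x = 0" "\<psi> (f x) = 0" "\<forall>u \<in> U. \<psi> (f u) = \<phi> u ^ d"
    "openin (top_of_set X) U" "homeomorphism U (ball 0 1) \<phi> \<phi>'" "openin (top_of_set Y) V" "homeomorphism V (ball 0 1) \<psi> \<psi>'"
proof -
  obtain \<phi> \<psi> where pf: "d \<ge> 1" "x \<in> U" "f ` U \<subseteq> V" "disk_chart R U \<phi>" "disk_chart C V \<psi>" "\<phi> x = 0" "\<psi> (f x) = 0"
      "\<forall>u \<in> U. \<psi> (f u) = \<phi> u ^ d"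
    using assms(1) unfolding power_form_def by (elim exE conjE) (rule that)
  obtain \<phi>' where h1: "openin (top_of_set X) U" "homeomorphism U (ball 0 1) \<phi> \<phi>'"
    by (rule disk_chart_homeo[OF pf(4) assms(2)])
  obtain \<psi>' where h2: "openin (top_of_set Y) V" "homeomorphism V (ball 0 1) \<psi> \<psi>'"
    by (rule disk_chart_homeo[OF pf(5) assms(3)])
  from pf(1-3,6-8) h1 h2 show ?thesis by (rule that)
qed

text \<open>In the charts, the points over v are the d-th roots of a nonzero number, of which there
  are d, and the only root of 0 is 0.\<close>

lemma power_form_count:
  fixes R :: "'a::metric_space surface" and C :: "'b::metric_space surface"
  assumes pf: "power_form R C f x U V d" and tR: "surf_top R = top_of_set X" and tC: "surf_top C = top_of_set Y"
  shows "local_mult X f Y x d" "openin (top_of_set X) U" "openin (top_of_set Y) V"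
    "\<And>v. v \<in> V \<Longrightarrow> v \<noteq> f x \<Longrightarrow> card {u\<in>U. f u = v} = d"
    "\<And>u. u \<in> U \<Longrightarrow> f u = f x \<Longrightarrow> u = x"
proof -
  obtain \<phi> :: "'a \<Rightarrow> complex" and \<phi>' and \<psi> :: "'b \<Rightarrow> complex" and \<psi>' where pf': "d \<ge> 1" "x \<in> U" "f ` U \<subseteq> V" "\<phi> x = 0" "\<psi> (f x) = 0" "\<forall>u \<in> U. \<psi> (f u) = \<phi> u ^ d"
    and h1: "openin (top_of_set X) U" "homeomorphism U (ball 0 1) \<phi> \<phi>'"
    and h2: "openin (top_of_set Y) V" "homeomorphism V (ball 0 1) \<psi> \<psi>'"
    by (rule power_formE[OF pf tR tC])
  have inj1: "inj_on \<phi> U" using h1(2) by (metis homeomorphism_apply1 inj_onI)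
  have inj2: "inj_on \<psi> V" using h2(2) by (metis homeomorphism_apply1 inj_onI)
  have iff: "f u = v \<longleftrightarrow> \<phi> u ^ d = \<psi> v" if "u \<in> U" "v \<in> V" for u v
    using pf'(3,6) that inj_onD[OF inj2, of "f u" v] by auto
  \<comment> \<open>The radii s and s^d match: if the value has modulus below s^d, then all its d-th
    roots have modulus below s, so the smaller window still contains every root.\<close>
  have cnt: "card {u\<in>U. \<phi> u \<in> ball 0 s \<and> f u = v} = d"
    if s: "0 < s" "s \<le> 1" and v: "v \<in> V" "v \<noteq> f x" "\<psi> v \<in> ball 0 (s ^ d)" for v s
  proof -
    have nz: "\<psi> v \<noteq> 0"
      using inj_onD[OF inj2, of v "f x"] v pf' by auto
    have "bij_betw \<phi> {u\<in>U. \<phi> u \<in> ball 0 s \<and> f u = v} {w. w ^ d = \<psi> v}"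
      unfolding bij_betw_def
    proof
      show "inj_on \<phi> {u\<in>U. \<phi> u \<in> ball 0 s \<and> f u = v}"
        by (rule inj_on_subset[OF inj1]) auto
      show "\<phi> ` {u\<in>U. \<phi> u \<in> ball 0 s \<and> f u = v} = {w. w ^ d = \<psi> v}"
      proof
        show "\<phi> ` {u\<in>U. \<phi> u \<in> ball 0 s \<and> f u = v} \<subseteq> {w. w ^ d = \<psi> v}"
          using iff v(1) by auto
        show "{w. w ^ d = \<psi> v} \<subseteq> \<phi> ` {u\<in>U. \<phi> u \<in> ball 0 s \<and> f u = v}"
        proof
          fix w assume "w \<in> {w. w ^ d = \<psi> v}"
          then have w: "w ^ d = \<psi> v" by simp
          then have "cmod w ^ d < s ^ d" using v(3) by (simp flip: norm_power)
          then have ws: "cmod w < s" using power_less_imp_less_base s(1) less_imp_le by metis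
          then have "w \<in> ball 0 1" using s by simp
          then have "\<phi>' w \<in> U" "\<phi> (\<phi>' w) = w"
            using h1(2) by (auto simp: homeomorphism_def)
          moreover from this have "f (\<phi>' w) = v" using iff[of "\<phi>' w" v] v(1) w by simp
          ultimately show "w \<in> \<phi> ` {u\<in>U. \<phi> u \<in> ball 0 s \<and> f u = v}"
            using ws by (intro image_eqI[of _ _ "\<phi>' w"]) auto
        qed
      qed
    qed
    then have "card {u\<in>U. \<phi> u \<in> ball 0 s \<and> f u = v} = card {w. w ^ d = \<psi> v}"
      by (rule bij_betw_same_card)
    also have "\<dots> = d" using nz pf'(1) by (intro card_nth_roots) auto
    finally show ?thesis .
  qed
  show only: "u = x" if "u \<in> U" "f u = f x" for u
  proof -
    have "\<phi> u ^ d = 0" using iff[of u "f x"] that pf' by auto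
    then have "\<phi> u = \<phi> x" using pf' by simp
    then show ?thesis using inj_onD[OF inj1] that pf' by blast
  qed
  show "openin (top_of_set X) U" "openin (top_of_set Y) V" by fact+
  show "card {u\<in>U. f u = v} = d" if "v \<in> V" "v \<noteq> f x" for v
  proof -
    have "\<psi> v \<in> ball 0 1" "\<forall>u\<in>U. \<phi> u \<in> ball 0 1"
      using h1(2) h2(2) that by (auto simp: homeomorphism_def)
    then show ?thesis using cnt[of 1 v] that by (simp cong: conj_cong)
  qed
  show "local_mult X f Y x d"
    unfolding local_mult_def
  proof (intro conjI allI impI)
    fix O' assume "openin (top_of_set X) O' \<and> x \<in> O'"
    then have O: "openin (top_of_set X) O'" "x \<in> O'" by auto
    have "openin (top_of_set U) (U \<inter> O')"
      by (rule openin_Int_subset[OF O(1) openin_imp_subset[OF h1(1)]])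
    then have "openin (top_of_set (ball 0 1)) (\<phi> ` (U \<inter> O'))"
      by (rule homeomorphism_imp_open_map[OF h1(2)])
    then have "open (\<phi> ` (U \<inter> O'))" using openin_open_trans by blast
    moreover have "0 \<in> \<phi> ` (U \<inter> O')" using pf' O by force
    ultimately obtain s0 where s0: "s0 > 0" "ball 0 s0 \<subseteq> \<phi> ` (U \<inter> O')"
      by (meson open_contains_ball)
    define s where "s = min s0 1"
    have s: "0 < s" "s \<le> 1" "ball 0 s \<subseteq> \<phi> ` (U \<inter> O')" using s0 by (auto simp: s_def)
    define W where "W = U \<inter> \<phi> -` ball 0 s"
    define N where "N = V \<inter> \<psi> -` ball 0 (s ^ d)"
    have "continuous_on U \<phi>" "continuous_on V \<psi>"
      using h1(2) h2(2) by (auto simp: homeomorphism_def)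
    then have "openin (top_of_set U) W" "openin (top_of_set V) N"
      unfolding W_def N_def by (auto intro!: continuous_openin_preimage_gen)
    then have oo: "openin (top_of_set X) W" "openin (top_of_set Y) N"
      using openin_trans h1(1) h2(1) by blast+
    have WO: "W \<subseteq> O'"
    proof
      fix u assume u: "u \<in> W"
      then have "\<phi> u \<in> \<phi> ` (U \<inter> O')" using s(3) by (auto simp: W_def)
      then obtain u' where "u' \<in> U \<inter> O'" "\<phi> u = \<phi> u'" by blast
      then show "u \<in> O'" using inj_onD[OF inj1, of u u'] u by (auto simp: W_def)
    qed
    have WN: "card {u \<in> W. f u = v} = d" if "v \<in> N - {f x}" for v
    proof -
      have "{u \<in> W. f u = v} = {u\<in>U. \<phi> u \<in> ball 0 s \<and> f u = v}" by (auto simp: W_def)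
      then show ?thesis using cnt[of s v] s that by (auto simp: N_def)
    qed
    have "x \<in> W" using pf'(2,4) s by (auto simp: W_def)
    moreover have "f x \<in> N" using pf'(2,3,5) s by (auto simp: N_def)
    ultimately have xW: "x \<in> W" "f x \<in> N" by auto
    have one: "{u \<in> W. f u = f x} = {x}" using only xW by (auto simp: W_def)
    show "\<exists>W N. openin (top_of_set X) W \<and> x \<in> W \<and> W \<subseteq> O' \<and> openin (top_of_set Y) N \<and> f x \<in> N \<and>
        {u\<in>W. f u = f x} = {x} \<and> (\<forall>v\<in>N - {f x}. card {u\<in>W. f u = v} = d)"
      using oo WO WN xW one by (intro exI[of _ W] exI[of _ N] conjI ballI)
  qed (use pf' in auto)
qed

lemma branched_covering_power_form:
  assumes bc: "branched_covering R C f" and x: "x \<in> topspace (surf_top R)"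
  obtains U V d where "power_form R C f x U V d"
proof -
  have "f x \<in> topspace (surf_top C)"
    using bc x by (auto simp: branched_covering_def continuous_map_def)
  with bc obtain V \<U> where V: "f x \<in> V" "\<Union>\<U> = {x \<in> topspace (surf_top R). f x \<in> V}"
       "\<forall>U \<in> \<U>. \<exists>x' d. U \<inter> fibre R f (f x) = {x'} \<and> power_form R C f x' U V d"
    unfolding branched_covering_def by meson
  then obtain U where U: "U \<in> \<U>" "x \<in> U" using x by blast
  then obtain x' d where d: "U \<inter> fibre R f (f x) = {x'}" "power_form R C f x' U V d"
    using V(3) by blast
  have "x \<in> U \<inter> fibre R f (f x)" using U x by (simp add: fibre_def)
  then have "x = x'" using d(1) by blast
  then show ?thesis using d(2) that by blast
qed

text \<open>The definite description in \<open>local_degree\<close> is meaningful because any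
  exponent d is recovered by counting preimages, whatever charts are used.\<close>

lemma local_degree_local_mult:
  fixes R :: "'a::metric_space surface" and C :: "'b::metric_space surface"
  assumes bc: "branched_covering R C f" and tR: "surf_top R = top_of_set X" and tC: "surf_top C = top_of_set Y"
    and x: "x \<in> X"
  shows "\<exists>U V. power_form R C f x U V (local_degree R C f x)"
proof -
  have "oriented_surface C" using bc by (simp add: branched_covering_def)
  note perf = surface_perfect[OF this tC]
  obtain U V d where pf: "power_form R C f x U V d"
    using branched_covering_power_form[OF bc, of x] tR x by auto
  have "local_degree R C f x = d"
    unfolding local_degree_def
  proof (rule the_equality)
    fix e assume "\<exists>U V. power_form R C f x U V e"
    then obtain U' V' where pf': "power_form R C f x U' V' e" by blast
    show "e = d"
      by (rule local_mult_unique[OF power_form_count(1)[OF pf' tR tC] power_form_count(1)[OF pf tR tC] x perf])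
  qed (use pf in blast)
  then show ?thesis using pf by blast
qed

text \<open>The sheets over V correspond to the points over y, one centre each. The fibre over y is
  compact and covered by open sheets containing one of its points each, hence finite. Adding up the
  counts of the sheets over v gives the total multiplicity over y.\<close>

lemma branched_covering_branched:
  fixes R :: "'a::metric_space surface" and C :: "'b::metric_space surface"
  assumes bc: "branched_covering R C f" and tR: "surf_top R = top_of_set X" and tC: "surf_top C = top_of_set Y"
    and compX: "compact X"
  shows "branched X Y f (local_degree R C f)"
proof
  let ?m = "local_degree R C f"
  have osC: "oriented_surface C" and cm: "continuous_map (surf_top R) (surf_top C) f"
    using bc by (auto simp: branched_covering_def)
  show "compact X" by fact
  show "connected Y" using osC tC connectedin_def[of euclidean Y] by (simp add: oriented_surface_def)
  show "Y \<noteq> {}" using osC tC by (simp add: oriented_surface_def)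
  show cont: "continuous_on X f" and im: "f ` X \<subseteq> Y" using cm tR tC by (auto simp: continuous_map_in_subtopology)
  show perf: "\<forall>U. openin (top_of_set Y) U \<and> U \<noteq> {} \<longrightarrow> infinite U" by (rule surface_perfect[OF osC tC])
  show mult: "local_mult X f Y x (?m x)" if "x \<in> X" for x
    using local_degree_local_mult[OF bc tR tC that] power_form_count(1)[OF _ tR tC] by blast
  fix y assume y: "y \<in> Y"
  have yt: "y \<in> topspace (surf_top C)" using y tC by simp
  have "\<forall>y \<in> topspace (surf_top C). \<exists>V \<U>.
        openin (surf_top C) V \<and> y \<in> V \<and>
        \<U> \<noteq> {} \<and> disjoint \<U> \<and> (\<forall>U \<in> \<U>. openin (surf_top R) U) \<and>
        \<Union>\<U> = {x \<in> topspace (surf_top R). f x \<in> V} \<and>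
        (\<forall>U \<in> \<U>. \<exists>x d. U \<inter> fibre R f y = {x} \<and> power_form R C f x U V d)"
    using bc unfolding branched_covering_def by (elim conjE)
  from bspec[OF this yt]
  obtain V \<U> where V: "openin (surf_top C) V" "y \<in> V" "\<U> \<noteq> {}" "disjoint \<U>" "\<forall>U \<in> \<U>. openin (surf_top R) U"
       "\<Union>\<U> = {x \<in> topspace (surf_top R). f x \<in> V}"
       "\<forall>U \<in> \<U>. \<exists>x d. U \<inter> fibre R f y = {x} \<and> power_form R C f x U V d"
    by (elim exE conjE) (rule that)
  have V': "openin (top_of_set Y) V" "\<Union>\<U> = {x\<in>X. f x \<in> V}" using V tR tC by auto
  have UX: "U \<subseteq> X" "f ` U \<subseteq> V" if "U \<in> \<U>" for U using that V'(2) by auto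
  have "\<forall>U\<in>\<U>. \<exists>x. U \<inter> fibre R f y = {x} \<and> power_form R C f x U V (?m x)"
  proof
    fix U assume U: "U \<in> \<U>"
    then obtain x d where xd: "U \<inter> fibre R f y = {x}" "power_form R C f x U V d" using V(7) by blast
    then have xX: "x \<in> X" using UX[OF U] by auto
    have "d = ?m x"
      by (rule local_mult_unique[OF power_form_count(1)[OF xd(2) tR tC] mult[OF xX] xX perf])
    then show "\<exists>x. U \<inter> fibre R f y = {x} \<and> power_form R C f x U V (?m x)" using xd by blast
  qed
  from bchoice[OF this] obtain c where c: "\<forall>U\<in>\<U>. U \<inter> fibre R f y = {c U} \<and> power_form R C f (c U) U V (?m (c U))"
    by (elim exE) (rule that)
  let ?F = "\<lambda>y. {x\<in>X. f x = y}"
  have fib: "fibre R f y = ?F y" by (simp add: fibre_def tR)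
  have cF: "c U \<in> U" "c U \<in> X" "f (c U) = y" if "U \<in> \<U>" for U
    using bspec[OF c that] fib by auto
  have bij: "bij_betw c \<U> (?F y)"
    unfolding bij_betw_def
  proof
    show "inj_on c \<U>"
    proof (rule inj_onI)
      fix U U' assume U: "U \<in> \<U>" "U' \<in> \<U>" "c U = c U'"
      then have "c U \<in> U \<inter> U'" using cF by force
      then show "U = U'" using V(4) U by (auto simp: disjoint_def)
    qed
    show "c ` \<U> = ?F y"
    proof
      show "?F y \<subseteq> c ` \<U>"
      proof
        fix x assume x: "x \<in> ?F y"
        then obtain U where U: "U \<in> \<U>" "x \<in> U" using V'(2) V(2) by blast
        then have "x = c U" using bspec[OF c U(1)] x fib by blast
        then show "x \<in> c ` \<U>" using U by blast
      qed
    qed (use cF in auto)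
  qed
  have "finite (?F y)"
  proof -
    have "closedin (top_of_set X) (?F y)"
      using continuous_closedin_preimage_constant[OF cont, of y] by simp
    then have comp: "compact (?F y)" using compX closedin_compact by blast
    have "\<forall>U\<in>\<U>. \<exists>O'. open O' \<and> U = X \<inter> O'" using V(5) tR by (auto simp: openin_open)
    from bchoice[OF this] obtain Op where Op: "\<forall>U\<in>\<U>. open (Op U) \<and> U = X \<inter> Op U" by (elim exE) (rule that)
    have cov: "?F y \<subseteq> (\<Union>U\<in>\<U>. Op U)"
    proof
      fix x assume x: "x \<in> ?F y"
      then obtain U where U: "U \<in> \<U>" "x \<in> U" using V'(2) V(2) by blast
      then show "x \<in> (\<Union>U\<in>\<U>. Op U)" using Op by blast
    qed
    have op: "open (Op U)" if "U \<in> \<U>" for U using Op that by blast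
    obtain D where D: "D \<subseteq> \<U>" "finite D" "?F y \<subseteq> (\<Union>U\<in>D. Op U)"
      by (rule compactE_image[OF comp op cov])
    have "?F y \<subseteq> c ` D"
    proof
      fix x assume x: "x \<in> ?F y"
      then obtain U where U: "U \<in> D" "x \<in> Op U" using D(3) by blast
      then have "x \<in> U" using Op D(1) x by blast
      then have "x = c U" using bspec[OF c, of U] D(1) U x fib by blast
      then show "x \<in> c ` D" using U by blast
    qed
    then show ?thesis using D(2) by (rule finite_surj[rotated])
  qed
  moreover have "?F y \<noteq> {}" using bij V(3) by (auto simp: bij_betw_def)
  moreover have "\<exists>V. openin (top_of_set Y) V \<and> y \<in> V \<and>
         (\<forall>v\<in>V - {y}. card (?F v) = (\<Sum>x | x \<in> X \<and> f x = y. ?m x) \<and> (\<forall>x\<in>X. f x = v \<longrightarrow> ?m x = 1))"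
  proof (intro exI[of _ V] conjI V'(1) V(2), rule ballI, rule conjI)
    have finU: "finite \<U>" using bij \<open>finite (?F y)\<close> bij_betw_finite by blast
    have cU: "card {u\<in>U. f u = v} = ?m (c U)" if "U \<in> \<U>" "v \<in> V - {y}" for U v
      using power_form_count(4)[OF conjunct2[OF bspec[OF c that(1)]] tR tC, of v] that cF by auto
    have mpos: "?m x \<ge> 1" if "x \<in> X" for x using local_mult_ge1[OF mult[OF that]] .
    have finv: "finite {u\<in>U. f u = v}" if "U \<in> \<U>" "v \<in> V - {y}" for U v
      using cU[OF that] mpos[OF cF(2)[OF that(1)]] by (intro card_ge_0_finite) simp
    fix v assume v: "v \<in> V - {y}"
    have "?F v = (\<Union>U\<in>\<U>. {u\<in>U. f u = v})" using V'(2) v by blast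
    then have "card (?F v) = card (\<Union>U\<in>\<U>. {u\<in>U. f u = v})" by simp
    also have "\<dots> = (\<Sum>U\<in>\<U>. card {u\<in>U. f u = v})"
    proof (rule card_UN_disjoint[OF finU])
      show "\<forall>U\<in>\<U>. \<forall>U'\<in>\<U>. U \<noteq> U' \<longrightarrow> {u\<in>U. f u = v} \<inter> {u\<in>U'. f u = v} = {}"
        using V(4) unfolding disjoint_def by blast
    qed (use finv v in blast)
    also have "\<dots> = (\<Sum>U\<in>\<U>. ?m (c U))" using cU v by (intro sum.cong) auto
    also have "\<dots> = (\<Sum>x | x \<in> X \<and> f x = y. ?m x)"
      using sum.reindex_bij_betw[OF bij, of ?m] by simp
    finally show "card (?F v) = (\<Sum>x | x \<in> X \<and> f x = y. ?m x)" .
    text \<open>Each of the \<open>d\<close> points over \<open>v\<close> in \<open>U\<close> has at least one point nearby over each \<open>v'\<close> near \<open>v\<close>;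
      as \<open>U\<close> contains only \<open>d\<close> points over \<open>v'\<close>, each has exactly one.\<close>
    show "\<forall>x\<in>X. f x = v \<longrightarrow> ?m x = 1"
    proof (intro ballI impI)
      fix x0 assume x0: "x0 \<in> X" "f x0 = v"
      then obtain U where U: "U \<in> \<U>" "x0 \<in> U" using V'(2) v by blast
      let ?A = "{u\<in>U. f u = v}"
      have finA: "finite ?A" by (rule finv[OF U(1) v])
      obtain \<delta> where \<delta>: "\<delta> > 0" "\<And>x y. x \<in> ?A \<Longrightarrow> y \<in> ?A \<Longrightarrow> x \<noteq> y \<Longrightarrow> \<delta> \<le> dist x y"
        using finite_separated[OF finA] by blast
      have "\<forall>u\<in>?A. \<exists>WN. openin (top_of_set X) (fst WN) \<and> fst WN \<subseteq> U \<inter> ball u (\<delta>/2) \<and> openin (top_of_set Y) (snd WN) \<and> v \<in> snd WN \<and>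
          (\<forall>v'\<in>snd WN - {v}. card {w\<in>fst WN. f w = v'} = ?m u)"
      proof
        fix u assume u: "u \<in> ?A"
        then have uX: "u \<in> X" using UX[OF U(1)] by blast
        have o: "openin (top_of_set X) (U \<inter> ball u (\<delta>/2))"
          using V(5) U(1) tR by (metis open_ball openin_Int_open)
        have "u \<in> U \<inter> ball u (\<delta>/2)" using u \<delta>(1) by auto
        then obtain W N where "openin (top_of_set X) W" "W \<subseteq> U \<inter> ball u (\<delta>/2)" "openin (top_of_set Y) N" "f u \<in> N"
           "\<forall>v'\<in>N - {f u}. card {w\<in>W. f w = v'} = ?m u"
          by (rule local_multE[OF mult[OF uX] o]) (rule that)
        then show "\<exists>WN. openin (top_of_set X) (fst WN) \<and> fst WN \<subseteq> U \<inter> ball u (\<delta>/2) \<and> openin (top_of_set Y) (snd WN) \<and> v \<in> snd WN \<and>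
          (\<forall>v'\<in>snd WN - {v}. card {w\<in>fst WN. f w = v'} = ?m u)"
          using u by (intro exI[of _ "(W, N)"]) auto
      qed
      from bchoice[OF this] obtain WN where WN: "\<forall>u\<in>?A. openin (top_of_set X) (fst (WN u)) \<and> fst (WN u) \<subseteq> U \<inter> ball u (\<delta>/2) \<and>
           openin (top_of_set Y) (snd (WN u)) \<and> v \<in> snd (WN u) \<and> (\<forall>v'\<in>snd (WN u) - {v}. card {w\<in>fst (WN u). f w = v'} = ?m u)"
        by (elim exE) (rule that)
      define N where "N = V \<inter> (\<Inter>u\<in>?A. snd (WN u))"
      have "x0 \<in> ?A" using x0 U by blast
      then have "openin (top_of_set Y) (\<Inter>u\<in>?A. snd (WN u))"
        using finA WN by (intro openin_Inter) auto
      then have "openin (top_of_set Y) N" unfolding N_def by (rule openin_Int[OF V'(1)])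
      moreover have "v \<in> N" using WN v by (auto simp: N_def)
      ultimately have "infinite N" using perf by blast
      \<comment> \<open>The value v is excluded because the small windows are counted off v, and y
        because the sheet U is counted off y.\<close>
      then have "infinite (N - {v, y})" by simp
      then obtain v' where v': "v' \<in> N - {v, y}" by (metis ex_in_conv finite.emptyI)
      have dis: "{w\<in>fst (WN u). f w = v'} \<inter> {w\<in>fst (WN u'). f w = v'} = {}" if "u \<in> ?A" "u' \<in> ?A" "u \<noteq> u'" for u u'
      proof (rule ccontr)
        assume "\<not> ?thesis"
        then obtain w where "w \<in> fst (WN u)" "w \<in> fst (WN u')" by blast
        then have "w \<in> ball u (\<delta>/2)" "w \<in> ball u' (\<delta>/2)" using WN that by blast+
        then have "dist u w < \<delta>/2" "dist u' w < \<delta>/2" by auto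
        then show False using \<delta>(2)[OF that] dist_triangle[of u u' w] by (simp add: dist_commute)
      qed
      have cw: "card {w\<in>fst (WN u). f w = v'} = ?m u" if "u \<in> ?A" for u
        using WN that v' by (auto simp: N_def)
      have v'V: "v' \<in> V - {y}" using v' by (auto simp: N_def)
      have sub: "(\<Union>u\<in>?A. {w\<in>fst (WN u). f w = v'}) \<subseteq> {w\<in>U. f w = v'}"
        using WN by blast
      have "(\<Sum>u\<in>?A. ?m u) = (\<Sum>u\<in>?A. card {w\<in>fst (WN u). f w = v'})" using cw by (intro sum.cong) auto
      also have "\<dots> = card (\<Union>u\<in>?A. {w\<in>fst (WN u). f w = v'})"
      proof (rule card_UN_disjoint[OF finA, symmetric])
        show "\<forall>u\<in>?A. finite {w\<in>fst (WN u). f w = v'}"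
        proof
          fix u assume "u \<in> ?A"
          then have "{w\<in>fst (WN u). f w = v'} \<subseteq> {w\<in>U. f w = v'}" using sub by blast
          then show "finite {w\<in>fst (WN u). f w = v'}" using finv[OF U(1) v'V] by (rule finite_subset)
        qed
        show "\<forall>u\<in>?A. \<forall>u'\<in>?A. u \<noteq> u' \<longrightarrow> {w\<in>fst (WN u). f w = v'} \<inter> {w\<in>fst (WN u'). f w = v'} = {}"
          using dis by blast
      qed
      also have "\<dots> \<le> card {w\<in>U. f w = v'}" by (rule card_mono[OF finv[OF U(1) v'V] sub])
      also have "\<dots> = card ?A" using cU[OF U(1) v'V] cU[OF U(1) v] by simp
      finally have le: "(\<Sum>u\<in>?A. ?m u) \<le> (\<Sum>u\<in>?A. 1)" by simp
      show "?m x0 = 1"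
      proof (rule ccontr)
        assume "?m x0 \<noteq> 1"
        then have "?m x0 > 1" using mpos[OF x0(1)] by simp
        moreover have "\<forall>u\<in>?A. 1 \<le> ?m u" using mpos UX[OF U(1)] by blast
        ultimately have "(\<Sum>u\<in>?A. 1) < (\<Sum>u\<in>?A. ?m u)"
          using \<open>x0 \<in> ?A\<close> finA by (intro sum_strict_mono_ex1) auto
        then show False using le by simp
      qed
    qed
  qed
  ultimately show "finite (?F y) \<and> ?F y \<noteq> {} \<and> (\<exists>V. openin (top_of_set Y) V \<and> y \<in> V \<and>
         (\<forall>v\<in>V - {y}. card (?F v) = (\<Sum>x | x \<in> X \<and> f x = y. ?m x) \<and> (\<forall>x\<in>X. f x = v \<longrightarrow> ?m x = 1)))"
    by blast
qed

lemma global_degree_deg: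
  fixes R :: "'a::metric_space surface" and C :: "'b::metric_space surface"
  assumes b: "branched X Y f (local_degree R C f)"
    and tR: "surf_top R = top_of_set X" and tC: "surf_top C = top_of_set Y"
  shows "global_degree R C f = branched.deg X Y f (local_degree R C f)"
proof -
  interpret branched X Y f "local_degree R C f" by fact
  have fib: "fibre R f y = F y" for y by (simp add: fibre_def tR)
  show ?thesis
    unfolding global_degree_def
  proof (rule the_equality)
    show "\<forall>y\<in>topspace (surf_top C). finite (fibre R f y) \<and> sum (local_degree R C f) (fibre R f y) = deg"
      using finite_fibre deg by (simp add: tC fib)
    fix n assume n: "\<forall>y\<in>topspace (surf_top C). finite (fibre R f y) \<and> sum (local_degree R C f) (fibre R f y) = n"
    obtain y where "y \<in> Y" using neY by blast
    then show "n = deg" using n deg by (auto simp: tC fib)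
  qed
qed

section \<open>Semiconjugate branched coverings\<close>

text \<open>The geometry of the two surfaces is isolated in two assumptions:
  \<open>unramified\<close>, which comes from the torus, and \<open>conn_cofinite\<close>, which
  comes from the sphere. The rest of the argument is counting in fibres.\<close>

locale semiconjugacy =
  p: branched X Y p mp + f: branched Y Y f mf + q: branched X X q mq
  for X :: "'a::metric_space set" and Y :: "'b::metric_space set" and p mp f mf q mq +
  assumes comm: "x \<in> X \<Longrightarrow> f (p x) = p (q x)"
    and conn_cofinite: "finite A \<Longrightarrow> connected (Y - A)"
    and unramified: "x \<in> X \<Longrightarrow> mq x = 1"
    and deg_f: "f.deg \<ge> 2"
begin

lemma pX: "x \<in> X \<Longrightarrow> p x \<in> Y"
  using p.im by blast

lemma qX: "x \<in> X \<Longrightarrow> q x \<in> X"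
  using q.im by blast

lemma fY: "y \<in> Y \<Longrightarrow> f y \<in> Y"
  using f.im by blast

lemma qkX: "x \<in> X \<Longrightarrow> (q ^^ k) x \<in> X"
  by (induction k) (auto simp: qX)

lemma fkY: "y \<in> Y \<Longrightarrow> (f ^^ k) y \<in> Y"
  by (induction k) (auto simp: fY)

lemma comm_k: "x \<in> X \<Longrightarrow> (f ^^ k) (p x) = p ((q ^^ k) x)"
  by (induction k) (auto simp: comm qkX)

lemma cont_qk: "continuous_on X (q ^^ k)"
proof (induction k)
  case (Suc k)
  have "continuous_on X (q \<circ> (q ^^ k))"
    using qkX by (intro continuous_on_compose Suc continuous_on_subset[OF q.cont]) auto
  then show ?case by simp
qed simp

lemma cont_fk: "continuous_on Y (f ^^ k)"
proof (induction k)
  case (Suc k)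
  have "continuous_on Y (f \<circ> (f ^^ k))"
    using fkY by (intro continuous_on_compose Suc continuous_on_subset[OF f.cont]) auto
  then show ?case by simp
qed simp

text \<open>Both sides are the multiplicity at x of one and the same map, read as f after p and as p
  after q; the factor of q is 1.\<close>

lemma mult_step: assumes x: "x \<in> X" shows "mp (q x) = mf (p x) * mp x"
proof -
  have 1: "local_mult X (\<lambda>x. f (p x)) Y x (mf (p x) * mp x)"
    using local_mult_compose[OF p.mult[OF x] f.mult[OF pX[OF x]] p.cont p.im] .
  have 2: "local_mult X (\<lambda>x. p (q x)) Y x (mp (q x) * mq x)"
    using local_mult_compose[OF q.mult[OF x] p.mult[OF qX[OF x]] q.cont q.im] .
  have "local_mult X (\<lambda>x. f (p x)) Y x (mp (q x) * mq x)"
  proof -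
    have e: "{u\<in>W. f (p u) = v} = {u\<in>W. p (q u) = v}" if "openin (top_of_set X) W" for W v
      using openin_imp_subset[OF that] comm by auto
    show ?thesis
      using 2 x unfolding local_mult_def by (simp add: e comm cong: conj_cong)
  qed
  then show ?thesis
    using local_mult_unique[OF 1 _ x p.perf] unramified[OF x] by simp
qed

text \<open>By the chain rule this is the local degree of f^k at z, written as a product so that
  iterates need no multiplicity function of their own.\<close>

definition orbit_mult where "orbit_mult k z = (\<Prod>i<k. mf ((f ^^ i) z))"

lemma orbit_mult_ge1: "z \<in> Y \<Longrightarrow> orbit_mult k z \<ge> 1"
  unfolding orbit_mult_def by (intro prod_ge_1 f.m_ge1 fkY)

lemma mult_k: "x \<in> X \<Longrightarrow> mp ((q ^^ k) x) = orbit_mult k (p x) * mp x"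
proof (induction k)
  case (Suc k)
  then show ?case
    using mult_step[OF qkX[OF Suc.prems], of k] comm_k[OF Suc.prems, of k]
    by (simp add: orbit_mult_def mult.commute mult.left_commute)
qed (simp add: orbit_mult_def)

text \<open>Count the points over w of f after p, with multiplicity, in two ways: grouped by their
  images under p, and grouped by their images under q. The positive factor deg p cancels.\<close>

lemma degrees_equal: "q.deg = f.deg"
proof -
  obtain w where w: "w \<in> Y" using p.neY by blast
  have "(\<Sum>x | x \<in> X \<and> f (p x) = w. mf (p x) * mp x) = (\<Sum>z\<in>f.F w. \<Sum>x | x \<in> {x\<in>X. f (p x) = w} \<and> p x = z. mf (p x) * mp x)"
  proof (rule sum_fibres[symmetric])
    have "{x\<in>X. f (p x) = w} \<subseteq> (\<Union>z\<in>f.F w. p.F z)" using pX by auto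
    then show "finite {x\<in>X. f (p x) = w}"
      by (rule finite_subset) (use f.finite_fibre[OF w] p.finite_fibre in auto)
  qed (use f.finite_fibre[OF w] pX in auto)
  also have "\<dots> = (\<Sum>z\<in>f.F w. mf z * p.deg)"
  proof (rule sum.cong)
    fix z assume z: "z \<in> f.F w"
    have "(\<Sum>x | x \<in> {x\<in>X. f (p x) = w} \<and> p x = z. mf (p x) * mp x) = (\<Sum>x\<in>p.F z. mf z * mp x)"
      using z by (intro sum.cong) auto
    also have "\<dots> = mf z * p.deg" using p.deg[of z] z by (simp flip: sum_distrib_left)
    finally show "(\<Sum>x | x \<in> {x\<in>X. f (p x) = w} \<and> p x = z. mf (p x) * mp x) = mf z * p.deg" .
  qed simp
  also have "\<dots> = f.deg * p.deg" using f.deg[OF w] by (simp flip: sum_distrib_right)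
  finally have 1: "(\<Sum>x | x \<in> X \<and> f (p x) = w. mf (p x) * mp x) = f.deg * p.deg" .
  have "(\<Sum>x | x \<in> X \<and> f (p x) = w. mf (p x) * mp x) = (\<Sum>x | x \<in> X \<and> p (q x) = w. mp (q x))"
    using comm mult_step by (intro sum.cong) auto
  also have "\<dots> = (\<Sum>y\<in>p.F w. \<Sum>x | x \<in> {x\<in>X. p (q x) = w} \<and> q x = y. mp (q x))"
  proof (rule sum_fibres[symmetric])
    have "{x\<in>X. p (q x) = w} \<subseteq> (\<Union>z\<in>p.F w. q.F z)" using qX by auto
    then show "finite {x\<in>X. p (q x) = w}"
      by (rule finite_subset) (use p.finite_fibre[OF w] q.finite_fibre in auto)
  qed (use p.finite_fibre[OF w] qX in auto)
  also have "\<dots> = (\<Sum>y\<in>p.F w. q.deg * mp y)"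
  proof (rule sum.cong)
    fix y assume y: "y \<in> p.F w"
    have "(\<Sum>x | x \<in> {x\<in>X. p (q x) = w} \<and> q x = y. mp (q x)) = (\<Sum>x\<in>q.F y. mp y)"
      using y by (intro sum.cong) auto
    also have "\<dots> = q.deg * mp y" using q.card_F_unram[of y] unramified y by simp
    finally show "(\<Sum>x | x \<in> {x\<in>X. p (q x) = w} \<and> q x = y. mp (q x)) = q.deg * mp y" .
  qed simp
  also have "\<dots> = q.deg * p.deg" using p.deg[OF w] by (simp flip: sum_distrib_left)
  finally show ?thesis using 1 p.deg_pos by simp
qed

lemma card_qk_fibre: "y \<in> X \<Longrightarrow> finite {x\<in>X. (q ^^ k) x = y} \<and> card {x\<in>X. (q ^^ k) x = y} = f.deg ^ k"
proof (induction k arbitrary: y)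
  case 0
  then have "{x\<in>X. (q ^^ 0) x = y} = {y}" by auto
  then show ?case by simp
next
  case (Suc k)
  have eq: "{x\<in>X. (q ^^ Suc k) x = y} = (\<Union>z\<in>q.F y. {x\<in>X. (q ^^ k) x = z})"
    using qkX by auto
  have fin: "finite (q.F y)" using q.finite_fibre Suc.prems by blast
  have "card (\<Union>z\<in>q.F y. {x\<in>X. (q ^^ k) x = z}) = (\<Sum>z\<in>q.F y. card {x\<in>X. (q ^^ k) x = z})"
    using fin Suc.IH by (intro card_UN_disjoint) auto
  also have "\<dots> = (\<Sum>z\<in>q.F y. f.deg ^ k)" using Suc.IH by (intro sum.cong) auto
  also have "\<dots> = f.deg ^ Suc k"
    using q.card_F_unram[OF Suc.prems] unramified degrees_equal by simp
  finally show ?case using eq fin Suc.IH by auto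
qed

lemma finite_fk_fibre: "y \<in> Y \<Longrightarrow> finite {z\<in>Y. (f ^^ k) z = y}"
proof (induction k arbitrary: y)
  case 0
  have "{z\<in>Y. (f ^^ 0) z = y} \<subseteq> {y}" by auto
  then show ?case by (rule finite_subset) simp
next
  case (Suc k)
  have eq: "{x\<in>Y. (f ^^ Suc k) x = y} = (\<Union>z\<in>f.F y. {x\<in>Y. (f ^^ k) x = z})"
    using fkY by auto
  show ?case unfolding eq using f.finite_fibre[OF Suc.prems] Suc.IH by auto
qed

section \<open>Stabilisation of the images of generic fibres\<close>

definition branch_values where "branch_values = p ` p.crit"

lemma finite_branch_values: "finite branch_values" and branch_values_subset: "branch_values \<subseteq> Y"
  using p.finite_crit_values pX by (auto simp: branch_values_def p.crit_def)

lemma unbranched_mult: "z \<notin> branch_values \<Longrightarrow> x \<in> p.F z \<Longrightarrow> mp x = 1"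
  by (auto simp: branch_values_def p.crit_def)

text \<open>The images under q^k of the points over z lie over f^k z. Since this is not a branch
  value, p is injective near each of them, which is what keeps the size of the image stable.\<close>

definition generic where "generic k = {z\<in>Y. z \<notin> branch_values \<and> (f ^^ k) z \<notin> branch_values}"

lemma finite_not_generic: "finite (Y - generic k)"
proof -
  have "Y - generic k \<subseteq> branch_values \<union> (\<Union>w\<in>branch_values. {z\<in>Y. (f ^^ k) z = w})" by (auto simp: generic_def)
  then show ?thesis
    by (rule finite_subset) (use finite_branch_values finite_fk_fibre branch_values_subset in auto)
qed

lemma generic_subset: "generic k \<subseteq> Y" by (auto simp: generic_def)

lemma connected_generic: "connected (generic k)"
proof -
  have "Y - (Y - generic k) = generic k" using generic_subset by blast
  then show ?thesis using conn_cofinite[OF finite_not_generic, of k] by simp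
qed

lemma cofinite_meets:
  assumes "openin (top_of_set Y) U" "U \<noteq> {}" "finite A"
  obtains z where "z \<in> U" "z \<notin> A"
proof -
  have "infinite U" using p.perf assms by blast
  then have "\<not> U \<subseteq> A" using finite_subset assms(3) by blast
  then show ?thesis using that by blast
qed

definition fibre_rank where "fibre_rank k z = card ((q ^^ k) ` p.F z)"

text \<open>Surround the points \<zeta> of the image set Z by disjoint sets B \<zeta> on which p is
  injective. For v near z the image of the fibre over v stays in these sets and meets each of them.
  It has at most one point in each, as p sends all its points to f^k v. Hence it is in bijection
  with Z.\<close>

lemma fibre_rank_locally_constant:
  assumes z: "z \<in> generic k"
  shows "\<exists>N. openin (top_of_set Y) N \<and> z \<in> N \<and> (\<forall>v\<in>N. fibre_rank k v = fibre_rank k z)"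
proof -
  let ?h = "q ^^ k"
  have zY: "z \<in> Y" "z \<notin> branch_values" "(f ^^ k) z \<notin> branch_values" using z by (auto simp: generic_def)
  define Z where "Z = ?h ` p.F z"
  have finZ: "finite Z" unfolding Z_def using p.finite_fibre[OF zY(1)] by simp
  have ZX: "\<zeta> \<in> X" "p \<zeta> = (f ^^ k) z" if "\<zeta> \<in> Z" for \<zeta>
    using that qkX comm_k by (auto simp: Z_def)
  obtain \<delta> where \<delta>: "\<delta> > 0" "\<And>x y. x \<in> Z \<Longrightarrow> y \<in> Z \<Longrightarrow> x \<noteq> y \<Longrightarrow> \<delta> \<le> dist x y"
    using finite_separated[OF finZ] by blast
  have "\<forall>\<zeta>\<in>Z. \<exists>B. openin (top_of_set X) B \<and> \<zeta> \<in> B \<and> B \<subseteq> X \<inter> ball \<zeta> (\<delta>/2) \<and> inj_on p B"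
  proof
    fix \<zeta> assume \<zeta>: "\<zeta> \<in> Z"
    have m1: "mp \<zeta> = 1" using unbranched_mult[OF zY(3), of \<zeta>] ZX[OF \<zeta>] by simp
    have "openin (top_of_set X) (X \<inter> ball \<zeta> (\<delta>/2))" by (rule openin_open_Int) simp
    moreover have "\<zeta> \<in> X \<inter> ball \<zeta> (\<delta>/2)" using \<delta>(1) ZX[OF \<zeta>] by simp
    ultimately show "\<exists>B. openin (top_of_set X) B \<and> \<zeta> \<in> B \<and> B \<subseteq> X \<inter> ball \<zeta> (\<delta>/2) \<and> inj_on p B"
      by (rule p.local_inj[OF ZX(1)[OF \<zeta>] m1])
  qed
  from bchoice[OF this] obtain B where B: "\<forall>\<zeta>\<in>Z. openin (top_of_set X) (B \<zeta>) \<and> \<zeta> \<in> B \<zeta> \<and> B \<zeta> \<subseteq> X \<inter> ball \<zeta> (\<delta>/2) \<and> inj_on p (B \<zeta>)"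
    by (elim exE) (rule that)
  have Bdisj: "\<zeta> = \<zeta>'" if "\<zeta> \<in> Z" "\<zeta>' \<in> Z" "u \<in> B \<zeta>" "u \<in> B \<zeta>'" for \<zeta> \<zeta>' u
  proof (rule ccontr)
    assume ne: "\<zeta> \<noteq> \<zeta>'"
    have "u \<in> ball \<zeta> (\<delta>/2)" "u \<in> ball \<zeta>' (\<delta>/2)" using B that by blast+
    then have "dist \<zeta> u < \<delta>/2" "dist \<zeta>' u < \<delta>/2" by auto
    then show False using dist_triangle[of \<zeta> \<zeta>' u] \<delta>(2)[OF that(1,2) ne] by (simp add: dist_commute)
  qed
  have "\<exists>W N. openin (top_of_set X) W \<and> x \<in> W \<and> ?h ` W \<subseteq> B (?h x) \<and> openin (top_of_set Y) N \<and> z \<in> N \<and> N \<subseteq> p ` W"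
    if x: "x \<in> p.F z" for x
  proof -
    have hx: "?h x \<in> Z" using x by (auto simp: Z_def)
    have o1: "openin (top_of_set X) (X \<inter> ?h -` B (?h x))"
      using continuous_openin_preimage[OF cont_qk[of k], of X "B (?h x)"] B hx qkX by auto
    have x1: "x \<in> X \<inter> ?h -` B (?h x)" using x B hx by auto
    have xX: "x \<in> X" using x by simp
    obtain W N where W: "openin (top_of_set X) W" "x \<in> W" "W \<subseteq> X \<inter> ?h -` B (?h x)"
       "openin (top_of_set Y) N" "p x \<in> N" "N \<subseteq> p ` W"
      by (rule local_multE[OF p.mult[OF xX] o1 x1]) (rule that)
    then show ?thesis using x by (intro exI[of _ W] exI[of _ N]) auto
  qed
  then have wn: "\<forall>x\<in>p.F z. \<exists>WN. openin (top_of_set X) (fst WN) \<and> x \<in> fst WN \<and> ?h ` fst WN \<subseteq> B (?h x) \<and> openin (top_of_set Y) (snd WN) \<and> z \<in> snd WN \<and> snd WN \<subseteq> p ` fst WN"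
    by simp
  from bchoice[OF wn] obtain WN where WN: "\<forall>x\<in>p.F z. openin (top_of_set X) (fst (WN x)) \<and> x \<in> fst (WN x) \<and> ?h ` fst (WN x) \<subseteq> B (?h x)
      \<and> openin (top_of_set Y) (snd (WN x)) \<and> z \<in> snd (WN x) \<and> snd (WN x) \<subseteq> p ` fst (WN x)"
    by (elim exE) (rule that)
  define W where "W x = fst (WN x)" for x
  define N where "N x = snd (WN x)" for x
  have W: "openin (top_of_set X) (W x)" "x \<in> W x" "?h ` W x \<subseteq> B (?h x)" 
    and N: "openin (top_of_set Y) (N x)" "z \<in> N x" "N x \<subseteq> p ` W x" if "x \<in> p.F z" for x
    using bspec[OF WN that] by (simp_all add: W_def N_def)
  have "openin (top_of_set X) (\<Union>x\<in>p.F z. W x)" using W(1) by blast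
  moreover have "p.F z \<subseteq> (\<Union>x\<in>p.F z. W x)" using W(2) by blast
  ultimately obtain N0 where N0: "openin (top_of_set Y) N0" "z \<in> N0" "\<forall>v\<in>N0. p.F v \<subseteq> (\<Union>x\<in>p.F z. W x)"
    by (rule p.fibre_nbhd[OF zY(1)])
  \<comment> \<open>N0 keeps the whole fibre over v inside the windows W x, and N x makes the window
    W x meet that fibre.\<close>
  define A where "A = N0 \<inter> (\<Inter>x\<in>p.F z. N x)"
  have "openin (top_of_set Y) (\<Inter>x\<in>p.F z. N x)"
    using p.finite_fibre[OF zY(1)] p.fibre_nonempty[OF zY(1)] N(1) by (intro openin_Inter) auto
  then have oA: "openin (top_of_set Y) A" unfolding A_def using N0(1) by (intro openin_Int)
  have zA: "z \<in> A" using N(2) N0(2) by (auto simp: A_def)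
  have "fibre_rank k v = card Z" if v: "v \<in> A" for v
  proof -
    have "bij_betw (\<lambda>u. THE \<zeta>. \<zeta> \<in> Z \<and> u \<in> B \<zeta>) (?h ` p.F v) Z"
    proof -
      have the: "(THE \<zeta>. \<zeta> \<in> Z \<and> u \<in> B \<zeta>) = \<zeta>" if "\<zeta> \<in> Z" "u \<in> B \<zeta>" for \<zeta> u
        using that Bdisj by (intro the_equality) auto
      have ex: "\<exists>\<zeta>\<in>Z. u \<in> B \<zeta>" if u: "u \<in> ?h ` p.F v" for u
      proof -
        obtain y where y: "y \<in> p.F v" "u = ?h y" using u by blast
        then obtain x where x: "x \<in> p.F z" "y \<in> W x" using N0(3) v by (fastforce simp: A_def)
        then have "u \<in> B (?h x)" using W(3)[OF x(1)] y(2) by auto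
        then show ?thesis using x(1) by (auto simp: Z_def)
      qed
      have pu: "p u = (f ^^ k) v" if "u \<in> ?h ` p.F v" for u
        using that comm_k by auto
      show ?thesis
        unfolding bij_betw_def
      proof
        show "inj_on (\<lambda>u. THE \<zeta>. \<zeta> \<in> Z \<and> u \<in> B \<zeta>) (?h ` p.F v)"
        proof (rule inj_onI)
          fix u u' assume u: "u \<in> ?h ` p.F v" "u' \<in> ?h ` p.F v" "(THE \<zeta>. \<zeta> \<in> Z \<and> u \<in> B \<zeta>) = (THE \<zeta>. \<zeta> \<in> Z \<and> u' \<in> B \<zeta>)"
          obtain \<zeta> where z1: "\<zeta> \<in> Z" "u \<in> B \<zeta>" using ex[OF u(1)] by blast
          obtain \<zeta>' where z2: "\<zeta>' \<in> Z" "u' \<in> B \<zeta>'" using ex[OF u(2)] by blast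
          have "\<zeta> = \<zeta>'" using the[OF z1] the[OF z2] u(3) by simp
          then show "u = u'" using B z1 z2 pu[OF u(1)] pu[OF u(2)] inj_onD[of p "B \<zeta>" u u'] by auto
        qed
        show "(\<lambda>u. THE \<zeta>. \<zeta> \<in> Z \<and> u \<in> B \<zeta>) ` ?h ` p.F v = Z"
        proof
          show "(\<lambda>u. THE \<zeta>. \<zeta> \<in> Z \<and> u \<in> B \<zeta>) ` ?h ` p.F v \<subseteq> Z"
          proof
            fix \<xi> assume "\<xi> \<in> (\<lambda>u. THE \<zeta>. \<zeta> \<in> Z \<and> u \<in> B \<zeta>) ` ?h ` p.F v"
            then obtain u where u: "u \<in> ?h ` p.F v" "\<xi> = (THE \<zeta>. \<zeta> \<in> Z \<and> u \<in> B \<zeta>)" by blast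
            obtain \<zeta> where "\<zeta> \<in> Z" "u \<in> B \<zeta>" using ex[OF u(1)] by blast
            then show "\<xi> \<in> Z" using the u(2) by simp
          qed
          show "Z \<subseteq> (\<lambda>u. THE \<zeta>. \<zeta> \<in> Z \<and> u \<in> B \<zeta>) ` ?h ` p.F v"
          proof
            fix \<zeta> assume \<zeta>: "\<zeta> \<in> Z"
            then obtain x where x: "x \<in> p.F z" "\<zeta> = ?h x" by (auto simp: Z_def)
            have "v \<in> p ` W x" using N(3)[OF x(1)] v x(1) by (auto simp: A_def)
            then obtain y where y: "y \<in> W x" "p y = v" by blast
            have "y \<in> X" using openin_imp_subset[OF W(1)[OF x(1)]] y by blast
            then have 1: "?h y \<in> ?h ` p.F v" using y by blast
            have "?h y \<in> B \<zeta>" using W(3)[OF x(1)] y x by blast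
            from the[OF \<zeta> this, symmetric] 1 show "\<zeta> \<in> (\<lambda>u. THE \<zeta>. \<zeta> \<in> Z \<and> u \<in> B \<zeta>) ` ?h ` p.F v"
              by (rule image_eqI)
          qed
        qed
      qed
    qed
    then show ?thesis unfolding fibre_rank_def by (rule bij_betw_same_card)
  qed
  moreover have "fibre_rank k z = card Z" by (simp add: fibre_rank_def Z_def)
  ultimately show ?thesis
    using oA zA by (intro exI[of _ A] conjI ballI) simp_all
qed

lemma fibre_rank_constant: "z \<in> generic k \<Longrightarrow> z' \<in> generic k \<Longrightarrow> fibre_rank k z = fibre_rank k z'"
proof (rule connected_equivalence_relation[OF connected_generic, where R = "\<lambda>z z'. fibre_rank k z = fibre_rank k z'"])
  show "\<exists>T. openin (top_of_set (generic k)) T \<and> a \<in> T \<and> (\<forall>x\<in>T. fibre_rank k a = fibre_rank k x)" if a: "a \<in> generic k" for a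
  proof -
    obtain N where N: "openin (top_of_set Y) N" "a \<in> N" "\<forall>v\<in>N. fibre_rank k v = fibre_rank k a"
      using fibre_rank_locally_constant[OF a] by blast
    obtain U where U: "open U" "N = Y \<inter> U" using N(1) by (auto simp: openin_open)
    show ?thesis
    proof (intro exI[of _ "generic k \<inter> U"] conjI ballI)
      show "openin (top_of_set (generic k)) (generic k \<inter> U)" by (rule openin_open_Int[OF U(1)])
      show "fibre_rank k a = fibre_rank k x" if "x \<in> generic k \<inter> U" for x
      proof -
        have "x \<in> N" using that U(2) generic_subset[of k] by blast
        then show ?thesis using N(3) by simp
      qed
    qed (use a N U in auto)
  qed
qed auto

lemma fibre_rank_mono: "z \<in> Y \<Longrightarrow> fibre_rank (Suc k) z \<le> fibre_rank k z"
proof -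
  assume z: "z \<in> Y"
  have eq: "(q ^^ Suc k) ` p.F z = q ` ((q ^^ k) ` p.F z)" by (auto simp: image_iff)
  show ?thesis unfolding fibre_rank_def eq using p.finite_fibre[OF z] by (intro card_image_le finite_imageI)
qed

lemma stable_rank:
  obtains K where "\<forall>k\<ge>K. \<forall>z\<in>generic k. \<forall>z'\<in>generic K. fibre_rank k z = fibre_rank K z'"
proof -
  define \<rho> where "\<rho> k = fibre_rank k (SOME z. z \<in> generic k)" for k
  \<comment> \<open>Ranks for k and k + 1 are constant on different sets; a point generic for both
    is needed to compare them.\<close>
  have ne: "\<exists>z. z \<in> generic k \<and> z \<in> generic (Suc k)" for k
  proof -
    have "finite ((Y - generic k) \<union> (Y - generic (Suc k)))" using finite_not_generic by simp
    then obtain z where "z \<in> Y" "z \<notin> (Y - generic k) \<union> (Y - generic (Suc k))"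
      by (rule cofinite_meets[of Y, rotated 2]) (use p.neY in auto)
    then show ?thesis by blast
  qed
  have \<rho>: "fibre_rank k z = \<rho> k" if "z \<in> generic k" for k z
    using fibre_rank_constant[OF that someI[of "\<lambda>z. z \<in> generic k", OF that]] by (simp add: \<rho>_def)
  have dec: "\<rho> (Suc k) \<le> \<rho> k" for k
  proof -
    obtain z where z: "z \<in> generic k" "z \<in> generic (Suc k)" using ne by blast
    then show ?thesis using fibre_rank_mono[of z k] \<rho>[OF z(1)] \<rho>[OF z(2)] generic_subset by auto
  qed
  define K where "K = (SOME K. \<forall>k. \<rho> K \<le> \<rho> k)"
  have "\<exists>K. \<forall>k. \<rho> K \<le> \<rho> k"
  proof -
    have "(LEAST n. n \<in> range \<rho>) \<in> range \<rho>" by (rule LeastI[of "\<lambda>n. n \<in> range \<rho>" "\<rho> 0"]) simp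
    then obtain K where "\<rho> K = (LEAST n. n \<in> range \<rho>)" by (metis imageE)
    then show ?thesis by (metis Least_le rangeI)
  qed
  then have K: "\<rho> K \<le> \<rho> k" for k unfolding K_def by (rule someI2_ex) blast
  have \<rho>K: "\<rho> k = \<rho> K" if "k \<ge> K" for k
    using lift_Suc_antimono_le[of \<rho>, OF dec that] K[of k] by simp
  have "\<forall>k\<ge>K. \<forall>z\<in>generic k. \<forall>z'\<in>generic K. fibre_rank k z = fibre_rank K z'"
  proof (intro allI impI ballI)
    fix k z z' assume k: "K \<le> k" and z: "z \<in> generic k" "z' \<in> generic K"
    show "fibre_rank k z = fibre_rank K z'" unfolding \<rho>[OF z(1)] \<rho>[OF z(2)] by (rule \<rho>K[OF k])
  qed
  then show ?thesis by (rule that)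
qed

text \<open>q^k sends the fibre over z into the fibre over f^k z, so the q^(2k)-image of the first
  lies in the q^k-image of the second. Both images have the stable cardinality, because z is generic
  for 2 k and f^k z is generic for k, so they coincide.\<close>

lemma generic_lift:
  assumes K: "\<forall>k\<ge>K. \<forall>z\<in>generic k. \<forall>z'\<in>generic K. fibre_rank k z = fibre_rank K z'"
    and k: "k \<ge> K" and z: "z \<in> generic k" "z \<in> generic (2 * k)" and y: "y \<in> p.F ((f ^^ k) z)"
  shows "\<exists>x\<in>p.F z. (q ^^ (2 * k)) x = (q ^^ k) y"
proof -
  have zY: "z \<in> Y" using z generic_subset by blast
  have fz: "(f ^^ k) z \<in> generic k"
    using z zY fkY by (auto simp: generic_def mult_2 funpow_add)
  obtain z0 where z0: "z0 \<in> generic K"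
    using cofinite_meets[of Y "Y - generic K"] finite_not_generic p.neY by auto
  have "fibre_rank (2 * k) z = fibre_rank k ((f ^^ k) z)"
    using K[rule_format, OF _ z(2) z0] K[rule_format, OF k fz z0] k by simp
  moreover have sub: "(q ^^ (2 * k)) ` p.F z \<subseteq> (q ^^ k) ` p.F ((f ^^ k) z)"
  proof
    fix u assume "u \<in> (q ^^ (2 * k)) ` p.F z"
    then obtain x where x: "x \<in> p.F z" "u = (q ^^ k) ((q ^^ k) x)" by (auto simp: mult_2 funpow_add)
    then have "(q ^^ k) x \<in> p.F ((f ^^ k) z)" using comm_k qkX by auto
    then show "u \<in> (q ^^ k) ` p.F ((f ^^ k) z)" using x by blast
  qed
  ultimately have "(q ^^ (2 * k)) ` p.F z = (q ^^ k) ` p.F ((f ^^ k) z)"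
    using p.finite_fibre[OF fkY[OF zY]] by (intro card_subset_eq) (auto simp: fibre_rank_def)
  then show ?thesis using y by (metis (no_types, lifting) imageE imageI)
qed

text \<open>The generic statement extends to all points, as both sides are closed conditions.\<close>

lemma lift:
  assumes K: "\<forall>k\<ge>K. \<forall>z\<in>generic k. \<forall>z'\<in>generic K. fibre_rank k z = fibre_rank K z'"
    and k: "k \<ge> K" and z: "z \<in> Y" and y: "y \<in> p.F ((f ^^ k) z)"
  shows "\<exists>x\<in>p.F z. (q ^^ (2 * k)) x = (q ^^ k) y"
proof (rule ccontr)
  assume no: "\<not> ?thesis"
  \<comment> \<open>C is the compact set of solutions (x, y). Applying p to the first coordinate
    gives a compact set of admissible pairs, so a failing pair (z, y) has a product neighbourhood of
    failing pairs.\<close>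
  define C where "C = {xy\<in>X \<times> X. (q ^^ (2 * k)) (fst xy) = (q ^^ k) (snd xy)}"
  have c1: "continuous_on (X \<times> X) (\<lambda>xy. (q ^^ (2 * k)) (fst xy))"
    by (rule continuous_on_compose2[OF cont_qk]) (auto intro!: continuous_intros)
  have c2: "continuous_on (X \<times> X) (\<lambda>xy. (q ^^ k) (snd xy))"
    by (rule continuous_on_compose2[OF cont_qk]) (auto intro!: continuous_intros)
  have "closedin (top_of_set (X \<times> X)) {xy\<in>X \<times> X. dist ((q ^^ (2 * k)) (fst xy)) ((q ^^ k) (snd xy)) = 0}"
    by (intro continuous_closedin_preimage_constant continuous_on_dist c1 c2)
  then have "closedin (top_of_set (X \<times> X)) C" by (simp add: C_def)
  then have "compact C"
    using closedin_compact compact_Times[OF p.compX p.compX] by blast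
  moreover have "continuous_on C (\<lambda>xy. (p (fst xy), snd xy))"
    by (intro continuous_on_Pair continuous_on_compose2[OF p.cont]) (auto simp: C_def intro!: continuous_intros)
  ultimately have "compact ((\<lambda>xy. (p (fst xy), snd xy)) ` C)"
    by (intro compact_continuous_image)
  then have "open (- ((\<lambda>xy. (p (fst xy), snd xy)) ` C))"
    by (intro open_Compl compact_imp_closed)
  moreover have "(z, y) \<in> - ((\<lambda>xy. (p (fst xy), snd xy)) ` C)"
    using no by (auto simp: C_def)
  ultimately obtain A B where AB: "open A" "open B" "z \<in> A" "y \<in> B" "A \<times> B \<subseteq> - ((\<lambda>xy. (p (fst xy), snd xy)) ` C)"
    by (rule open_prod_elim) auto
  \<comment> \<open>As p is open, the points over f^k z' still include one in B when z' is close to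
    z. Such a z' can be taken generic, where \<open>generic_lift\<close> contradicts
    failure.\<close>
  have oB: "openin (top_of_set Y) (p ` (X \<inter> B))"
    by (rule p.open_image) (rule openin_open_Int[OF AB(2)])
  have "openin (top_of_set Y) (Y \<inter> (f ^^ k) -` (p ` (X \<inter> B)))"
    using continuous_openin_preimage[OF cont_fk[of k], of Y "p ` (X \<inter> B)"] oB fkY by auto
  then have "openin (top_of_set Y) ((Y \<inter> A) \<inter> (Y \<inter> (f ^^ k) -` (p ` (X \<inter> B))))"
    by (rule openin_Int[OF openin_open_Int[OF AB(1)]])
  moreover have "z \<in> (Y \<inter> A) \<inter> (Y \<inter> (f ^^ k) -` (p ` (X \<inter> B)))"
    using z AB y by (auto intro!: image_eqI[of _ p y])
  moreover have "finite ((Y - generic k) \<union> (Y - generic (2 * k)))" using finite_not_generic by simp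
  ultimately obtain z' where z': "z' \<in> (Y \<inter> A) \<inter> (Y \<inter> (f ^^ k) -` (p ` (X \<inter> B)))" "z' \<notin> (Y - generic k) \<union> (Y - generic (2 * k))"
    by (metis (no_types, lifting) cofinite_meets empty_iff)
  then obtain y' where y': "y' \<in> X" "y' \<in> B" "p y' = (f ^^ k) z'" by auto
  have "z' \<in> generic k" "z' \<in> generic (2 * k)" using z' by auto
  then obtain x where x: "x \<in> p.F z'" "(q ^^ (2 * k)) x = (q ^^ k) y'"
    using generic_lift[OF K k, of z' y'] y' by auto
  then have "(x, y') \<in> C" using y' by (auto simp: C_def)
  then have "(z', y') \<in> (\<lambda>xy. (p (fst xy), snd xy)) ` C"
    using x by (auto intro!: image_eqI[of _ _ "(x, y')"])
  then show False using AB(5) z' y' by auto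
qed

text \<open>All points over w are compared with one z satisfying f^k z = w that is not a branch
  value. Their common multiplicity is then the local degree of f^k at z.\<close>

theorem uniform:
  assumes w: "w \<in> Y" and y: "y \<in> p.F w" "y' \<in> p.F w"
  shows "mp y = mp y'"
proof -
  obtain K where K: "\<forall>k\<ge>K. \<forall>z\<in>generic k. \<forall>z'\<in>generic K. fibre_rank k z = fibre_rank K z'"
    using stable_rank by blast
  \<comment> \<open>At most deg p times the number of branch values points of X lie over branch
    values. This is less than 2^k, hence less than the (deg f)^k points of the q^k-fibre of y, so
    one of these points lies over an unbranched z. The bound K makes \<open>lift\<close>
    available.\<close>
  define k where "k = max K (p.deg * card branch_values)"
  have kK: "k \<ge> K" by (simp add: k_def)
  have "p.deg * card branch_values \<le> k" by (simp add: k_def)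
  also have "k < 2 ^ k" by simp
  also have "(2::nat) ^ k \<le> f.deg ^ k" using deg_f by (rule power_mono) simp
  finally have big: "p.deg * card branch_values < f.deg ^ k" .
  have "\<exists>z\<in>Y. (f ^^ k) z = w \<and> z \<notin> branch_values"
  proof (rule ccontr)
    assume "\<not> ?thesis"
    then have "{x\<in>X. (q ^^ k) x = y} \<subseteq> (\<Union>z\<in>branch_values. p.F z)"
      using y comm_k pX by fastforce
    moreover have "finite (\<Union>z\<in>branch_values. p.F z)"
      using finite_branch_values branch_values_subset p.finite_fibre by auto
    ultimately have "card {x\<in>X. (q ^^ k) x = y} \<le> card (\<Union>z\<in>branch_values. p.F z)"
      by (intro card_mono)
    also have "\<dots> \<le> (\<Sum>z\<in>branch_values. card (p.F z))" by (rule card_UN_le[OF finite_branch_values])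
    also have "\<dots> \<le> (\<Sum>z\<in>branch_values. p.deg)" using p.card_F_le branch_values_subset by (intro sum_mono) auto
    finally show False using card_qk_fibre[of y k] y big by (simp add: mult.commute)
  qed
  then obtain z where z: "z \<in> Y" "(f ^^ k) z = w" "z \<notin> branch_values" by blast
  have "mp u = orbit_mult k z" if u: "u \<in> p.F w" for u
  proof -
    have "u \<in> p.F ((f ^^ k) z)" using u z by simp
    then obtain x where x: "x \<in> p.F z" "(q ^^ (2 * k)) x = (q ^^ k) u"
      using lift[OF K kK z(1)] by blast
    have xX: "x \<in> X" "p x = z" "mp x = 1" using x unbranched_mult[OF z(3)] by auto
    have qx: "(q ^^ k) x \<in> X" "p ((q ^^ k) x) = w" using qkX comm_k xX z by (auto simp flip: comm_k)
    \<comment> \<open>The points u and q^k x both lie over w and have the same image under q^k, so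
      the same positive factor multiplies both multiplicities and cancels.\<close>
    have "orbit_mult k w * mp u = mp ((q ^^ k) u)" using mult_k[of u k] u by simp
    also have "\<dots> = mp ((q ^^ k) ((q ^^ k) x))" using x(2) by (simp add: mult_2 funpow_add)
    also have "\<dots> = orbit_mult k w * mp ((q ^^ k) x)" using mult_k[OF qx(1), of k] qx(2) by simp
    finally have "mp u = mp ((q ^^ k) x)" using orbit_mult_ge1[OF w, of k] by simp
    then show ?thesis using mult_k[OF xX(1), of k] xX by simp
  qed
  then show ?thesis using y by simp
qed

end

section \<open>The torus as a quotient of the plane\<close>

text \<open>Presents the sphere as a subspace of a metric space of functions, the setting of all
  preceding counting lemmas.\<close>

lemma nsphere_top: "nsphere n = top_of_set (topspace (nsphere n))"
  by (simp add: nsphere euclidean_product_topology)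

definition circle_set :: "(nat \<Rightarrow> real) set" where "circle_set = topspace (nsphere 1)"

definition circle_point :: "real \<Rightarrow> nat \<Rightarrow> real" where
  "circle_point t = (\<lambda>i. if i = 0 then cos (2 * pi * t) else if i = 1 then sin (2 * pi * t) else 0)"

text \<open>The universal covering of the torus with deck group Z + Z i, scaled so that unit squares
  are period squares.\<close>

definition torus_exp :: "complex \<Rightarrow> (nat \<Rightarrow> real) \<times> (nat \<Rightarrow> real)" where
  "torus_exp z = (circle_point (Re z), circle_point (Im z))"

lemma circle_set_iff: "x \<in> circle_set \<longleftrightarrow> (x 0)\<^sup>2 + (x 1)\<^sup>2 = 1 \<and> (\<forall>i>1. x i = 0)"
  by (auto simp: circle_set_def nsphere euclidean_product_topology)

lemma circle_in: "circle_point t \<in> circle_set"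
  by (simp add: circle_set_iff circle_point_def)

lemma circle_surj:
  assumes "x \<in> circle_set"
  obtains t where "x = circle_point t"
proof -
  obtain s where s: "x 0 = cos s" "x 1 = sin s"
    using sincos_total_2pi[of "x 0" "x 1"] assms by (auto simp: circle_set_iff)
  have x0: "x i = 0" if "i > 1" for i using assms that by (simp add: circle_set_iff)
  have "x = circle_point (s / (2 * pi))"
  proof
    fix i :: nat
    consider "i = 0" | "i = 1" | "i > 1" by arith
    then show "x i = circle_point (s / (2 * pi)) i"
      using s x0 by cases (auto simp: circle_point_def)
  qed
  then show ?thesis by (rule that)
qed

lemma circle_eq_iff: "circle_point t = circle_point s \<longleftrightarrow> (\<exists>n::int. t = s + of_int n)"
proof
  assume "circle_point t = circle_point s"
  then have "circle_point t 0 = circle_point s 0" "circle_point t 1 = circle_point s 1" by simp_all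
  then have "sin (2 * pi * t) = sin (2 * pi * s) \<and> cos (2 * pi * t) = cos (2 * pi * s)"
    by (simp add: circle_point_def)
  then obtain n :: int where "2 * pi * t = 2 * pi * s + 2 * pi * of_int n"
    using sin_cos_eq_iff by blast
  then have "2 * pi * t = 2 * pi * (s + of_int n)" by (simp add: algebra_simps)
  then show "\<exists>n::int. t = s + of_int n" by (intro exI[of _ n]) simp
next
  assume "\<exists>n::int. t = s + of_int n"
  then obtain n :: int where n: "t = s + of_int n" by blast
  then have "2 * pi * t = 2 * pi * s + 2 * pi * of_int n" by (simp add: algebra_simps)
  then have "sin (2 * pi * t) = sin (2 * pi * s)" "cos (2 * pi * t) = cos (2 * pi * s)"
    using sin_cos_eq_iff by blast+
  then show "circle_point t = circle_point s" unfolding circle_point_def by (simp only:)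
qed

lemma continuous_circle_point: "continuous_on A circle_point"
proof (rule continuous_on_coordinatewise_then_product)
  fix i show "continuous_on A (\<lambda>t. circle_point t i)"
    unfolding circle_point_def by (cases "i = 0"; cases "i = 1") (auto intro!: continuous_intros)
qed

lemma continuous_torus_exp: "continuous_on A torus_exp"
  unfolding torus_exp_def by (intro continuous_on_Pair continuous_on_compose2[OF continuous_circle_point[of UNIV]] continuous_intros) auto

abbreviation torus_set where "torus_set \<equiv> circle_set \<times> circle_set"

lemma torus_in: "torus_exp z \<in> torus_set"
  by (simp add: torus_exp_def circle_in)

lemma torus_eq_iff: "torus_exp z = torus_exp w \<longleftrightarrow> (\<exists>m n :: int. z = w + of_int m + of_int n * \<i>)"
  by (auto simp: torus_exp_def circle_eq_iff complex_eq_iff)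

lemma torus_shift: "torus_exp (z + of_int m + of_int n * \<i>) = torus_exp z"
  using torus_eq_iff by blast

lemma torus_onto_square:
  assumes "x \<in> torus_set"
  obtains z where "z \<in> cbox a (a + 1 + \<i>)" "torus_exp z = x"
proof -
  obtain s t where st: "fst x = circle_point s" "snd x = circle_point t"
    using assms circle_surj by (metis mem_Times_iff)
  define z where "z = Complex s t"
  define m where "m = \<lfloor>Re (z - a)\<rfloor>"
  define n where "n = \<lfloor>Im (z - a)\<rfloor>"
  have "torus_exp z = x" using st by (simp add: torus_exp_def z_def prod_eq_iff)
  moreover have "torus_exp (z + of_int (-m) + of_int (-n) * \<i>) = torus_exp z" by (rule torus_shift)
  moreover have "z + of_int (-m) + of_int (-n) * \<i> \<in> cbox a (a + 1 + \<i>)"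
    unfolding in_cbox_complex_iff m_def n_def by (simp; linarith)
  ultimately show ?thesis using that by simp
qed

lemma torus_image: "torus_exp ` cbox a (a + 1 + \<i>) = torus_set"
proof
  show "torus_set \<subseteq> torus_exp ` cbox a (a + 1 + \<i>)"
  proof
    fix x assume "x \<in> torus_set"
    then obtain z where "z \<in> cbox a (a + 1 + \<i>)" "torus_exp z = x" by (rule torus_onto_square)
    then show "x \<in> torus_exp ` cbox a (a + 1 + \<i>)" by blast
  qed
qed (use torus_in in blast)

lemma compact_torus_set: "compact torus_set"
  using compact_continuous_image[OF continuous_torus_exp compact_cbox[of 0 "0 + 1 + \<i>"]] torus_image by metis

text \<open>The complement of the image is itself the image of a compact set: a period square minus
  all lattice translates of U.\<close>

lemma torus_open:
  assumes "open U"
  shows "openin (top_of_set torus_set) (torus_exp ` U)"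
proof -
  define W where "W = (\<Union>m::int. \<Union>n::int. (\<lambda>z. (of_int m + of_int n * \<i>) + z) ` U)"
  have oW: "open W" unfolding W_def using open_translation[OF assms] by blast
  have iff: "torus_exp z \<in> torus_exp ` U \<longleftrightarrow> z \<in> W" for z
  proof
    assume "torus_exp z \<in> torus_exp ` U"
    then obtain u where "u \<in> U" "torus_exp z = torus_exp u" by blast
    then obtain m n :: int where "z = u + of_int m + of_int n * \<i>" using torus_eq_iff by blast
    then have "z = (of_int m + of_int n * \<i>) + u" by simp
    then show "z \<in> W" unfolding W_def using \<open>u \<in> U\<close> by blast
  next
    assume "z \<in> W"
    then obtain u and m n :: int where u: "u \<in> U" "z = (of_int m + of_int n * \<i>) + u"
      unfolding W_def by blast
    then have "z = u + of_int m + of_int n * \<i>" by simp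
    then have "torus_exp z = torus_exp u" using torus_shift by metis
    then show "torus_exp z \<in> torus_exp ` U" using u by blast
  qed
  have "torus_set - torus_exp ` U = torus_exp ` (cbox 0 (0 + 1 + \<i>) - W)"
  proof
    show "torus_set - torus_exp ` U \<subseteq> torus_exp ` (cbox 0 (0 + 1 + \<i>) - W)"
    proof
      fix x assume x: "x \<in> torus_set - torus_exp ` U"
      then obtain z where z: "z \<in> cbox 0 (0 + 1 + \<i>)" "torus_exp z = x" using torus_onto_square by blast
      then have "z \<notin> W" using iff[of z] x by blast
      then show "x \<in> torus_exp ` (cbox 0 (0 + 1 + \<i>) - W)" using z by blast
    qed
    show "torus_exp ` (cbox 0 (0 + 1 + \<i>) - W) \<subseteq> torus_set - torus_exp ` U"
    proof
      fix x assume "x \<in> torus_exp ` (cbox 0 (0 + 1 + \<i>) - W)"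
      then obtain z where z: "x = torus_exp z" "z \<notin> W" by blast
      show "x \<in> torus_set - torus_exp ` U"
        unfolding z(1) using z(2) iff[of z] torus_in[of z] by (intro DiffI) simp_all
    qed
  qed
  moreover have "compact (cbox 0 (0 + 1 + \<i>) - W)" using oW by (intro compact_diff) auto
  then have "compact (torus_exp ` (cbox 0 (0 + 1 + \<i>) - W))" by (intro compact_continuous_image continuous_torus_exp)
  ultimately have "closed (torus_set - torus_exp ` U)" using compact_imp_closed by simp
  then have "open (- (torus_set - torus_exp ` U))" by (rule open_Compl)
  then have "openin (top_of_set torus_set) (torus_set \<inter> - (torus_set - torus_exp ` U))" by (rule openin_open_Int)
  moreover have "torus_set \<inter> - (torus_set - torus_exp ` U) = torus_exp ` U"
  proof -
    have "torus_exp ` U \<subseteq> torus_set" using torus_in by (intro image_subsetI)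
    then show ?thesis by blast
  qed
  ultimately show ?thesis by simp
qed

lemma torus_eq_close:
  assumes "torus_exp z = torus_exp w" "\<bar>Re (z - w)\<bar> < 1" "\<bar>Im (z - w)\<bar> < 1"
  shows "z = w"
proof -
  obtain m n :: int where mn: "z = w + of_int m + of_int n * \<i>" using assms(1) torus_eq_iff by blast
  then have "\<bar>real_of_int m\<bar> < 1" "\<bar>real_of_int n\<bar> < 1" using assms(2,3) by simp_all
  then have "m = 0" "n = 0" by linarith+
  then show ?thesis using mn by simp
qed

text \<open>Points of a ball of radius 1/2 are less than 1 apart, while nonzero lattice vectors have
  length at least 1.\<close>

lemma torus_inj_ball: "inj_on torus_exp (ball c (1/2))"
proof (rule inj_onI)
  fix z w assume zw: "z \<in> ball c (1/2)" "w \<in> ball c (1/2)" "torus_exp z = torus_exp w"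
  have "dist z c < 1/2" "dist w c < 1/2" using zw by (auto simp: dist_commute)
  then have "dist z w < 1" using dist_triangle2[of z w c] by linarith
  then have "cmod (z - w) < 1" by (simp add: dist_norm)
  then show "z = w"
    using abs_Re_le_cmod[of "z - w"] abs_Im_le_cmod[of "z - w"] by (intro torus_eq_close[OF zw(3)]) linarith+
qed

lemma torus_local_inverse:
  obtains h where "homeomorphism (ball c (1/2)) (torus_exp ` ball c (1/2)) torus_exp h"
proof (rule homeomorphism_injective_open_map[OF continuous_torus_exp refl torus_inj_ball])
  show "openin (top_of_set (torus_exp ` ball c (1/2))) (torus_exp ` U)" if U: "openin (top_of_set (ball c (1/2))) U" for U
  proof -
    have "open U" using U openin_open_trans by blast
    have "openin (top_of_set (torus_exp ` ball c (1/2))) (torus_exp ` ball c (1/2) \<inter> torus_exp ` U)"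
    proof (rule openin_Int_subset[OF torus_open[OF \<open>open U\<close>]])
      show "torus_exp ` ball c (1/2) \<subseteq> torus_set" using torus_in by blast
    qed
    moreover have "torus_exp ` ball c (1/2) \<inter> torus_exp ` U = torus_exp ` U" using openin_imp_subset[OF U] by blast
    ultimately show ?thesis by simp
  qed
qed (use that in blast)

lemma finite_torus_fibre: "finite {z\<in>cbox a b. torus_exp z = x}"
proof (cases "{z\<in>cbox a b. torus_exp z = x} = {}")
  case False
  then obtain w where w: "w \<in> cbox a b" "torus_exp w = x" by blast
  define N where "N = \<lceil>\<bar>Re b - Re a\<bar> + \<bar>Im b - Im a\<bar>\<rceil>"
  have "{z\<in>cbox a b. torus_exp z = x} \<subseteq> (\<lambda>(m, n). w + of_int m + of_int n * \<i>) ` ({-N..N} \<times> {-N..N})"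
  proof
    fix z assume z: "z \<in> {z\<in>cbox a b. torus_exp z = x}"
    then have "torus_exp z = torus_exp w" using w by simp
    then obtain m n :: int where mn: "z = w + of_int m + of_int n * \<i>"
      unfolding torus_eq_iff by (elim exE) (rule that)
    have "Re z = Re w + real_of_int m" "Im z = Im w + real_of_int n" unfolding mn by simp_all
    moreover have "\<bar>Re z - Re w\<bar> \<le> \<bar>Re b - Re a\<bar>" "\<bar>Im z - Im w\<bar> \<le> \<bar>Im b - Im a\<bar>"
      using z w(1) by (auto simp: in_cbox_complex_iff)
    moreover have "\<bar>Re b - Re a\<bar> + \<bar>Im b - Im a\<bar> \<le> of_int N" unfolding N_def by (rule le_of_int_ceiling)
    ultimately have "real_of_int \<bar>m\<bar> \<le> of_int N" "real_of_int \<bar>n\<bar> \<le> of_int N"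
      unfolding of_int_abs by linarith+
    then have "\<bar>m\<bar> \<le> N" "\<bar>n\<bar> \<le> N" unfolding of_int_le_iff by simp_all
    then have "m \<in> {-N..N}" "n \<in> {-N..N}" by auto
    then show "z \<in> (\<lambda>(m, n). w + of_int m + of_int n * \<i>) ` ({-N..N} \<times> {-N..N})"
      using mn by (intro image_eqI[of _ _ "(m, n)"]) auto
  qed
  then show ?thesis by (rule finite_subset) auto
next
  case True
  show ?thesis unfolding True by simp
qed

lemma finite_torus_preimage: "finite B \<Longrightarrow> finite {z\<in>cbox a b. torus_exp z \<in> B}"
proof -
  assume B: "finite B"
  have "{z\<in>cbox a b. torus_exp z \<in> B} = (\<Union>x\<in>B. {z\<in>cbox a b. torus_exp z = x})" by blast
  then show ?thesis using B finite_torus_fibre by simp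
qed

text \<open>E parametrises the source near x and h is a coordinate on the target near f x, so g is h
  after f after E. With the disc charts inserted, \<phi> after E becomes the inner map and h after
  the inverse of \<psi> the outer one. For q, h is a local inverse of the torus covering; for p, it
  is a chart of the punctured sphere.\<close>

lemma pow_at_of_power_form:
  fixes R :: "'a::metric_space surface" and C :: "'b::metric_space surface" and E :: "complex \<Rightarrow> 'a"
  assumes pf: "power_form R C f x U V d" and tR: "surf_top R = top_of_set X" and tC: "surf_top C = top_of_set Y"
    and E: "continuous_on UNIV E" "range E \<subseteq> X" "E c = x" "inj_on E (ball c r0)" "r0 > 0"
    and L: "openin (top_of_set Y) L" "f x \<in> L" and h: "continuous_on L h" "inj_on h L"
    and g: "r1 > 0" "\<forall>z\<in>ball c r1. f (E z) \<in> L \<longrightarrow> g z = h (f (E z))"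
  shows "pow_at g c d"
proof -
  obtain \<phi> :: "'a \<Rightarrow> complex" and \<phi>' and \<psi> :: "'b \<Rightarrow> complex" and \<psi>' where pf': "d \<ge> 1" "x \<in> U" "f ` U \<subseteq> V" "\<phi> x = 0" "\<psi> (f x) = 0" "\<forall>u \<in> U. \<psi> (f u) = \<phi> u ^ d"
    and h1: "openin (top_of_set X) U" "homeomorphism U (ball 0 1) \<phi> \<phi>'"
    and h2: "openin (top_of_set Y) V" "homeomorphism V (ball 0 1) \<psi> \<psi>'"
    by (rule power_formE[OF pf tR tC])
  have inj1: "inj_on \<phi> U" using h1(2) by (metis homeomorphism_apply1 inj_onI)
  have "openin (top_of_set V) (V \<inter> L)" by (rule openin_Int_subset[OF L(1) openin_imp_subset[OF h2(1)]])
  then have "openin (top_of_set (ball 0 1)) (\<psi> ` (V \<inter> L))" by (rule homeomorphism_imp_open_map[OF h2(2)])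
  then have "open (\<psi> ` (V \<inter> L))" using openin_open_trans by blast
  moreover have "0 \<in> \<psi> ` (V \<inter> L)"
    using pf'(2,3,5) L(2) by (intro image_eqI[of _ _ "f x"]) auto
  ultimately obtain s where s: "s > 0" "ball 0 s \<subseteq> \<psi> ` (V \<inter> L)"
    by (meson open_contains_ball)
  have \<psi>L: "\<psi>' w \<in> V \<inter> L" "\<psi> (\<psi>' w) = w" if w: "w \<in> ball 0 s" for w :: complex
  proof -
    obtain v where v: "v \<in> V \<inter> L" "w = \<psi> v" using s(2) w by blast
    then have "\<psi>' w = v" using h2(2) by (simp add: homeomorphism_def)
    then show "\<psi>' w \<in> V \<inter> L" "\<psi> (\<psi>' w) = w" using v by auto
  qed
  have sub1: "ball 0 s \<subseteq> ball (0::complex) 1"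
  proof
    fix w :: complex assume "w \<in> ball 0 s"
    then have "\<psi>' w \<in> V" "\<psi> (\<psi>' w) = w" using \<psi>L by auto
    then show "w \<in> ball 0 1" using h2(2) by (metis homeomorphism_image1 imageI)
  qed
  have "openin (top_of_set UNIV) (UNIV \<inter> E -` U)"
    using continuous_openin_preimage[OF E(1), of X U] h1(1) E(2) by auto
  then have oEU: "open (E -` U)" by simp
  have ca: "continuous_on (E -` U) (\<lambda>z. \<phi> (E z))"
    by (rule continuous_on_compose2[of U \<phi>]) (use h1(2) E(1) in \<open>auto simp: homeomorphism_def intro: continuous_on_subset\<close>)
  then have "openin (top_of_set (E -` U)) ((E -` U) \<inter> (\<lambda>z. \<phi> (E z) ^ d) -` ball 0 s)"
    by (intro continuous_openin_preimage_gen continuous_intros) auto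
  then have "open ((E -` U) \<inter> (\<lambda>z. \<phi> (E z) ^ d) -` ball 0 s)"
    using openin_open_trans oEU by blast
  moreover have "c \<in> (E -` U) \<inter> (\<lambda>z. \<phi> (E z) ^ d) -` ball 0 s"
  proof -
    have "\<phi> (E c) ^ d = 0" using pf'(1,4) E(3) by simp
    then have "\<phi> (E c) ^ d \<in> ball 0 s" using s(1) by (simp only: centre_in_ball)
    then show ?thesis using pf'(2) E(3) by blast
  qed
  ultimately obtain r2 where r2: "r2 > 0" "ball c r2 \<subseteq> (E -` U) \<inter> (\<lambda>z. \<phi> (E z) ^ d) -` ball 0 s"
    by (meson open_contains_ball)
  define r where "r = min r2 (min r0 r1)"
  have r: "r > 0" "ball c r \<subseteq> ball c r2" "ball c r \<subseteq> ball c r0" "ball c r \<subseteq> ball c r1"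
    using r2(1) E(5) g(1) by (auto simp: r_def)
  have EU: "E z \<in> U" "\<phi> (E z) ^ d \<in> ball 0 s" if "z \<in> ball c r" for z
    using subsetD[OF r2(2) subsetD[OF r(2) that]] by blast+
  show ?thesis
    unfolding pow_at_def
  proof (rule conjI[OF pf'(1)], rule exI[of _ r], rule conjI[OF r(1)], rule exI[of _ s], rule conjI[OF s(1)],
      rule exI[of _ "\<lambda>z. \<phi> (E z)"], rule exI[of _ "\<lambda>w. h (\<psi>' w)"], intro conjI ballI)
    show "continuous_on (ball c r) (\<lambda>z. \<phi> (E z))"
      by (rule continuous_on_subset[OF ca]) (use EU in auto)
    show "inj_on (\<lambda>z. \<phi> (E z)) (ball c r)"
      using inj1 E(4) r(3) EU(1) by (auto simp: inj_on_def subset_iff)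
    show "continuous_on (ball 0 s) (\<lambda>w. h (\<psi>' w))"
      by (rule continuous_on_compose2[OF h(1)])
        (use h2(2) \<psi>L sub1 in \<open>auto simp: homeomorphism_def intro: continuous_on_subset\<close>)
    show "inj_on (\<lambda>w. h (\<psi>' w)) (ball 0 s)"
    proof (rule inj_onI)
      fix w w' assume "w \<in> ball 0 s" "w' \<in> ball 0 s" "h (\<psi>' w) = h (\<psi>' w')"
      then show "w = w'" using inj_onD[OF h(2), of "\<psi>' w" "\<psi>' w'"] \<psi>L by (metis IntD2)
    qed
    show "\<phi> (E z) ^ d \<in> ball 0 s" if "z \<in> ball c r" for z using EU[OF that] by simp
    show "g z = h (\<psi>' (\<phi> (E z) ^ d))" if z: "z \<in> ball c r" for z
    proof -
      have "f (E z) \<in> V" using EU(1)[OF z] pf'(3) by blast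
      moreover have "\<psi> (f (E z)) = \<phi> (E z) ^ d" using pf'(6) EU(1)[OF z] by blast
      ultimately have eq: "\<psi>' (\<phi> (E z) ^ d) = f (E z)" using h2(2) by (metis homeomorphism_apply1)
      then have "f (E z) \<in> L" using \<psi>L(1)[OF EU(2)[OF z]] by simp
      then show ?thesis using g(2) r(4) z eq by auto
    qed
  qed (use pf'(4) E(3) in auto)
qed

section \<open>The sphere with points removed\<close>

lemma nsphere2_homeomorphism:
  obtains f :: "(nat \<Rightarrow> real) \<Rightarrow> complex \<times> real" and g
  where "homeomorphism (topspace (nsphere 2)) (sphere 0 1) f g"
proof -
  obtain f :: "(nat \<Rightarrow> real) \<Rightarrow> complex \<times> real" and g
    where fg: "homeomorphic_maps (nsphere 2) (top_of_set (sphere 0 1)) f g"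
    by (rule nsphere2_homeo)
  then have m: "homeomorphic_maps (top_of_set (topspace (nsphere 2))) (top_of_set (sphere 0 1)) f g"
    using nsphere_top[of 2] by simp
  then have "homeomorphism (topspace (nsphere 2)) (sphere 0 1) f g"
    using homeomorphic_imp_surjective_map[of "top_of_set (topspace (nsphere 2))" "top_of_set (sphere 0 1)" f]
      homeomorphic_imp_surjective_map[of "top_of_set (sphere 0 1)" "top_of_set (topspace (nsphere 2))" g]
    unfolding homeomorphic_maps_map
    by (auto simp: homeomorphism_def homeomorphic_eq_everything_map continuous_map_in_subtopology)
  then show ?thesis by (rule that)
qed

lemma sphere2_punctured:
  assumes a: "a \<in> topspace (nsphere 2)"
  obtains \<sigma> :: "(nat \<Rightarrow> real) \<Rightarrow> complex" and \<sigma>' where "homeomorphism (topspace (nsphere 2) - {a}) UNIV \<sigma> \<sigma>'"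
proof -
  let ?Y = "topspace (nsphere 2)"
  obtain f :: "(nat \<Rightarrow> real) \<Rightarrow> complex \<times> real" and g where h: "homeomorphism ?Y (sphere 0 1) f g"
    by (rule nsphere2_homeomorphism)
  have fa: "f a \<in> sphere 0 1" using h a by (metis homeomorphism_image1 imageI)
  have "homeomorphism (?Y - {a}) (f ` (?Y - {a})) f g"
    by (rule homeomorphism_of_subsets[OF h]) auto
  moreover have "f ` (?Y - {a}) = sphere 0 1 - {f a}"
  proof -
    have "inj_on f ?Y" by (rule inj_on_inverseI[of _ g]) (rule homeomorphism_apply1[OF h])
    then have "f ` (?Y - {a}) = f ` ?Y - f ` {a}" by (rule inj_on_image_set_diff) (use a in auto)
    then show ?thesis using homeomorphism_image1[OF h] by simp
  qed
  ultimately have 1: "?Y - {a} homeomorphic sphere 0 1 - {f a}"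
    by (auto simp: homeomorphic_def)
  let ?H = "{x :: complex \<times> real. (0, 1) \<bullet> x = 0}"
  have ad: "aff_dim ?H = 2" using aff_dim_hyperplane[of "(0, 1) :: complex \<times> real" 0] by (simp add: zero_prod_def)
  have 2: "sphere 0 1 - {f a} homeomorphic ?H"
    by (rule homeomorphic_punctured_sphere_affine) (use fa ad affine_hyperplane in auto)
  have 3: "?H homeomorphic (UNIV :: complex set)"
    by (rule homeomorphic_affine_sets) (use ad affine_hyperplane in auto)
  have "?Y - {a} homeomorphic (UNIV :: complex set)"
    using homeomorphic_trans[OF homeomorphic_trans[OF 1 2] 3] .
  then show ?thesis using that by (auto simp: homeomorphic_def)
qed

lemma compact_nsphere2: "compact (topspace (nsphere 2))"
proof -
  obtain f :: "(nat \<Rightarrow> real) \<Rightarrow> complex \<times> real" and g where h: "homeomorphism (topspace (nsphere 2)) (sphere 0 1) f g"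
    by (rule nsphere2_homeomorphism)
  then show ?thesis using compact_continuous_image[of "sphere 0 1" g] by (simp add: homeomorphism_def)
qed

text \<open>Removing one further point a moves the question to the plane, where finite sets do not
  disconnect. The point is put back by a set lying between a connected set and its closure; here a
  must be a limit of the other points, which \<open>perf\<close> provides.\<close>

lemma connected_sphere2_cofinite:
  assumes perf: "\<forall>U. openin (top_of_set (topspace (nsphere 2))) U \<and> U \<noteq> {} \<longrightarrow> infinite U" and A: "finite A"
  shows "connected (topspace (nsphere 2) - A)"
proof -
  let ?Y = "topspace (nsphere 2)"
  obtain a where a: "a \<in> ?Y" using in_topspace_nsphere by blast
  obtain \<sigma> :: "(nat \<Rightarrow> real) \<Rightarrow> complex" and \<sigma>' where \<sigma>: "homeomorphism (?Y - {a}) UNIV \<sigma> \<sigma>'"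
    by (rule sphere2_punctured[OF a])
  have eq: "?Y - insert a A = \<sigma>' ` (UNIV - \<sigma> ` (A \<inter> (?Y - {a})))"
  proof
    show "?Y - insert a A \<subseteq> \<sigma>' ` (UNIV - \<sigma> ` (A \<inter> (?Y - {a})))"
    proof
      fix y assume y: "y \<in> ?Y - insert a A"
      then have ya: "y \<in> ?Y - {a}" by blast
      have "\<sigma> y \<notin> \<sigma> ` (A \<inter> (?Y - {a}))"
      proof
        assume "\<sigma> y \<in> \<sigma> ` (A \<inter> (?Y - {a}))"
        then obtain w where "w \<in> A" "w \<in> ?Y - {a}" "\<sigma> y = \<sigma> w" by blast
        then have "y = w" using \<sigma> ya by (metis homeomorphism_apply1)
        then show False using y \<open>w \<in> A\<close> by blast
      qed
      then show "y \<in> \<sigma>' ` (UNIV - \<sigma> ` (A \<inter> (?Y - {a})))"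
        using homeomorphism_apply1[OF \<sigma> ya] by (metis DiffI UNIV_I imageI)
    qed
    show "\<sigma>' ` (UNIV - \<sigma> ` (A \<inter> (?Y - {a}))) \<subseteq> ?Y - insert a A"
    proof
      fix y assume "y \<in> \<sigma>' ` (UNIV - \<sigma> ` (A \<inter> (?Y - {a})))"
      then obtain w where w: "w \<notin> \<sigma> ` (A \<inter> (?Y - {a}))" "y = \<sigma>' w" by blast
      have ya: "y \<in> ?Y - {a}" using \<sigma> w(2) by (metis UNIV_I homeomorphism_image2 imageI)
      have "\<sigma> y = w" using \<sigma> w(2) by (metis UNIV_I homeomorphism_apply2)
      then have "y \<notin> A" using w(1) ya by blast
      then show "y \<in> ?Y - insert a A" using ya by blast
    qed
  qed
  have "connected (UNIV - \<sigma> ` (A \<inter> (?Y - {a})))"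
    using A by (intro connected_open_diff_countable connected_UNIV countable_finite) auto
  then have con: "connected (?Y - insert a A)"
    unfolding eq using \<sigma> by (intro connected_continuous_image) (auto simp: homeomorphism_def intro: continuous_on_subset)
  show ?thesis
  proof (rule connected_intermediate_closure[OF con])
    show "?Y - A \<subseteq> closure (?Y - insert a A)"
    proof
      fix y assume y: "y \<in> ?Y - A"
      show "y \<in> closure (?Y - insert a A)"
        unfolding closure_iff_nhds_not_empty
      proof (intro allI impI)
        fix B U assume "U \<subseteq> B" "open U" "y \<in> U"
        then have "openin (top_of_set ?Y) (?Y \<inter> U)" "?Y \<inter> U \<noteq> {}" using y by (auto intro: openin_open_Int)
        then have "infinite (?Y \<inter> U)" using perf by blast
        then have "\<not> ?Y \<inter> U \<subseteq> insert a A" using A finite_subset by blast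
        then show "(?Y - insert a A) \<inter> B \<noteq> {}" using \<open>U \<subseteq> B\<close> by blast
      qed
    qed
  qed auto
qed

section \<open>Riemann-Hurwitz for the torus\<close>

lemma circle_exp:
  assumes "x \<in> circle_set" "of_real (x 0) + \<i> * of_real (x 1) = exp L"
  shows "circle_point (Im L / (2 * pi)) = x"
proof -
  have "Re (of_real (x 0) + \<i> * of_real (x 1)) = Re (exp L)" "Im (of_real (x 0) + \<i> * of_real (x 1)) = Im (exp L)"
    using assms(2) by simp_all
  then have x01: "x 0 = exp (Re L) * cos (Im L)" "x 1 = exp (Re L) * sin (Im L)"
    by (simp_all add: Re_exp Im_exp)
  have "(exp (Re L))\<^sup>2 * ((cos (Im L))\<^sup>2 + (sin (Im L))\<^sup>2) = (x 0)\<^sup>2 + (x 1)\<^sup>2"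
    unfolding x01 by (simp only: power_mult_distrib distrib_left)
  then have "(exp (Re L))\<^sup>2 = 1" using assms(1) by (simp add: circle_set_iff)
  then have "exp (Re L) = 1 \<or> exp (Re L) = - 1" by (simp only: power2_eq_1_iff)
  then have e1: "exp (Re L) = 1" using exp_gt_zero[of "Re L"] by linarith
  have x0: "x i = 0" if "i > 1" for i using assms(1) that by (simp add: circle_set_iff)
  show ?thesis
  proof
    fix i :: nat
    consider "i = 0" | "i = 1" | "i > 1" by arith
    then show "circle_point (Im L / (2 * pi)) i = x i"
      using x01 x0 e1 by cases (auto simp: circle_point_def)
  qed
qed

text \<open>The plane is contractible, so the circle-valued map, viewed as a complex function
  without zeros, has a continuous logarithm; its imaginary part is the angle.\<close>

lemma circle_lift:
  fixes u :: "complex \<Rightarrow> nat \<Rightarrow> real"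
  assumes cont: "continuous_on UNIV u" and u: "\<And>z. u z \<in> circle_set"
  obtains v where "continuous_on UNIV v" "\<And>z. circle_point (v z) = u z"
proof -
  define A where "A z = of_real (u z 0) + \<i> * of_real (u z 1)" for z
  have "continuous_on UNIV A"
    unfolding A_def by (intro continuous_intros continuous_on_product_then_coordinatewise[OF cont])
  moreover have "A z \<noteq> 0" for z
  proof
    assume "A z = 0"
    then have "Re (A z) = 0" "Im (A z) = 0" by simp_all
    then have "u z 0 = 0" "u z 1 = 0" by (simp_all add: A_def)
    then show False using u[of z] by (simp add: circle_set_iff)
  qed
  moreover have "contractible (UNIV :: complex set)" by (simp add: contractible_UNIV)
  ultimately obtain L where L: "continuous_on UNIV L" "\<And>z. z \<in> UNIV \<Longrightarrow> A z = exp (L z)"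
    using continuous_logarithm_on_contractible[of UNIV A] by metis
  show ?thesis
  proof (rule that[of "\<lambda>z. Im (L z) / (2 * pi)"])
    show "continuous_on UNIV (\<lambda>z. Im (L z) / (2 * pi))"
      by (intro continuous_intros L) auto
    show "circle_point (Im (L z) / (2 * pi)) = u z" for z
      by (rule circle_exp[OF u]) (use L(2)[of z] in \<open>simp add: A_def\<close>)
  qed
qed

text \<open>Distinct Gaussian integers are at distance at least 1. This is what turns periods of a
  lift into constants.\<close>

lemma gauss_valued_constant:
  fixes D :: "complex \<Rightarrow> complex"
  assumes cont: "continuous_on UNIV D" and D: "\<And>z. \<exists>m n :: int. D z = of_int m + of_int n * \<i>"
  shows "\<exists>\<kappa>. \<forall>z. D z = \<kappa>"
proof -
  have far: "1 \<le> cmod (D y - D x)" if "D y \<noteq> D x" for x y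
  proof -
    obtain m n :: int where mn: "D x = of_int m + of_int n * \<i>" using D by blast
    obtain m' n' :: int where mn': "D y = of_int m' + of_int n' * \<i>" using D by blast
    have re: "Re (D y - D x) = of_int (m' - m)" "Im (D y - D x) = of_int (n' - n)"
      unfolding mn mn' by simp_all
    have "m' - m \<noteq> 0 \<or> n' - n \<noteq> 0" using that mn mn' by auto
    then have "\<bar>real_of_int (m' - m)\<bar> \<ge> 1 \<or> \<bar>real_of_int (n' - n)\<bar> \<ge> 1" by linarith
    then show ?thesis
      using abs_Re_le_cmod[of "D y - D x"] abs_Im_le_cmod[of "D y - D x"] unfolding re by linarith
  qed
  have "D constant_on UNIV"
    by (rule continuous_discrete_range_constant[OF connected_UNIV cont]) (use far in \<open>auto intro!: exI[of _ 1]\<close>)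
  then show ?thesis by (auto simp: constant_on_def)
qed

lemma torus_lift:
  fixes u :: "complex \<Rightarrow> (nat \<Rightarrow> real) \<times> (nat \<Rightarrow> real)"
  assumes cont: "continuous_on UNIV u" and u: "\<And>z. u z \<in> torus_set"
  obtains Q where "continuous_on UNIV Q" "\<And>z. torus_exp (Q z) = u z"
proof -
  have uu: "fst (u z) \<in> circle_set" "snd (u z) \<in> circle_set" for z using u[of z] by (auto simp: mem_Times_iff)
  obtain v where v: "continuous_on UNIV v" "\<And>z. circle_point (v z) = fst (u z)"
    using circle_lift[OF continuous_on_fst[OF cont] uu(1)] by blast
  obtain w where w: "continuous_on UNIV w" "\<And>z. circle_point (w z) = snd (u z)"
    using circle_lift[OF continuous_on_snd[OF cont] uu(2)] by blast
  show ?thesis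
  proof (rule that[of "\<lambda>z. of_real (v z) + \<i> * of_real (w z)"])
    show "continuous_on UNIV (\<lambda>z. of_real (v z) + \<i> * of_real (w z) :: complex)"
      by (intro continuous_intros v w)
    show "torus_exp (of_real (v z) + \<i> * of_real (w z)) = u z" for z
      by (simp add: torus_exp_def v w)
  qed
qed

text \<open>Passes from a period square to the torus. As no point of B has a lift on the boundary,
  each has exactly one lift in the open square.\<close>

lemma torus_bij_box:
  assumes B: "B \<subseteq> torus_set" and inner: "\<And>z. torus_exp z \<in> B \<Longrightarrow> z \<in> cbox a (a + 1 + \<i>) \<Longrightarrow> z \<in> box a (a + 1 + \<i>)"
  shows "bij_betw torus_exp {z \<in> box a (a + 1 + \<i>). torus_exp z \<in> B} B"
  unfolding bij_betw_def
proof
  show "inj_on torus_exp {z \<in> box a (a + 1 + \<i>). torus_exp z \<in> B}"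
  proof (rule inj_onI)
    fix z w assume "z \<in> {z \<in> box a (a + 1 + \<i>). torus_exp z \<in> B}" "w \<in> {z \<in> box a (a + 1 + \<i>). torus_exp z \<in> B}" and eq: "torus_exp z = torus_exp w"
    then have "z \<in> box a (a + 1 + \<i>)" "w \<in> box a (a + 1 + \<i>)" by auto
    then have "\<bar>Re (z - w)\<bar> < 1" "\<bar>Im (z - w)\<bar> < 1"
      by (auto simp: in_box_complex_iff)
    then show "z = w" by (rule torus_eq_close[OF eq])
  qed
  show "torus_exp ` {z \<in> box a (a + 1 + \<i>). torus_exp z \<in> B} = B"
  proof
    show "B \<subseteq> torus_exp ` {z \<in> box a (a + 1 + \<i>). torus_exp z \<in> B}"
    proof
      fix x assume x: "x \<in> B"
      then have "x \<in> torus_set" using B by blast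
      then obtain z where z: "z \<in> cbox a (a + 1 + \<i>)" "torus_exp z = x" by (rule torus_onto_square)
      then have "z \<in> box a (a + 1 + \<i>)" using inner x by blast
      then show "x \<in> torus_exp ` {z \<in> box a (a + 1 + \<i>). torus_exp z \<in> B}" using z x by (intro image_eqI[of _ _ z]) auto
    qed
  qed auto
qed

text \<open>A lift \<open>Q\<close> of \<open>q\<close> to the plane satisfies \<open>Q (z + \<mu>) = Q z + A \<mu>\<close> and has no poles, so the index sum
  counts critical points only.\<close>

theorem torus_unramified:
  assumes bc: "branched_covering T T q" and tT: "surf_top T = top_of_set torus_set" and x: "x \<in> torus_set"
  shows "local_degree T T q x = 1"
proof -
  let ?m = "local_degree T T q"
  interpret branched torus_set torus_set q ?m
    by (rule branched_covering_branched[OF bc tT tT compact_torus_set])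
  have cqt: "continuous_on UNIV (\<lambda>z. q (torus_exp z))"
    by (rule continuous_on_compose2[OF cont continuous_torus_exp]) (use torus_in in blast)
  have qt: "q (torus_exp z) \<in> torus_set" for z using im torus_in by blast
  obtain Q where Q: "continuous_on UNIV Q" "\<And>z. torus_exp (Q z) = q (torus_exp z)"
    by (rule torus_lift[OF cqt qt]) (rule that)
  \<comment> \<open>Two lifts of the same torus point differ by a lattice vector, and this vector
    depends continuously on z.\<close>
  have per: "\<exists>\<kappa>. \<forall>z. Q (z + \<mu>) - Q z = \<kappa>" if \<mu>: "\<And>z. torus_exp (z + \<mu>) = torus_exp z" for \<mu>
  proof (rule gauss_valued_constant)
    show "continuous_on UNIV (\<lambda>z. Q (z + \<mu>) - Q z)"
      by (intro continuous_intros continuous_on_compose2[OF Q(1)]) auto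
    show "\<exists>m n :: int. Q (z + \<mu>) - Q z = of_int m + of_int n * \<i>" for z
    proof -
      have "torus_exp (Q (z + \<mu>)) = torus_exp (Q z)" using Q(2) \<mu> by simp
      then obtain m n :: int where "Q (z + \<mu>) = Q z + of_int m + of_int n * \<i>"
        unfolding torus_eq_iff by (elim exE) (rule that)
      then have "Q (z + \<mu>) - Q z = of_int m + of_int n * \<i>" by simp
      then show ?thesis by blast
    qed
  qed
  have t1: "torus_exp (z + 1) = torus_exp z" "torus_exp (z + \<i>) = torus_exp z" for z
    using torus_shift[of z 1 0] torus_shift[of z 0 1] by simp_all
  obtain \<kappa>1 where \<kappa>1: "\<forall>z. Q (z + 1) - Q z = \<kappa>1" using per[of 1] t1 by blast
  obtain \<kappa>2 where \<kappa>2: "\<forall>z. Q (z + \<i>) - Q z = \<kappa>2" using per[of \<i>] t1 by blast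
  define e where "e z = ?m (torus_exp z)" for z
  have "\<exists>a. (\<forall>z\<in>({} \<union> {z. e z \<noteq> 1}) \<inter> cbox a (a + 1 + \<i>). z \<in> box a (a + 1 + \<i>)) \<and>
    (\<Sum>z\<in>({} \<union> {z. e z \<noteq> 1}) \<inter> box a (a + 1 + \<i>). if z \<in> {} then - 2 else int (e z) - 1) = 0"
  proof (rule doubly_periodic_index[where g = Q and ?\<kappa>1.0 = \<kappa>1 and ?\<kappa>2.0 = \<kappa>2])
    show "finite (({} \<union> {z. e z \<noteq> 1}) \<inter> cbox a b)" for a b
    proof -
      have "({} \<union> {z. e z \<noteq> 1}) \<inter> cbox a b = {z\<in>cbox a b. torus_exp z \<in> crit}"
        using torus_in by (auto simp: crit_def e_def)
      then show ?thesis using finite_torus_preimage[OF finite_crit] by simp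
    qed
    show "pow_at Q z (e z)" for z
    proof -
      obtain U V where pf: "power_form T T q (torus_exp z) U V (?m (torus_exp z))"
        using local_degree_local_mult[OF bc tT tT torus_in[of z]] by blast
      \<comment> \<open>Near z the lift Q stays in the ball around Q z, where it equals this inverse
        branch applied to the torus map q.\<close>
      obtain h where h: "homeomorphism (ball (Q z) (1/2)) (torus_exp ` ball (Q z) (1/2)) torus_exp h"
        by (rule torus_local_inverse)
      have "isCont Q z" using Q(1) by (simp add: continuous_on_eq_continuous_at)
      then obtain r1 where r1: "r1 > 0" "\<And>w. dist w z < r1 \<Longrightarrow> dist (Q w) (Q z) < 1/2"
        unfolding continuous_at_eps_delta by (metis half_gt_zero zero_less_one)
      show ?thesis
        unfolding e_def
      proof (rule pow_at_of_power_form[OF pf tT tT continuous_torus_exp _ refl torus_inj_ball])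
        show "range torus_exp \<subseteq> torus_set" using torus_in by blast
        show "openin (top_of_set torus_set) (torus_exp ` ball (Q z) (1/2))" by (rule torus_open) simp
        show "q (torus_exp z) \<in> torus_exp ` ball (Q z) (1/2)" unfolding Q(2)[symmetric] by simp
        show "continuous_on (torus_exp ` ball (Q z) (1/2)) h" using h by (simp add: homeomorphism_def)
        show "inj_on h (torus_exp ` ball (Q z) (1/2))"
          by (rule inj_on_inverseI[of _ torus_exp]) (rule homeomorphism_apply2[OF h])
        show "\<forall>w\<in>ball z r1. q (torus_exp w) \<in> torus_exp ` ball (Q z) (1/2) \<longrightarrow> Q w = h (q (torus_exp w))"
        proof (intro ballI impI)
          fix w assume "w \<in> ball z r1"
          then have "Q w \<in> ball (Q z) (1/2)" using r1(2)[of w] by (simp add: dist_commute)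
          from homeomorphism_apply1[OF h this] show "Q w = h (q (torus_exp w))" by (simp add: Q(2))
        qed
      qed (use r1 in auto)
    qed
    show "Q (z + 1) = Q z + \<kappa>1" "Q (z + \<i>) = Q z + \<kappa>2" for z
      using \<kappa>1 \<kappa>2 by (metis add.commute diff_add_cancel)+
  qed auto
  then obtain a where a: "\<forall>z\<in>{z. e z \<noteq> 1} \<inter> cbox a (a + 1 + \<i>). z \<in> box a (a + 1 + \<i>)"
    "(\<Sum>z\<in>{z. e z \<noteq> 1} \<inter> box a (a + 1 + \<i>). int (e z) - 1) = 0"
    by auto
  have fin: "finite ({z. e z \<noteq> 1} \<inter> box a (a + 1 + \<i>))"
  proof -
    have "{z. e z \<noteq> 1} \<inter> box a (a + 1 + \<i>) \<subseteq> {z\<in>cbox a (a + 1 + \<i>). torus_exp z \<in> crit}"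
      using torus_in box_subset_cbox[of a "a + 1 + \<i>"] by (auto simp: crit_def e_def)
    then show ?thesis using finite_torus_preimage[OF finite_crit] finite_subset by blast
  qed
  have e1: "e z \<ge> 1" for z using m_ge1[OF torus_in] by (simp add: e_def)
  \<comment> \<open>Without poles no term of the vanishing index sum is negative, so every term is
    zero.\<close>
  have "int (e z) - 1 \<ge> 0" for z using e1[of z] by simp
  then have "\<forall>z\<in>{z. e z \<noteq> 1} \<inter> box a (a + 1 + \<i>). int (e z) - 1 = 0"
    using a(2) sum_nonneg_eq_0_iff[OF fin, of "\<lambda>z. int (e z) - 1"] by simp
  then have none: "e z = 1" if "z \<in> box a (a + 1 + \<i>)" for z using that by force
  obtain z where z: "z \<in> cbox a (a + 1 + \<i>)" "torus_exp z = x" by (rule torus_onto_square[OF x])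
  then have "e z = 1" using a(1) none[of z] by blast
  then show ?thesis using z by (simp add: e_def)
qed

section \<open>Poles and the Riemann-Hurwitz count for p\<close>

text \<open>The coordinate 1/\<sigma> at the point a sent to infinity; the point with \<sigma> = 0
  has to be taken out. Continuity at a holds because the preimage of a closed disc under \<sigma> is
  compact and misses a, so \<sigma> is large near a.\<close>

lemma inverse_chart_at_infinity:
  fixes \<sigma> :: "'a::metric_space \<Rightarrow> complex"
  assumes \<sigma>: "homeomorphism (Y - {a}) UNIV \<sigma> \<sigma>'"
  defines "\<kappa> \<equiv> \<lambda>y. if y = a then 0 else inverse (\<sigma> y)"
  shows "continuous_on (Y - {\<sigma>' 0}) \<kappa>" "inj_on \<kappa> (Y - {\<sigma>' 0})"
proof -
  let ?L = "Y - {\<sigma>' 0}"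
  have s0: "\<sigma> y \<noteq> 0" if "y \<in> ?L" "y \<noteq> a" for y
    using that homeomorphism_apply1[OF \<sigma>, of y] by auto
  show "inj_on \<kappa> ?L"
  proof (rule inj_onI)
    fix y y' assume y: "y \<in> ?L" "y' \<in> ?L" "\<kappa> y = \<kappa> y'"
    consider "y = a" "y' = a" | "y = a" "y' \<noteq> a" | "y \<noteq> a" "y' = a" | "y \<noteq> a" "y' \<noteq> a" by blast
    then show "y = y'"
    proof cases
      case 4
      then have "\<sigma> y = \<sigma> y'" using y by (simp add: \<kappa>_def)
      moreover have "\<sigma>' (\<sigma> y) = y" "\<sigma>' (\<sigma> y') = y'"
        using homeomorphism_apply1[OF \<sigma>] y 4 by blast+
      ultimately show ?thesis by metis
    qed (use y s0 in \<open>auto simp: \<kappa>_def\<close>)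
  qed
  show "continuous_on ?L \<kappa>"
    unfolding continuous_on_eq_continuous_within
  proof
    fix y assume y: "y \<in> ?L"
    show "continuous (at y within ?L) \<kappa>"
    proof (cases "y = a")
      case False
      have "continuous_on (?L - {a}) (\<lambda>y. inverse (\<sigma> y))"
        using \<sigma> s0 by (intro continuous_on_inverse) (auto simp: homeomorphism_def intro: continuous_on_subset)
      then have "continuous_on (?L - {a}) \<kappa>"
        by (rule continuous_on_eq) (simp add: \<kappa>_def)
      then have "continuous (at y within ?L - {a}) \<kappa>"
        using y False by (simp add: continuous_on_eq_continuous_within)
      moreover have "at y within ?L - {a} = at y within ?L"
        by (rule at_within_nhd[of y "- {a}"]) (use False in auto)
      ultimately show ?thesis by simp
    next
      case True
      show ?thesis
        unfolding continuous_within_eps_delta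
      proof (intro allI impI)
        fix \<epsilon> :: real assume \<epsilon>: "\<epsilon> > 0"
        let ?K = "\<sigma>' ` cball 0 (1 / \<epsilon>)"
        have "continuous_on (cball 0 (1 / \<epsilon>)) \<sigma>'"
          using \<sigma> by (auto simp: homeomorphism_def intro: continuous_on_subset)
        then have "compact ?K" by (intro compact_continuous_image) auto
        then have "open (- ?K)" by (intro open_Compl compact_imp_closed)
        moreover have "a \<notin> ?K" using homeomorphism_image2[OF \<sigma>] by auto
        ultimately obtain \<delta> where \<delta>: "\<delta> > 0" "ball a \<delta> \<subseteq> - ?K" by (meson ComplI open_contains_ball)
        have "dist (\<kappa> y') (\<kappa> y) < \<epsilon>" if y': "y' \<in> ?L" "dist y' y < \<delta>" for y'
        proof (cases "y' = a")
          case False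
          have "y' \<in> ball a \<delta>" using y'(2) True by (simp add: dist_commute)
          then have "y' \<notin> ?K" using \<delta>(2) by blast
          moreover have "y' = \<sigma>' (\<sigma> y')" using homeomorphism_apply1[OF \<sigma>, of y'] y' False by simp
          ultimately have "\<sigma> y' \<notin> cball 0 (1 / \<epsilon>)" by (metis imageI)
          then have "1 / \<epsilon> < cmod (\<sigma> y')" by simp
          then have "inverse (cmod (\<sigma> y')) < \<epsilon>"
            using \<epsilon> by (metis inverse_eq_divide inverse_inverse_eq less_imp_inverse_less positive_imp_inverse_positive)
          then show ?thesis using True False by (simp add: \<kappa>_def norm_inverse)
        qed (use True \<epsilon> in simp)
        then show "\<exists>d>0. \<forall>x'\<in>?L. dist x' y < d \<longrightarrow> dist (\<kappa> x') (\<kappa> y) < \<epsilon>"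
          using \<delta>(1) by blast
      qed
    qed
  qed
qed

text \<open>With a sent to infinity, each of the deg p points over a becomes a simple pole of index
  -2, and every critical point x contributes m x - 1. The sum is 0, in accordance with the Euler
  characteristics 0 and 2.\<close>

theorem torus_riemann_hurwitz:
  fixes S :: "(nat \<Rightarrow> real) surface"
  assumes bc: "branched_covering T S p" and tT: "surf_top T = top_of_set torus_set"
    and tS: "surf_top S = top_of_set (topspace (nsphere 2))"
  defines "m \<equiv> local_degree T S p"
  shows "(\<Sum>x | x \<in> torus_set \<and> m x \<noteq> 1. int (m x) - 1) = 2 * int (branched.deg torus_set (topspace (nsphere 2)) p m)"
proof -
  let ?Y = "topspace (nsphere 2)"
  interpret branched torus_set ?Y p m
    unfolding m_def by (rule branched_covering_branched[OF bc tT tS compact_torus_set])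
  have "infinite ?Y" using perf neY by auto
  then have "\<not> ?Y \<subseteq> p ` crit" using finite_subset[OF _ finite_crit_values] by metis
  \<comment> \<open>Choosing a off the branch values makes all poles simple and separates them from
    the critical points.\<close>
  then obtain a where a: "a \<in> ?Y" "a \<notin> p ` crit"
    by (meson subsetI)
  have ma: "m x = 1" if "x \<in> F a" for x using that a(2) by (auto simp: crit_def)
  obtain \<sigma> :: "(nat \<Rightarrow> real) \<Rightarrow> complex" and \<sigma>' where \<sigma>: "homeomorphism (?Y - {a}) UNIV \<sigma> \<sigma>'"
    by (rule sphere2_punctured[OF a(1)])
  define \<kappa> where "\<kappa> y = (if y = a then 0 else inverse (\<sigma> y))" for y
  note \<kappa> = inverse_chart_at_infinity[OF \<sigma>, folded \<kappa>_def]
  have \<kappa>': "continuous_on (?Y - {\<sigma>' 0}) \<kappa>" "inj_on \<kappa> (?Y - {\<sigma>' 0})"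
    using \<kappa> by (simp_all add: \<kappa>_def[abs_def])
  \<comment> \<open>The value 0 at a pole is a placeholder: the pole hypothesis of the index theorem
    constrains g only off the pole.\<close>
  define g where "g z = (if p (torus_exp z) = a then 0 else \<sigma> (p (torus_exp z)))" for z
  define Pol where "Pol = {z. p (torus_exp z) = a}"
  define e where "e z = m (torus_exp z)" for z
  have ptor: "p (torus_exp z) \<in> ?Y" for z using im torus_in by blast
  define B where "B = F a \<union> crit"
  have Bd: "Pol \<union> {z. e z \<noteq> 1} = {z. torus_exp z \<in> B}"
    using torus_in by (auto simp: Pol_def e_def B_def crit_def)
  have finB: "finite B" unfolding B_def using finite_fibre[OF a(1)] finite_crit by simp
  have BT: "B \<subseteq> torus_set" by (auto simp: B_def crit_def)
  have "\<exists>c. (\<forall>z\<in>(Pol \<union> {z. e z \<noteq> 1}) \<inter> cbox c (c + 1 + \<i>). z \<in> box c (c + 1 + \<i>)) \<and>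
    (\<Sum>z\<in>(Pol \<union> {z. e z \<noteq> 1}) \<inter> box c (c + 1 + \<i>). if z \<in> Pol then - 2 else int (e z) - 1) = 0"
  proof (rule doubly_periodic_index[where g = g and ?\<kappa>1.0 = 0 and ?\<kappa>2.0 = 0])
    show "finite ((Pol \<union> {z. e z \<noteq> 1}) \<inter> cbox b c)" for b c
      unfolding Bd using finite_torus_preimage[OF finB, of b c] by (simp add: Int_def conj_commute)
    show "pow_at g z (e z)" if z: "z \<notin> Pol" for z
    proof -
      obtain U V where pf: "power_form T S p (torus_exp z) U V (m (torus_exp z))"
        using local_degree_local_mult[OF bc tT tS torus_in[of z]] unfolding m_def by blast
      show ?thesis
        unfolding e_def
      proof (rule pow_at_of_power_form[OF pf tT tS continuous_torus_exp _ refl torus_inj_ball])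
        show "range torus_exp \<subseteq> torus_set" using torus_in by blast
        show "openin (top_of_set ?Y) (?Y - {a})" by (rule openin_delete) simp
        show "p (torus_exp z) \<in> ?Y - {a}" using z ptor by (simp add: Pol_def)
        show "continuous_on (?Y - {a}) \<sigma>" using \<sigma> by (simp add: homeomorphism_def)
        show "inj_on \<sigma> (?Y - {a})" by (rule inj_on_inverseI[of _ \<sigma>']) (rule homeomorphism_apply1[OF \<sigma>])
        show "\<forall>w\<in>ball z 1. p (torus_exp w) \<in> ?Y - {a} \<longrightarrow> g w = \<sigma> (p (torus_exp w))" by (simp add: g_def)
      qed auto
    qed
    show "\<exists>r>0. \<exists>u. continuous_on (ball z r) u \<and> inj_on u (ball z r) \<and> u z = 0 \<and>
        (\<forall>w\<in>ball z r. w \<noteq> z \<longrightarrow> g w = inverse (u w))" if z: "z \<in> Pol" for z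
    proof -
      let ?L = "?Y - {\<sigma>' 0}"
      have pz: "p (torus_exp z) = a" using z by (simp add: Pol_def)
      have "\<sigma>' 0 \<noteq> a" using homeomorphism_image2[OF \<sigma>] by auto
      then have aL: "a \<in> ?L" using a(1) by simp
      have "openin (top_of_set ?Y) ?L" by (rule openin_delete) simp
      then have oL: "openin (top_of_set torus_set) (torus_set \<inter> p -` ?L)"
        using continuous_openin_preimage[OF cont, of ?Y ?L] im by auto
      have zL: "torus_exp z \<in> torus_set \<inter> p -` ?L" using aL pz torus_in[of z] by simp
      have m1: "m (torus_exp z) = 1" using ma[of "torus_exp z"] pz torus_in[of z] by simp
      from local_inj[OF torus_in m1 oL zL] obtain W where W: "openin (top_of_set torus_set) W" "torus_exp z \<in> W" "W \<subseteq> torus_set \<inter> p -` ?L" "inj_on p W"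
        by (elim exE conjE) (rule that)
      have "openin (top_of_set UNIV) (UNIV \<inter> torus_exp -` W)"
        by (rule continuous_openin_preimage[OF continuous_torus_exp _ W(1)]) (use torus_in in blast)
      then have "open (torus_exp -` W)" by simp
      then obtain r0 where r0: "r0 > 0" "ball z r0 \<subseteq> torus_exp -` W" using W(2) by (meson open_contains_ball vimageI)
      define r where "r = min r0 (1/2)"
      have r: "r > 0" "ball z r \<subseteq> ball z r0" "ball z r \<subseteq> ball z (1/2)" using r0(1) by (auto simp: r_def)
      have tW: "torus_exp w \<in> W" "p (torus_exp w) \<in> ?L" if "w \<in> ball z r" for w
        using subsetD[OF r0(2) subsetD[OF r(2) that]] W(3) by blast+
      have injt: "inj_on (\<lambda>w. p (torus_exp w)) (ball z r)"
      proof (rule inj_onI)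
        fix w w' assume w: "w \<in> ball z r" "w' \<in> ball z r" "p (torus_exp w) = p (torus_exp w')"
        then have "torus_exp w = torus_exp w'" using inj_onD[OF W(4)] tW by blast
        then show "w = w'" using inj_onD[OF torus_inj_ball] w r(3) by blast
      qed
      define u where "u w = \<kappa> (p (torus_exp w))" for w
      have cpt: "continuous_on (ball z r) (\<lambda>w. p (torus_exp w))"
        by (rule continuous_on_compose2[OF cont continuous_torus_exp]) (use torus_in in blast)
      have "continuous_on (ball z r) u"
        unfolding u_def[abs_def] by (rule continuous_on_compose2[OF \<kappa>'(1) cpt]) (rule image_subsetI, rule tW(2))
      moreover have "inj_on u (ball z r)"
      proof (rule inj_onI)
        fix w w' assume w: "w \<in> ball z r" "w' \<in> ball z r" "u w = u w'"
        then have "p (torus_exp w) = p (torus_exp w')" using inj_onD[OF \<kappa>'(2)] tW unfolding u_def by blast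
        then show "w = w'" using inj_onD[OF injt] w by blast
      qed
      moreover have "u z = 0" by (simp add: u_def pz \<kappa>_def)
      moreover have "g w = inverse (u w)" if w: "w \<in> ball z r" "w \<noteq> z" for w
      proof -
        have "p (torus_exp w) \<noteq> a"
        proof
          assume "p (torus_exp w) = a"
          then have "w = z" using inj_onD[OF injt, of w z] w(1) r(1) pz by simp
          then show False using w(2) by simp
        qed
        then show ?thesis by (simp add: u_def g_def \<kappa>_def)
      qed
      ultimately show ?thesis using r(1) by blast
    qed
    show "g (z + 1) = g z + 0" "g (z + \<i>) = g z + 0" for z
      using torus_shift[of z 1 0] torus_shift[of z 0 1] by (simp_all add: g_def)
  qed
  then obtain c where c: "\<forall>z\<in>{z. torus_exp z \<in> B} \<inter> cbox c (c + 1 + \<i>). z \<in> box c (c + 1 + \<i>)"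
    "(\<Sum>z\<in>{z. torus_exp z \<in> B} \<inter> box c (c + 1 + \<i>). if z \<in> Pol then - 2 else int (e z) - 1) = 0"
    unfolding Bd by blast
  define W where "W x = (if p x = a then - 2 else int (m x) - 1)" for x
  have bij: "bij_betw torus_exp {z \<in> box c (c + 1 + \<i>). torus_exp z \<in> B} B"
    by (rule torus_bij_box[OF BT]) (use c(1) in blast)
  have "(\<Sum>x\<in>B. W x) = (\<Sum>z | z \<in> box c (c + 1 + \<i>) \<and> torus_exp z \<in> B. W (torus_exp z))"
    using sum.reindex_bij_betw[OF bij, of W] by simp
  also have "\<dots> = (\<Sum>z\<in>{z. torus_exp z \<in> B} \<inter> box c (c + 1 + \<i>). if z \<in> Pol then - 2 else int (e z) - 1)"
    by (rule sum.cong) (auto simp: W_def Pol_def e_def)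
  finally have "sum W B = 0" using c(2) by simp
  moreover have "sum W B = sum W (F a) + sum W crit"
    unfolding B_def using finite_fibre[OF a(1)] finite_crit ma by (intro sum.union_disjoint) (auto simp: crit_def)
  moreover have "sum W (F a) = - 2 * int deg"
    using card_F_unram[OF a(1) ma] by (simp add: W_def)
  moreover have "sum W crit = (\<Sum>x | x \<in> torus_set \<and> m x \<noteq> 1. int (m x) - 1)"
    using a(2) by (intro sum.cong) (auto simp: W_def crit_def)
  ultimately show ?thesis by simp
qed

section \<open>Uniform multiplicities give the orbifold\<close>

theorem theorem1p2:
  fixes S :: "(nat \<Rightarrow> real) surface"
    and T :: "((nat \<Rightarrow> real) \<times> (nat \<Rightarrow> real)) surface"
    and f :: "(nat \<Rightarrow> real) \<Rightarrow> (nat \<Rightarrow> real)"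
    and p :: "(nat \<Rightarrow> real) \<times> (nat \<Rightarrow> real) \<Rightarrow> (nat \<Rightarrow> real)"
    and q :: "(nat \<Rightarrow> real) \<times> (nat \<Rightarrow> real) \<Rightarrow> (nat \<Rightarrow> real) \<times> (nat \<Rightarrow> real)"
  assumes "oriented_surface S" and "surf_top S = nsphere 2"
    and "oriented_surface T" and "surf_top T = prod_topology (nsphere 1) (nsphere 1)"
    and "branched_covering S S f"
    and "branched_covering T S p"
    and "branched_covering T T q"
    and "global_degree S S f \<ge> 2"
    and "\<forall>z \<in> topspace (surf_top T). f (p z) = p (q z)"
  shows "\<exists>\<nu> :: (nat \<Rightarrow> real) \<Rightarrow> nat.
           is_orbifold (S, \<nu>) \<and> orbifold_euler_char (S, \<nu>) = 0 \<and>
           orbifold_covering (nonramified T) (nonramified T) q \<and>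
           orbifold_covering (nonramified T) (S, \<nu>) p \<and>
           orbifold_covering (S, \<nu>) (S, \<nu>) f"
proof -
  let ?Y = "topspace (nsphere 2)"
  have tS: "surf_top S = top_of_set ?Y" using assms(2) nsphere_top[of 2] by simp
  have tT: "surf_top T = top_of_set torus_set"
    using nsphere_top[of 1] assms(4) by (metis circle_set_def prod_topology_subtopology_eu)
  let ?mp = "local_degree T S p" and ?mf = "local_degree S S f" and ?mq = "local_degree T T q"
  interpret p: branched torus_set ?Y p ?mp
    by (rule branched_covering_branched[OF assms(6) tT tS compact_torus_set])
  interpret q: branched torus_set torus_set q ?mq
    by (rule branched_covering_branched[OF assms(7) tT tT compact_torus_set])
  interpret f: branched ?Y ?Y f ?mf
    by (rule branched_covering_branched[OF assms(5) tS tS compact_nsphere2])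
  have mq: "?mq x = 1" if "x \<in> torus_set" for x
    by (rule torus_unramified[OF assms(7) tT that])
  interpret semiconjugacy torus_set ?Y p ?mp f ?mf q ?mq
  proof
    show "f (p x) = p (q x)" if "x \<in> torus_set" for x using bspec[OF assms(9), of x] tT that by simp
    show "connected (?Y - A)" if "finite A" for A
      by (rule connected_sphere2_cofinite[OF p.perf that])
    show "f.deg \<ge> 2"
      using global_degree_deg[OF f.branched_axioms tS tS] assms(8) by simp
  qed (rule mq)
  \<comment> \<open>By \<open>uniform\<close> all points over w have the same multiplicity, so any
    choice of preimage gives the same number. Off the sphere the value 1 is a default.\<close>
  define \<nu> where "\<nu> w = (if w \<in> ?Y then ?mp (SOME x. x \<in> p.F w) else 1)" for w
  have \<nu>: "\<nu> (p x) = ?mp x" if "x \<in> torus_set" for x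
  proof -
    have pY: "p x \<in> ?Y" by (rule pX[OF that])
    have xF: "x \<in> p.F (p x)" using that by simp
    have "?mp (SOME y. y \<in> p.F (p x)) = ?mp x"
      by (rule uniform[OF pY someI[of "\<lambda>y. y \<in> p.F (p x)", OF xF] xF])
    then show ?thesis using pY by (simp add: \<nu>_def)
  qed
  have lift: "\<exists>x\<in>torus_set. p x = w" if "w \<in> ?Y" for w using p.fibre_nonempty[OF that] by blast
  have \<nu>1: "\<nu> w \<ge> 1" if "w \<in> ?Y" for w
  proof -
    obtain x where x: "x \<in> torus_set" "p x = w" using lift[OF \<open>w \<in> ?Y\<close>] by blast
    then show ?thesis using \<nu>[OF x(1)] p.m_ge1[OF x(1)] by simp
  qed
  define R where "R = {w\<in>?Y. \<nu> w \<noteq> 1}"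
  \<comment> \<open>This gives finiteness of the ramified points, hence isolatedness, and lets the
    Euler sum be compared with the critical points of p.\<close>
  have RP: "R = branch_values"
  proof
    show "R \<subseteq> branch_values"
    proof
      fix w assume w: "w \<in> R"
      then obtain x where x: "x \<in> torus_set" "p x = w" using lift[of w] by (auto simp: R_def)
      then have "?mp x \<noteq> 1" using \<nu>[OF x(1)] w by (simp add: R_def)
      then show "w \<in> branch_values" using x unfolding branch_values_def p.crit_def by blast
    qed
    show "branch_values \<subseteq> R"
    proof
      fix w assume "w \<in> branch_values"
      then obtain x where x: "x \<in> torus_set" "?mp x \<noteq> 1" "w = p x" unfolding branch_values_def p.crit_def by blast
      then show "w \<in> R" using \<nu>[OF x(1)] pX[OF x(1)] by (simp add: R_def)
    qed
  qed
  have finR: "finite R" using finite_branch_values RP by simp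
  have orb: "is_orbifold (S, \<nu>)"
  proof -
    have "Hausdorff_space (surf_top S)" using assms(1) by (simp add: oriented_surface_def)
    then have "t1_space (surf_top S)" by (rule Hausdorff_imp_t1_space)
    then have "surf_top S derived_set_of R = {}" using finR t1_space_derived_set_of_finite by blast
    moreover have "R = {z \<in> topspace (surf_top S). \<nu> z \<noteq> 1}" by (simp add: R_def tS)
    ultimately show ?thesis
      using assms(1) \<nu>1 by (simp add: is_orbifold_def tS)
  qed
  have orbT: "is_orbifold (nonramified T)"
    using assms(3) by (simp add: is_orbifold_def nonramified_def)
  have cov_q: "orbifold_covering (nonramified T) (nonramified T) q"
    using orbT assms(7) mq by (simp add: orbifold_covering_def nonramified_def tT)
  have cov_p: "orbifold_covering (nonramified T) (S, \<nu>) p"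
    using orbT orb assms(6) \<nu> by (simp add: orbifold_covering_def nonramified_def tT)
  have "\<nu> (f z) = \<nu> z * ?mf z" if z: "z \<in> ?Y" for z
  proof -
    obtain x where x: "x \<in> torus_set" "p x = z" using lift[OF z] by blast
    have "\<nu> (f z) = \<nu> (p (q x))" using comm[OF x(1)] x(2) by simp
    also have "\<dots> = ?mp (q x)" by (rule \<nu>[OF qX[OF x(1)]])
    also have "\<dots> = ?mf z * ?mp x" using mult_step[OF x(1)] x(2) by simp
    finally show ?thesis using \<nu>[OF x(1)] x(2) by simp
  qed
  then have cov_f: "orbifold_covering (S, \<nu>) (S, \<nu>) f"
    using orb assms(5) by (simp add: orbifold_covering_def tS)
  have deg_card: "p.deg = card (p.F w) * \<nu> w" if w: "w \<in> ?Y" for w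
  proof -
    have "sum ?mp (p.F w) = sum (\<lambda>_. \<nu> w) (p.F w)" using \<nu> by (intro sum.cong) auto
    then show ?thesis using p.deg[OF w] by simp
  qed
  \<comment> \<open>By uniformity deg p is the product of \<nu> w and the number of points over w,
    so both sides equal that number times 1 - \<nu> w.\<close>
  have contrib: "real p.deg * (1 / real (\<nu> w) - 1) = - (\<Sum>x\<in>p.F w. real (?mp x) - 1)" if w: "w \<in> ?Y" for w
  proof -
    have "(\<Sum>x\<in>p.F w. real (?mp x) - 1) = (\<Sum>x\<in>p.F w. real (\<nu> w) - 1)"
      using \<nu> by (intro sum.cong) auto
    also have "\<dots> = real (card (p.F w)) * (real (\<nu> w) - 1)" by simp
    finally have 1: "(\<Sum>x\<in>p.F w. real (?mp x) - 1) = real (card (p.F w)) * (real (\<nu> w) - 1)" .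
    have "real (\<nu> w) \<noteq> 0" using \<nu>1[OF w] by simp
    moreover have "real p.deg = real (card (p.F w)) * real (\<nu> w)" using deg_card[OF w] by simp
    ultimately show ?thesis unfolding 1 by (simp add: field_simps)
  qed
  have RY: "R \<subseteq> ?Y" by (auto simp: R_def)
  have "real p.deg * (\<Sum>w\<in>R. 1 / real (\<nu> w) - 1) = - (\<Sum>w\<in>R. \<Sum>x\<in>p.F w. real (?mp x) - 1)"
    using contrib RY by (simp add: sum_distrib_left subset_iff flip: sum_negf)
  \<comment> \<open>Noncritical points contribute 0, and every critical point lies over R.\<close>
  also have "(\<Sum>w\<in>R. \<Sum>x\<in>p.F w. real (?mp x) - 1) = (\<Sum>x\<in>p.crit. real (?mp x) - 1)"
  proof -
    have "(\<Sum>x\<in>p.F w. real (?mp x) - 1) = (\<Sum>x | x \<in> p.crit \<and> p x = w. real (?mp x) - 1)" if "w \<in> R" for w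
      using p.finite_fibre[of w] that RY by (intro sum.mono_neutral_right) (auto simp: p.crit_def)
    then have "(\<Sum>w\<in>R. \<Sum>x\<in>p.F w. real (?mp x) - 1) = (\<Sum>w\<in>R. \<Sum>x | x \<in> p.crit \<and> p x = w. real (?mp x) - 1)"
      by simp
    also have "\<dots> = (\<Sum>x\<in>p.crit. real (?mp x) - 1)"
      by (rule sum_fibres[OF p.finite_crit _ finR]) (simp add: RP branch_values_def)
    finally show ?thesis .
  qed
  also have "\<dots> = of_int (\<Sum>x\<in>p.crit. int (?mp x) - 1)" by simp
  also have "(\<Sum>x\<in>p.crit. int (?mp x) - 1) = 2 * int p.deg"
    unfolding p.crit_def by (rule torus_riemann_hurwitz[OF assms(6) tT tS])
  finally have "real p.deg * (\<Sum>w\<in>R. 1 / real (\<nu> w) - 1) = real p.deg * (- 2)" by simp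
  moreover have "real p.deg \<noteq> 0" using p.deg_pos by simp
  ultimately have "(\<Sum>w\<in>R. 1 / real (\<nu> w) - 1) = - 2" by (simp only: mult_cancel_left) simp
  then have "orbifold_euler_char (S, \<nu>) = 0"
    using euler_char_nsphere2 by (simp add: orbifold_euler_char_def assms(2) R_def)
  then show ?thesis using orb cov_q cov_p cov_f by blast
qed

end
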